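(* Let $G$ be an $m$-uniform hypergraph without isolated nodes in which every connected component is properly connected. Then $j(I(G))\neq0$ if and only if, for each connected component of $G$, all nodes of that component are pivot equivalent to each other.
   Context: A hypergraph $G$ has a finite non-empty node set $V(G)=\{x_1,\dots,x_n\}$ and an edge set $E(G)$ consisting of subsets of $V(G)$; it is $m$-uniform ($m\ge1$) if every edge has exactly $m$ elements. A node is isolated if it lies in no edge. Fix a field $\Bbbk$ and view nodes as indeterminates; the edge ideal is $I(G)=(x_{i_1}\cdots x_{i_m}:\{x_{i_1},\dots,x_{i_m}\}\in E(G))\subset R=\Bbbk[x_1,\dots,x_n]_{(x_1,\dots,x_n)}$. For an ideal $I$ in a Noetherian local ring $(R,\mathfrak m)$ of dimension $n\ge1$, the $j$-multiplicity is $j(I)=(n-1)!\lim_{t\to\infty}\lambda_R(\Gamma_{\mathfrak m}(I^t/I^{t+1}))/t^{n-1}$, where $\lambda_R$ is length and $\Gamma_{\mathfrak m}$ is the zeroth local cohomology. $G$ is connected if any two nodes can be joined by a sequence of edges, the first containing one node and the last the other, with consecutive edges sharing a node. An $m$-uniform hypergraph is properly connected if for any two edges $u,v$ there is a sequence of edges starting with $u$ and ending with $v$ such that consecutive edges intersect in exactly $m-1$ nodes. Pivot equivalence: $x_i\approx x_j$ if there is a subset $A\subset V(G)\setminus\{x_i,x_j\}$ such that $\{x_i\}\cup A$ and $\{x_j\}\cup A$ are both edges; two nodes are pivot equivalent if they are linked by a chain $x_i=x_{i_1}\approx\cdots\approx x_{i_r}=x_j$. *)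

theory Defs
  imports
    "HOL-Library.Poly_Mapping"
    "HOL-Library.Extended_Real"
    "HOL-Algebra.Ideal_Product"
    "HOL-Algebra.QuotRing"
    "HOL-Algebra.Module"
begin

section \<open>Commutative algebra\<close>

subsection \<open>Localization of a commutative ring\<close>

text \<open>The fraction \<open>a / s\<close> is the class of \<open>(a, s)\<close> in \<open>R \<times> S\<close> for the relation
  \<open>(a, s) \<sim> (b, t) \<longleftrightarrow> (\<exists>u \<in> S. u (t a - s b) = 0)\<close>. The unions in the ring operations run
  over all representatives, on each of which the value is the same.\<close>

definition loc_frac :: "('a, 'b) ring_scheme \<Rightarrow> 'a set \<Rightarrow> 'a \<Rightarrow> 'a \<Rightarrow> ('a \<times> 'a) set" where
  "loc_frac R S a s = {(b, t). b \<in> carrier R \<and> t \<in> S \<and>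
     (\<exists>u\<in>S. u \<otimes>\<^bsub>R\<^esub> (t \<otimes>\<^bsub>R\<^esub> a \<ominus>\<^bsub>R\<^esub> s \<otimes>\<^bsub>R\<^esub> b) = \<zero>\<^bsub>R\<^esub>)}"

definition localization :: "('a, 'b) ring_scheme \<Rightarrow> 'a set \<Rightarrow> ('a \<times> 'a) set ring" where
  "localization R S = \<lparr>
     carrier = {loc_frac R S a s | a s. a \<in> carrier R \<and> s \<in> S},
     mult = (\<lambda>X Y. \<Union>(a, s)\<in>X. \<Union>(b, t)\<in>Y. loc_frac R S (a \<otimes>\<^bsub>R\<^esub> b) (s \<otimes>\<^bsub>R\<^esub> t)),
     one = loc_frac R S \<one>\<^bsub>R\<^esub> \<one>\<^bsub>R\<^esub>,
     zero = loc_frac R S \<zero>\<^bsub>R\<^esub> \<one>\<^bsub>R\<^esub>,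
     add = (\<lambda>X Y. \<Union>(a, s)\<in>X. \<Union>(b, t)\<in>Y.
              loc_frac R S (a \<otimes>\<^bsub>R\<^esub> t \<oplus>\<^bsub>R\<^esub> b \<otimes>\<^bsub>R\<^esub> s) (s \<otimes>\<^bsub>R\<^esub> t))\<rparr>"

subsection \<open>Krull dimension and the maximal ideal of a local ring\<close>

definition krull_dim :: "('a, 'b) ring_scheme \<Rightarrow> enat" where
  "krull_dim R = (SUP n \<in> {n. \<exists>P. (\<forall>i\<le>n. primeideal (P i) R) \<and> (\<forall>i<n. P i \<subset> P (Suc i))}. enat n)"

definition max_ideal :: "('a, 'b) ring_scheme \<Rightarrow> 'a set" where
  "max_ideal R = (THE M. maximalideal M R)"

definition ideal_power :: "('a, 'b) ring_scheme \<Rightarrow> 'a set \<Rightarrow> nat \<Rightarrow> 'a set" where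
  "ideal_power R I t = I [^]\<^bsub>ideals_set R\<^esub> t"

subsection \<open>Modules\<close>

text \<open>Module records extend ring records. The fields \<open>mult\<close> and \<open>one\<close> play no role in the theory
  of modules.\<close>

definition ideal_module :: "('a, 'b) ring_scheme \<Rightarrow> 'a set \<Rightarrow> ('a, 'a) module" where
  "ideal_module R I = \<lparr>carrier = I, mult = mult R, one = one R, zero = zero R, add = add R,
     smult = mult R\<rparr>"

definition quot_module :: "('a, 'c, 'd) module_scheme \<Rightarrow> 'c set \<Rightarrow> ('a, 'c set) module" where
  "quot_module M N = \<lparr>carrier = a_rcosets\<^bsub>M\<^esub> N, mult = undefined, one = undefined, zero = N,
     add = set_add M, smult = (\<lambda>r X. \<Union>x\<in>X. N +>\<^bsub>M\<^esub> (r \<odot>\<^bsub>M\<^esub> x))\<rparr>"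

definition module_length :: "('a, 'b) ring_scheme \<Rightarrow> ('a, 'c, 'd) module_scheme \<Rightarrow> enat" where
  "module_length R M = (SUP n \<in> {n. \<exists>N. (\<forall>i\<le>n. submodule (N i) R M) \<and>
     (\<forall>i<n. N i \<subset> N (Suc i))}. enat n)"

text \<open>The zeroth local cohomology of \<open>M\<close> with support in \<open>J\<close>: the submodule of the elements
  annihilated by some power of \<open>J\<close>.\<close>

definition local_cohomology_0 ::
  "('a, 'b) ring_scheme \<Rightarrow> 'a set \<Rightarrow> ('a, 'c, 'd) module_scheme \<Rightarrow> ('a, 'c, 'd) module_scheme" where
  "local_cohomology_0 R J M = M\<lparr>carrier :=
     {x \<in> carrier M. \<exists>k. \<forall>a\<in>ideal_power R J k. a \<odot>\<^bsub>M\<^esub> x = \<zero>\<^bsub>M\<^esub>}\<rparr>"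

subsection \<open>The j-multiplicity\<close>

text \<open>\<open>R\<close> is meant to be a Noetherian local ring of finite dimension at least 1. Lengths are
  possibly infinite a priori, so the limit is taken in the extended reals.\<close>

definition j_multiplicity :: "('a, 'b) ring_scheme \<Rightarrow> 'a set \<Rightarrow> ereal" where
  "j_multiplicity R I = (let n = the_enat (krull_dim R) in
     ereal (fact (n - 1)) *
     lim (\<lambda>t. ereal_of_enat (module_length R (local_cohomology_0 R (max_ideal R)
                (quot_module (ideal_module R (ideal_power R I t)) (ideal_power R I (Suc t)))))
              / ereal (real t ^ (n - 1))))"

section \<open>Hypergraphs\<close>

definition hypergraph :: "'v set \<Rightarrow> 'v set set \<Rightarrow> bool" where
  "hypergraph V E \<longleftrightarrow> finite V \<and> V \<noteq> {} \<and> E \<subseteq> Pow V"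

definition uniform :: "nat \<Rightarrow> 'v set set \<Rightarrow> bool" where
  "uniform m E \<longleftrightarrow> (\<forall>e\<in>E. card e = m)"

definition isolated_node :: "'v set set \<Rightarrow> 'v \<Rightarrow> bool" where
  "isolated_node E v \<longleftrightarrow> (\<forall>e\<in>E. v \<notin> e)"

definition connected_hypergraph :: "'v set \<Rightarrow> 'v set set \<Rightarrow> bool" where
  "connected_hypergraph V E \<longleftrightarrow> (\<forall>x\<in>V. \<forall>y\<in>V. x \<noteq> y \<longrightarrow>
     (\<exists>es. es \<noteq> [] \<and> set es \<subseteq> E \<and> x \<in> hd es \<and> y \<in> last es \<and>
           successively (\<lambda>u v. u \<inter> v \<noteq> {}) es))"

definition induced_edges :: "'v set set \<Rightarrow> 'v set \<Rightarrow> 'v set set" where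
  "induced_edges E W = {e \<in> E. e \<subseteq> W}"

text \<open>A connected component is identified with its node set \<open>W\<close>. As a hypergraph it is
  \<open>(W, induced_edges E W)\<close>.\<close>

definition connected_components :: "'v set \<Rightarrow> 'v set set \<Rightarrow> 'v set set" where
  "connected_components V E = {W. W \<subseteq> V \<and> W \<noteq> {} \<and> connected_hypergraph W (induced_edges E W) \<and>
     (\<forall>W'. W \<subseteq> W' \<and> W' \<subseteq> V \<and> connected_hypergraph W' (induced_edges E W') \<longrightarrow> W' = W)}"

definition properly_connected :: "nat \<Rightarrow> 'v set set \<Rightarrow> bool" where
  "properly_connected m E \<longleftrightarrow> (\<forall>u\<in>E. \<forall>v\<in>E.
     \<exists>es. es \<noteq> [] \<and> set es \<subseteq> E \<and> hd es = u \<and> last es = v \<and>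
          successively (\<lambda>e f. card (e \<inter> f) = m - 1) es)"

definition pivot :: "'v set \<Rightarrow> 'v set set \<Rightarrow> 'v \<Rightarrow> 'v \<Rightarrow> bool" where
  "pivot V E x y \<longleftrightarrow> x \<in> V \<and> y \<in> V \<and>
     (\<exists>A. A \<subseteq> V - {x, y} \<and> insert x A \<in> E \<and> insert y A \<in> E)"

definition pivot_equivalent :: "'v set \<Rightarrow> 'v set set \<Rightarrow> 'v \<Rightarrow> 'v \<Rightarrow> bool" where
  "pivot_equivalent V E = (pivot V E)\<^sup>*\<^sup>*"

section \<open>Edge ideals\<close>

text \<open>Monomials are exponent functions of type \<open>'v \<Rightarrow>\<^sub>0 nat\<close>, and polynomials are finitely supported
  families of coefficients indexed by monomials.\<close>

type_synonym ('v, 'k) mpoly = "('v \<Rightarrow>\<^sub>0 nat) \<Rightarrow>\<^sub>0 'k"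

definition mpoly_var :: "'v \<Rightarrow> ('v, 'k::field) mpoly" where
  "mpoly_var v = Poly_Mapping.single (Poly_Mapping.single v 1) 1"

definition mpoly_ring :: "'v set \<Rightarrow> ('v, 'k::field) mpoly ring" where
  "mpoly_ring V = \<lparr>carrier = {p. \<forall>u\<in>Poly_Mapping.keys p. Poly_Mapping.keys u \<subseteq> V},
     mult = (*), one = 1, zero = 0, add = (+)\<rparr>"

text \<open>\<open>node_denominators V\<close> is the complement of the ideal generated by the nodes in \<open>V\<close>, and
  \<open>node_local_ring V\<close> is the localization of the polynomial ring at that ideal.\<close>

definition node_denominators :: "'v set \<Rightarrow> ('v, 'k::field) mpoly set" where
  "node_denominators V = carrier (mpoly_ring V) - Idl\<^bsub>mpoly_ring V\<^esub> (mpoly_var ` V)"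

definition node_local_ring ::
  "'k::field itself \<Rightarrow> 'v set \<Rightarrow> (('v, 'k) mpoly \<times> ('v, 'k) mpoly) set ring" where
  "node_local_ring K V = localization (mpoly_ring V) (node_denominators V)"

definition edge_ideal ::
  "'k::field itself \<Rightarrow> 'v set \<Rightarrow> 'v set set \<Rightarrow> (('v, 'k) mpoly \<times> ('v, 'k) mpoly) set set" where
  "edge_ideal K V E = Idl\<^bsub>node_local_ring K V\<^esub>
     ((\<lambda>e. loc_frac (mpoly_ring V) (node_denominators V) (\<Prod>v\<in>e. mpoly_var v) 1) ` E)"

end

theory Submission
  imports Defs "HOL-Library.Multiset" "HOL-Library.Product_Plus"
begin

text \<open>Write \<open>n\<close> for the number of nodes. The module \<open>\<Gamma>(I\<^sup>t / I\<^sup>t\<^sup>+\<^sup>1)\<close> has a basis of monomials, so its length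
  is the number of monomials \<open>u\<close> of \<open>I\<^sup>t\<close> outside \<open>I\<^sup>t\<^sup>+\<^sup>1\<close> such that all multiples of \<open>u\<close> of large degree lie in
  \<open>I\<^sup>t\<^sup>+\<^sup>1\<close>. Over all \<open>t\<close> these monomials form a finitely generated module over the monoid of sums of edges, so
  their number is eventually a polynomial in \<open>t\<close>, and the limit defining the multiplicity exists.

  If the nodes of each component are pivot equivalent, then \<open>m x\<close> is an integral combination of edges for every
  node \<open>x\<close>. A suitable sum \<open>w\<close> of edges and all \<open>w + m x\<close> are then sums of edges, which yields about \<open>t\<^sup>n\<^sup>-\<^sup>1\<close>
  monomials. Otherwise proper connectedness forces all edges of some component to meet each of two pivot classes
  in a constant number of nodes. Sums of \<open>t\<close> edges thus satisfy two independent linear equations, and there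
  are only \<open>O(t\<^sup>n\<^sup>-\<^sup>2)\<close> of them.\<close>

section \<open>Hilbert functions\<close>

text \<open>\<open>lim\<close> in the definition of the multiplicity is unspecified without
  convergence, so bounds on the lengths do not suffice: existence of the limit has to come from
  polynomial growth. The limit lies in the extended reals, and only its vanishing is decided. Once
  it exists, a lower bound along a subsequence of levels determines its sign.

  The degree of a sum of \<open>t\<close> edges is forced to be \<open>m * t\<close>, which is why
  \<open>n - 1\<close> is the critical exponent. Counts of edge sums transfer to lengths because the
  torsion is covered by finitely many translates of sets of edge sums.

  The obstacle to that finite generation is that powers of the edge ideal are stable under all
  nodes, while only edges raise the grading. Torsion overcomes it: node monomials of large degree
  carry a given torsion element into the next power, so only finitely many of them matter for each
  generator.

  Localization does no damage, since denominators have a constant term and membership of a fraction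
  in a monomial ideal depends on the support of its numerator alone. The Krull dimension must be
  computed because it supplies the exponent.\<close>

lemma dickson_multiset_aux:
  assumes "finite G"
  shows "\<exists>F\<subseteq>Zs. finite F \<and> (\<forall>Z\<in>Zs. \<exists>W\<in>F. \<forall>g\<in>G. count W g \<le> count Z g)"
  using assms
proof (induction G arbitrary: Zs rule: finite_induct)
  case empty
  show ?case
  proof (cases "Zs = {}")
    case False
    then obtain Z where "Z \<in> Zs" by blast
    then show ?thesis by (intro exI[of _ "{Z}"]) auto
  qed auto
next
  case (insert a G)
  obtain F0 where F0: "F0 \<subseteq> Zs" "finite F0" "\<forall>Z\<in>Zs. \<exists>W\<in>F0. \<forall>g\<in>G. count W g \<le> count Z g"
    using insert.IH[of Zs] by blast
  define Zk where "Zk k = {Z\<in>Zs. count Z a = k}" for k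
  have "\<forall>k. \<exists>F. F \<subseteq> Zk k \<and> finite F \<and> (\<forall>Z\<in>Zk k. \<exists>W\<in>F. \<forall>g\<in>G. count W g \<le> count Z g)"
    using insert.IH by blast
  from choice[OF this] obtain Fk where Fk0: "\<forall>k. Fk k \<subseteq> Zk k \<and> finite (Fk k) \<and>
      (\<forall>Z\<in>Zk k. \<exists>W\<in>Fk k. \<forall>g\<in>G. count W g \<le> count Z g)" ..
  have Fk: "Fk k \<subseteq> {Z\<in>Zs. count Z a = k}" "finite (Fk k)" for k
    using Fk0 by (auto simp: Zk_def)
  have Fk3: "\<exists>W\<in>Fk k. \<forall>g\<in>G. count W g \<le> count Z g" if "Z \<in> Zs" "count Z a = k" for Z k
    using Fk0 that by (simp add: Zk_def)
  \<comment> \<open>From \<open>M\<close> on, the count of \<open>a\<close> cannot obstruct the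
    comparison with \<open>F0\<close>; below \<open>M\<close> there are finitely many slices of
    constant count, each covered by the induction hypothesis.\<close>
  obtain M where M: "\<And>W. W \<in> F0 \<Longrightarrow> count W a \<le> M"
    using finite_nat_set_iff_bounded_le[of "(\<lambda>W. count W a) ` F0"] F0(2) by auto
  show ?case
  proof (intro exI[of _ "F0 \<union> (\<Union>k<M. Fk k)"] conjI ballI)
    show "F0 \<union> (\<Union>k<M. Fk k) \<subseteq> Zs" using F0(1) Fk(1) by fast
    show "finite (F0 \<union> (\<Union>k<M. Fk k))" using F0(2) Fk(2) by simp
    fix Z assume Z: "Z \<in> Zs"
    show "\<exists>W\<in>F0 \<union> (\<Union>k<M. Fk k). \<forall>g\<in>insert a G. count W g \<le> count Z g"
    proof (cases "count Z a < M")
      case True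
      obtain W where W: "W \<in> Fk (count Z a)" "\<forall>g\<in>G. count W g \<le> count Z g"
        using Fk3[OF Z refl] by blast
      moreover have "count W a = count Z a" using Fk(1) W(1) by blast
      ultimately show ?thesis using True by (intro bexI[of _ W]) auto
    next
      case False
      obtain W where "W \<in> F0" "\<forall>g\<in>G. count W g \<le> count Z g" using F0(3) Z by blast
      then show ?thesis using M[of W] False by (intro bexI[of _ W]) auto
    qed
  qed
qed

text \<open>Stands in for Noetherianity: \<open>fg_modulo_sub\<close> extracts finite generating
  sets from it. Supports inside \<open>G\<close> turn the comparison of counts on \<open>G\<close>
  into \<open>\<subseteq>#\<close>.\<close>

lemma dickson_multiset:
  assumes "finite G" and "\<And>Z. Z \<in> Zs \<Longrightarrow> set_mset Z \<subseteq> G"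
  obtains F where "F \<subseteq> Zs" "finite F" "\<And>Z. Z \<in> Zs \<Longrightarrow> \<exists>W\<in>F. W \<subseteq># Z"
proof -
  obtain F where F: "F \<subseteq> Zs" "finite F" "\<forall>Z\<in>Zs. \<exists>W\<in>F. \<forall>g\<in>G. count W g \<le> count Z g"
    using dickson_multiset_aux[OF assms(1), of Zs] by blast
  have "\<exists>W\<in>F. W \<subseteq># Z" if Z: "Z \<in> Zs" for Z
  proof -
    obtain W where W: "W \<in> F" "\<forall>g\<in>G. count W g \<le> count Z g" using bspec[OF F(3) Z] ..
    have "set_mset W \<subseteq> G" using W(1) F(1) assms(2) by blast
    then have "W \<subseteq># Z" using W(2)
      by (intro mset_subset_eqI) (metis count_eq_zero_iff le0 subsetD)
    then show ?thesis using W(1) by blast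
  qed
  then show ?thesis using that[OF F(1,2)] by simp
qed

section \<open>Finitely generated modules over a commutative monoid\<close>

definition msums :: "'g::comm_monoid_add set \<Rightarrow> 'g set" where
  "msums G = {sum_mset Z | Z. set_mset Z \<subseteq> G}"

lemma msums_0 [simp]: "0 \<in> msums G"
  unfolding msums_def by (rule CollectI, rule exI[of _ "{#}"]) simp

lemma msums_gen: "g \<in> G \<Longrightarrow> g \<in> msums G"
  unfolding msums_def by (rule CollectI, rule exI[of _ "{#g#}"]) simp

lemma msums_add: "x \<in> msums G \<Longrightarrow> y \<in> msums G \<Longrightarrow> x + y \<in> msums G"
  unfolding msums_def
proof clarify
  fix Z W assume "set_mset Z \<subseteq> G" "set_mset W \<subseteq> G"
  then show "\<exists>Za. sum_mset Z + sum_mset W = sum_mset Za \<and> set_mset Za \<subseteq> G"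
    by (intro exI[of _ "Z + W"]) auto
qed

lemma msums_sum: "(\<And>i. i \<in> I \<Longrightarrow> f i \<in> msums G) \<Longrightarrow> sum f I \<in> msums G"
  by (induction I rule: infinite_finite_induct) (auto intro: msums_add)

lemma msums_induct [consumes 1, case_names zero add]:
  assumes "x \<in> msums G" and "P 0" and "\<And>g x. g \<in> G \<Longrightarrow> x \<in> msums G \<Longrightarrow> P x \<Longrightarrow> P (x + g)"
  shows "P x"
proof -
  obtain Z where Z: "x = sum_mset Z" "set_mset Z \<subseteq> G" using assms(1) by (auto simp: msums_def)
  have "set_mset Z \<subseteq> G \<Longrightarrow> P (sum_mset Z)"
  proof (induction Z)
    case (add g Z)
    then have "P (sum_mset Z + g)" by (intro assms(3)) (auto simp: msums_def)
    then show ?case by (simp add: add.commute)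
  qed (simp add: assms(2))
  then show ?thesis using Z by simp
qed

definition act_closed :: "'g::comm_monoid_add set \<Rightarrow> 'g set \<Rightarrow> bool" where
  "act_closed G X \<longleftrightarrow> (\<forall>x\<in>X. \<forall>g\<in>G. x + g \<in> X)"

text \<open>Combinatorial form of a finitely generated quotient of \<open>X\<close> by
  \<open>Y\<close>: elements of \<open>Y\<close> count as zero, so only those outside
  \<open>Y\<close> have to be reached from the generators.\<close>

definition fg_modulo :: "'g::comm_monoid_add set \<Rightarrow> 'g set \<Rightarrow> 'g set \<Rightarrow> bool" where
  "fg_modulo G X Y \<longleftrightarrow>
     (\<exists>F. finite F \<and> F \<subseteq> X \<and> (\<forall>x\<in>X - Y. \<exists>f\<in>F. \<exists>z\<in>msums G. x = f + z))"

lemma act_closed_msums: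
  assumes "act_closed G X" "x \<in> X" "z \<in> msums G"
  shows "x + z \<in> X"
  using assms(3)
proof (induction rule: msums_induct)
  case (add g z)
  then have "(x + z) + g \<in> X" using assms(1) by (simp add: act_closed_def)
  then show ?case by (simp add: add.assoc)
qed (use assms in simp)

lemma act_closed_mono: "act_closed G X \<Longrightarrow> H \<subseteq> G \<Longrightarrow> act_closed H X"
  by (auto simp: act_closed_def)

text \<open>For each generator \<open>f\<close> of \<open>X\<close>, the multisets that carry
  \<open>f\<close> into \<open>X'\<close> all lie above finitely many of them, by Dickson's lemma;
  adding these to \<open>f\<close> yields generators of \<open>X'\<close>. This is the basis theorem
  in terms of monomials.\<close>

lemma fg_modulo_sub:
  assumes G: "finite G" and fg: "fg_modulo G X Y" and X': "act_closed G X'" "X' \<subseteq> X"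
  shows "fg_modulo G X' Y"
proof -
  obtain F where F: "finite F" "F \<subseteq> X" "\<forall>x\<in>X - Y. \<exists>f\<in>F. \<exists>z\<in>msums G. x = f + z"
    using fg by (auto simp: fg_modulo_def)
  define Zs where "Zs f = {Z. set_mset Z \<subseteq> G \<and> f + sum_mset Z \<in> X'}" for f
  have "\<exists>B\<subseteq>Zs f. finite B \<and> (\<forall>Z\<in>Zs f. \<exists>W\<in>B. W \<subseteq># Z)" for f
    by (rule dickson_multiset[OF G, of "Zs f"]) (auto simp: Zs_def)
  then obtain B where B: "\<And>f. B f \<subseteq> Zs f" "\<And>f. finite (B f)" 
     "\<And>f Z. Z \<in> Zs f \<Longrightarrow> \<exists>W\<in>B f. W \<subseteq># Z" by metis
  define F' where "F' = (\<Union>f\<in>F. (\<lambda>Z. f + sum_mset Z) ` B f)"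
  show ?thesis unfolding fg_modulo_def
  proof (intro exI[of _ F'] conjI ballI)
    show "finite F'" using F(1) B(2) by (auto simp: F'_def)
    show "F' \<subseteq> X'" using B(1) by (auto simp: F'_def Zs_def)
    fix x assume x: "x \<in> X' - Y"
    then obtain f Z where f: "f \<in> F" and Z: "set_mset Z \<subseteq> G" "x = f + sum_mset Z"
      using F(3) X'(2) by (auto simp: msums_def) blast
    then have "Z \<in> Zs f" using x by (auto simp: Zs_def)
    then obtain W where W: "W \<in> B f" "W \<subseteq># Z" using B(3) by blast
    have "sum_mset Z = sum_mset W + sum_mset (Z - W)"
      using W(2) by (metis subset_mset.add_diff_inverse sum_mset.union)
    then have "x = (f + sum_mset W) + sum_mset (Z - W)" using Z(2) by (simp add: add.assoc)
    moreover have "sum_mset (Z - W) \<in> msums G"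
      using Z(1) by (auto simp: msums_def dest: in_diffD)
    ultimately show "\<exists>f\<in>F'. \<exists>z\<in>msums G. x = f + z" using f W(1) by (auto simp: F'_def)
  qed
qed

text \<open>The \<open>r\<close>-th forward difference of \<open>f\<close> vanishes eventually, that
  is, \<open>f\<close> eventually agrees with a polynomial of degree below \<open>r\<close>.
  Differences suit the induction on generators, since each generator accounts for one of
  them.\<close>

primrec ev_diff :: "nat \<Rightarrow> (nat \<Rightarrow> real) \<Rightarrow> bool" where
  "ev_diff 0 f \<longleftrightarrow> (\<forall>\<^sub>F t in sequentially. f t = 0)"
| "ev_diff (Suc r) f \<longleftrightarrow> ev_diff r (\<lambda>t. f (Suc t) - f t)"

lemma ev_diff_shift: "ev_diff r f \<Longrightarrow> ev_diff r (\<lambda>t. f (Suc t))"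
proof (induction r arbitrary: f)
  case 0
  then show ?case by (auto simp: eventually_sequentially intro: le_SucI)
qed auto

lemma ev_diff_minus: "ev_diff r f \<Longrightarrow> ev_diff r g \<Longrightarrow> ev_diff r (\<lambda>t. f t - g t)"
proof (induction r arbitrary: f g)
  case 0
  then show ?case by (auto elim: eventually_elim2)
next
  case (Suc r)
  have "ev_diff r (\<lambda>t. (f (Suc t) - f t) - (g (Suc t) - g t))"
    using Suc.IH Suc.prems by simp
  then show ?case by (simp add: algebra_simps)
qed

lemma ev_diff_binomial:
  "ev_diff r f \<Longrightarrow> \<exists>c. \<forall>\<^sub>F t in sequentially. f t = (\<Sum>i<r. c i * real (t choose i))"
proof (induction r arbitrary: f)
  case (Suc r)
  obtain c t0 where c: "\<And>t. t \<ge> t0 \<Longrightarrow> f (Suc t) - f t = (\<Sum>i<r. c i * real (t choose i))"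
    using Suc.IH[of "\<lambda>t. f (Suc t) - f t"] Suc.prems by (auto simp: eventually_sequentially)
  \<comment> \<open>By Pascal's rule the difference of \<open>t choose Suc i\<close> is
    \<open>t choose i\<close>, so the coefficients of the difference move up by one place; the new
    constant term fits the value at \<open>t0\<close>.\<close>
  define c' where "c' = case_nat (f t0 - (\<Sum>i<r. c i * real (t0 choose Suc i))) c"
  have "f t = (\<Sum>i<Suc r. c' i * real (t choose i))" if "t \<ge> t0" for t
    using that
  proof (induction t rule: dec_induct)
    case base
    show ?case by (subst sum.lessThan_Suc_shift) (simp add: c'_def)
  next
    case (step t)
    have "f (Suc t) = f t + (\<Sum>i<r. c i * real (t choose i))" using c[of t] step by simp
    also have "\<dots> = (\<Sum>i<Suc r. c' i * real (Suc t choose i))"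
      unfolding step.IH
      by (simp add: sum.lessThan_Suc_shift c'_def sum.distrib distrib_left del: sum.lessThan_Suc)
    finally show ?case .
  qed
  then show ?case unfolding eventually_sequentially by blast
qed simp

lemma finite_size_multisets: "finite G \<Longrightarrow> finite {Z. set_mset Z \<subseteq> G \<and> size Z \<le> k}"
proof -
  assume G: "finite G"
  have "{Z. set_mset Z \<subseteq> G \<and> size Z \<le> k} \<subseteq> mset ` {xs. set xs \<subseteq> G \<and> length xs \<le> k}"
  proof
    fix Z assume Z: "Z \<in> {Z. set_mset Z \<subseteq> G \<and> size Z \<le> k}"
    obtain xs where "Z = mset xs" by (metis ex_mset)
    then show "Z \<in> mset ` {xs. set xs \<subseteq> G \<and> length xs \<le> k}" using Z by auto
  qed
  then show ?thesis using finite_lists_length_le[OF G] finite_subset by blast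
qed

lemma sum_mset_hom:
  assumes "h 0 = 0" "\<And>x y. h (x + y) = h x + h y" "\<And>g. g \<in> G \<Longrightarrow> h g = Suc 0"
    and "set_mset Z \<subseteq> G"
  shows "h (sum_mset Z) = size Z"
  using assms(4) by (induction Z) (auto simp: assms)

text \<open>Each generator raises \<open>h\<close> by one, so an element on level \<open>t\<close>
  is some \<open>f\<close> plus at most \<open>t\<close> generators. Finiteness matters because
  \<open>card\<close> of an infinite set is 0.\<close>

lemma finite_level:
  fixes h :: "'g::cancel_comm_monoid_add \<Rightarrow> nat"
  assumes h: "h 0 = 0" "\<And>x y. h (x + y) = h x + h y" "\<And>g. g \<in> G \<Longrightarrow> h g = 1"
    and G: "finite G" and fg: "fg_modulo G X Y"
  shows "finite {x \<in> X - Y. h x = t}"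
proof -
  obtain F where F: "finite F" "F \<subseteq> X" "\<forall>x\<in>X - Y. \<exists>f\<in>F. \<exists>z\<in>msums G. x = f + z"
    using fg by (auto simp: fg_modulo_def)
  let ?Z = "{Z. set_mset Z \<subseteq> G \<and> size Z \<le> t}"
  have "{x \<in> X - Y. h x = t} \<subseteq> (\<lambda>(f, Z). f + sum_mset Z) ` (F \<times> ?Z)"
  proof
    fix x assume x: "x \<in> {x \<in> X - Y. h x = t}"
    then obtain f Z where f: "f \<in> F" "set_mset Z \<subseteq> G" "x = f + sum_mset Z"
      using F(3) by (auto simp: msums_def) blast
    have "h (sum_mset Z) = size Z" using h f(2) by (intro sum_mset_hom[of h G]) auto
    then have "size Z \<le> t" using x f(3) h(2) by auto
    then show "x \<in> (\<lambda>(f, Z). f + sum_mset Z) ` (F \<times> ?Z)" using f by force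
  qed
  then show ?thesis using F(1) finite_size_multisets[OF G, of t]
    by (meson finite_SigmaI finite_imageI finite_subset)
qed

text \<open>The combinatorial form of the theorem of Hilbert and Serre for the quotient \<open>X - Y\<close>: multiplication
  by one generator \<open>e\<close> has a kernel and a cokernel that are generated by the remaining ones.\<close>

lemma hilbert_function:
  fixes h :: "'g::cancel_comm_monoid_add \<Rightarrow> nat"
  assumes "finite G"
    and h: "h 0 = 0" "\<And>x y. h (x + y) = h x + h y" "\<And>g. g \<in> G \<Longrightarrow> h g = 1"
    and "act_closed G X" "act_closed G Y" "fg_modulo G X Y"
  shows "ev_diff (card G) (\<lambda>t. real (card {x \<in> X - Y. h x = t}))"
  using assms(1,4-)
proof (induction G arbitrary: X Y rule: finite_induct)
  case empty
  then obtain F where F: "finite F" "F \<subseteq> X" "\<forall>x\<in>X - Y. \<exists>f\<in>F. x = f"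
    by (auto simp: fg_modulo_def msums_def)
  \<comment> \<open>Without generators all of \<open>X - Y\<close> lies in the finite set
    \<open>F\<close>, so high levels are empty.\<close>
  obtain M where M: "\<And>x. x \<in> F \<Longrightarrow> h x \<le> M"
    using finite_nat_set_iff_bounded_le[of "h ` F"] F(1) by auto
  have "{x \<in> X - Y. h x = t} = {}" if "t \<ge> Suc M" for t
    using F M that by force
  then have "real (card {x \<in> X - Y. h x = t}) = 0" if "t \<ge> Suc M" for t
    using that by (metis card.empty of_nat_0)
  then show ?case by (auto simp only: card.empty ev_diff.simps eventually_sequentially)
next
  case (insert e G)
  note G = \<open>finite G\<close>
  note cX = insert.prems(2) and cY = insert.prems(3) and fg = insert.prems(4)
  have he: "h e = 1" using insert.prems(1) by simp
  \<comment> \<open>Modulo \<open>Y\<close>, the set \<open>K\<close> is the kernel of adding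
    \<open>e\<close>, and \<open>X\<close> modulo \<open>Y'\<close> is the cokernel.\<close>
  define K where "K = {x \<in> X. x + e \<in> Y}"
  define Y' where "Y' = Y \<union> (\<lambda>x. x + e) ` X"
  have cK: "act_closed (insert e G) K"
    using cX cY unfolding act_closed_def K_def
    by (auto simp: add.assoc) (metis add.commute add.left_commute insertI2)
  have fgK: "fg_modulo (insert e G) K Y"
    by (rule fg_modulo_sub[OF _ fg cK]) (auto simp: K_def G)
  \<comment> \<open>If adding \<open>e\<close> sends all of \<open>X0\<close> into
    \<open>Y0\<close>, a representation of an element outside \<open>Y0\<close> cannot contain
    \<open>e\<close>. This disposes of \<open>e\<close> for the kernel and the cokernel
    alike.\<close>
  have drop: "fg_modulo G X0 Y0" 
    if fg0: "fg_modulo (insert e G) X0 Y0" and c: "act_closed (insert e G) Y0"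
      and k: "\<And>x. x \<in> X0 \<Longrightarrow> x + e \<in> Y0" for X0 Y0
  proof -
    obtain F where F: "finite F" "F \<subseteq> X0" 
      "\<forall>x\<in>X0 - Y0. \<exists>f\<in>F. \<exists>z\<in>msums (insert e G). x = f + z"
      using fg0 by (auto simp: fg_modulo_def)
    have "\<exists>f\<in>F. \<exists>z\<in>msums G. x = f + z" if x: "x \<in> X0 - Y0" for x
    proof -
      obtain f Z where f: "f \<in> F" "set_mset Z \<subseteq> insert e G" "x = f + sum_mset Z"
        using F(3) x by (auto simp: msums_def) blast
      have "e \<notin># Z"
      proof
        assume "e \<in># Z"
        then obtain Z' where Z': "Z = add_mset e Z'" by (metis insert_DiffM)
        have "f + e \<in> Y0" using F(2) f(1) k by blast
        then have "(f + e) + sum_mset Z' \<in> Y0"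
          using act_closed_msums[OF c] f(2) Z' by (auto simp: msums_def)
        then show False using x f(3) Z' by (simp add: add.assoc)
      qed
      then have "sum_mset Z \<in> msums G" using f(2) by (auto simp: msums_def)
      then show ?thesis using f by blast
    qed
    then show ?thesis using F by (auto simp: fg_modulo_def)
  qed
  have cY': "act_closed (insert e G) Y'"
    unfolding act_closed_def
  proof (intro ballI)
    fix y g assume y: "y \<in> Y'" and g: "g \<in> insert e G"
    show "y + g \<in> Y'"
    proof (cases "y \<in> Y")
      case True
      then show ?thesis using cY g by (auto simp: act_closed_def Y'_def)
    next
      case False
      then obtain x where x: "x \<in> X" "y = x + e" using y by (auto simp: Y'_def)
      then have "x + g \<in> X" using cX g by (auto simp: act_closed_def)
      moreover have "y + g = (x + g) + e" using x by (simp add: ac_simps)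
      ultimately show ?thesis by (simp add: Y'_def)
    qed
  qed
  have fgK': "fg_modulo G K Y" by (rule drop[OF fgK cY]) (auto simp: K_def)
  have "fg_modulo (insert e G) X Y'" using fg unfolding fg_modulo_def Y'_def by (metis (no_types, lifting) Diff_iff UnI1)
  then have fgC: "fg_modulo G X Y'" by (rule drop[OF _ cY']) (auto simp: Y'_def)
  have IHK: "ev_diff (card G) (\<lambda>t. real (card {x \<in> K - Y. h x = t}))"
    using insert.prems(1) cK cY fgK' by (intro insert.IH) (auto intro: act_closed_mono)
  have IHC: "ev_diff (card G) (\<lambda>t. real (card {x \<in> X - Y'. h x = t}))"
    using insert.prems(1) cX cY' fgC by (intro insert.IH) (auto intro: act_closed_mono)
  have fin: "finite {x \<in> X - Y. h x = t}" for t
    using finite_level[of h "insert e G" X Y t] h insert.prems(1) G fg by simp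
  \<comment> \<open>Counting in the exact sequence of kernel and cokernel: by cancellation, adding
    \<open>e\<close> is a bijection from level \<open>t\<close> without the kernel onto the part of
    level \<open>Suc t\<close> that vanishes in the cokernel.\<close>
  have eq: "real (card {x \<in> X - Y. h x = Suc t}) - real (card {x \<in> X - Y. h x = t})
     = real (card {x \<in> X - Y'. h x = Suc t}) - real (card {x \<in> K - Y. h x = t})" for t
  proof -
    let ?T = "\<lambda>t. {x \<in> X - Y. h x = t}" and ?K = "{x \<in> K - Y. h x = t}" 
      and ?C = "{x \<in> X - Y'. h x = Suc t}"
    have sub: "?K \<subseteq> ?T t" "?C \<subseteq> ?T (Suc t)" by (auto simp: K_def Y'_def)
    have clX: "x + e \<in> X" if "x \<in> X" for x using that cX by (auto simp: act_closed_def)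
    have clY: "x + e \<in> Y" if "x \<in> Y" for x using that cY by (auto simp: act_closed_def)
    have "(\<lambda>x. x + e) ` (?T t - ?K) = ?T (Suc t) - ?C"
    proof (intro equalityI subsetI)
      fix y assume "y \<in> (\<lambda>x. x + e) ` (?T t - ?K)"
      then obtain x where "x \<in> X" "x \<notin> Y" "x + e \<notin> Y" "h x = t" "y = x + e" by (auto simp: K_def)
      then show "y \<in> ?T (Suc t) - ?C" using clX by (simp add: Y'_def h he)
    next
      fix y assume "y \<in> ?T (Suc t) - ?C"
      then obtain x where x: "x \<in> X" "y = x + e" "y \<notin> Y" "h y = Suc t" by (auto simp: Y'_def)
      then have "x \<in> ?T t - ?K" using clY by (auto simp: K_def h he)
      then show "y \<in> (\<lambda>x. x + e) ` (?T t - ?K)" unfolding x(2) by (rule imageI)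
    qed
    then have "bij_betw (\<lambda>x. x + e) (?T t - ?K) (?T (Suc t) - ?C)"
      by (simp add: bij_betw_def)
    then have "card (?T t - ?K) = card (?T (Suc t) - ?C)" by (rule bij_betw_same_card)
    moreover have "card ?K \<le> card (?T t)" "card ?C \<le> card (?T (Suc t))"
      using sub fin by (auto intro!: card_mono)
    ultimately show ?thesis using sub
      by (simp add: card_Diff_subset finite_subset[OF _ fin] of_nat_diff)
  qed
  have "ev_diff (card G) (\<lambda>t. real (card {x \<in> X - Y. h x = Suc t}) - real (card {x \<in> X - Y. h x = t}))"
    unfolding eq using ev_diff_minus[OF ev_diff_shift[OF IHC] IHK] .
  then show ?case using G insert.hyps(2) by simp
qed

section \<open>Limits of eventually polynomial functions\<close>

lemma binomial_over_power_tendsto: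
  "(\<lambda>t. real (t choose i) / real t ^ i) \<longlonglongrightarrow> 1 / fact i"
proof (induction i)
  case (Suc i)
  have "(\<lambda>t. 1 - real i / real t) \<longlonglongrightarrow> 1 - 0"
    by (intro tendsto_diff tendsto_const tendsto_divide_0[OF tendsto_const] filterlim_real_sequentially
        filterlim_at_top_imp_at_infinity)
  then have "(\<lambda>t. (real (t choose i) / real t ^ i) * ((1 - real i / real t) / real (Suc i)))
     \<longlonglongrightarrow> 1 / fact i * ((1 - 0) / real (Suc i))"
    by (intro tendsto_mult Suc.IH tendsto_divide tendsto_const) auto
  moreover have "\<forall>\<^sub>F t in sequentially. (real (t choose i) / real t ^ i) * ((1 - real i / real t) / real (Suc i))
     = real (t choose Suc i) / real t ^ Suc i"
  proof (rule eventually_sequentiallyI)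
    fix t assume t: "t \<ge> Suc i"
    have "Suc i * (t choose Suc i) = (t - i) * (t choose i)"
      using binomial_absorb_comp[of t i] binomial_absorption[of i "t"] t
      by (metis Suc_diff_Suc Suc_le_eq Suc_times_binomial_eq binomial_absorption diff_Suc_1 Suc_le_D)
    then have "real (Suc i) * real (t choose Suc i) = (real t - real i) * real (t choose i)"
      using t by (metis Suc_leD of_nat_diff of_nat_mult)
    then show "(real (t choose i) / real t ^ i) * ((1 - real i / real t) / real (Suc i))
     = real (t choose Suc i) / real t ^ Suc i"
      using t by (simp add: divide_simps del: of_nat_Suc) (simp add: algebra_simps del: of_nat_Suc)
  qed
  ultimately have "(\<lambda>t. real (t choose Suc i) / real t ^ Suc i)
     \<longlonglongrightarrow> 1 / fact i * ((1 - 0) / real (Suc i))"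
    by (rule Lim_transform_eventually)
  then show ?case by (simp add: mult.commute)
qed simp

text \<open>The degree of \<open>f\<close> is not tied to \<open>k\<close>. If it exceeds
  \<open>k\<close>, the limit is \<open>\<infinity>\<close>: the leading coefficient is positive
  because \<open>f\<close> takes no negative values.\<close>

lemma ev_diff_limit:
  assumes "ev_diff r f" and "\<And>t. f t \<ge> 0"
  shows "\<exists>L. (\<lambda>t. ereal (f t) / ereal (real t ^ k)) \<longlonglongrightarrow> L"
proof -
  obtain c where c: "\<forall>\<^sub>F t in sequentially. f t = (\<Sum>i<r. c i * real (t choose i))"
    using ev_diff_binomial[OF assms(1)] by blast
  \<comment> \<open>When the coefficients beyond \<open>d\<close> vanish, only the term of index
    \<open>d\<close> survives division by \<open>t ^ d\<close>. The sum on the right is 0 if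
    \<open>d \<ge> r\<close>.\<close>
  have lim: "(\<lambda>t. f t / real t ^ d) \<longlonglongrightarrow> (\<Sum>i<r. if i = d then c i / fact d else 0)"
    if d: "\<And>i. i < r \<Longrightarrow> i > d \<Longrightarrow> c i = 0" for d
  proof -
    have "(\<lambda>t. \<Sum>i<r. c i * (real (t choose i) / real t ^ d)) \<longlonglongrightarrow> 
       (\<Sum>i<r. if i = d then c i / fact d else 0)"
    proof (intro tendsto_sum)
      fix i assume i: "i \<in> {..<r}"
      consider "i = d" | "i < d" | "i > d" by linarith
      then show "(\<lambda>t. c i * (real (t choose i) / real t ^ d)) \<longlonglongrightarrow> (if i = d then c i / fact d else 0)"
      proof cases
        case 1
        then show ?thesis using tendsto_mult[OF tendsto_const binomial_over_power_tendsto, of "c i" d] by simp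
      next
        case 2
        have "(\<lambda>t. inverse (real t)) \<longlonglongrightarrow> 0" by (rule lim_inverse_n)
        then have "(\<lambda>t. inverse (real t) ^ (d - i)) \<longlonglongrightarrow> 0 ^ (d - i)" by (rule tendsto_power)
        from tendsto_mult[OF binomial_over_power_tendsto[of i] this]
        have "(\<lambda>t. real (t choose i) / real t ^ i * inverse (real t) ^ (d - i)) \<longlonglongrightarrow> 0"
          using 2 by (simp add: zero_power)
        moreover have "\<forall>\<^sub>F t in sequentially. real (t choose i) / real t ^ i * inverse (real t) ^ (d - i)
          = real (t choose i) / real t ^ d"
        proof (rule eventually_sequentiallyI)
          fix t :: nat assume "t \<ge> 1"
          have "real t ^ d = real t ^ i * real t ^ (d - i)" using 2 by (simp flip: power_add)
          then show "real (t choose i) / real t ^ i * inverse (real t) ^ (d - i) = real (t choose i) / real t ^ d"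
            by (simp add: field_simps power_inverse)
        qed
        ultimately have "(\<lambda>t. real (t choose i) / real t ^ d) \<longlonglongrightarrow> 0" by (rule Lim_transform_eventually)
        from tendsto_mult[OF tendsto_const this, of "c i"] show ?thesis using 2 by simp
      next
        case 3
        then show ?thesis using d i by simp
      qed
    qed
    moreover have "\<forall>\<^sub>F t in sequentially. (\<Sum>i<r. c i * (real (t choose i) / real t ^ d)) = f t / real t ^ d"
      using c by eventually_elim (simp add: sum_divide_distrib)
    ultimately show ?thesis by (rule Lim_transform_eventually)
  qed
  show ?thesis
  proof (cases "\<forall>i<r. i > k \<longrightarrow> c i = 0")
    case True
    have "(\<lambda>t. ereal (f t / real t ^ k)) \<longlonglongrightarrow> ereal (\<Sum>i<r. if i = k then c i / fact k else 0)"
      using lim[of k] True by (intro tendsto_ereal) auto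
    moreover have "\<forall>\<^sub>F t in sequentially. ereal (f t / real t ^ k) = ereal (f t) / ereal (real t ^ k)"
      by (rule eventually_sequentiallyI[of 1]) auto
    ultimately show ?thesis by (blast intro: Lim_transform_eventually)
  next
    case False
    define d where "d = (GREATEST i. i < r \<and> c i \<noteq> 0)"
    obtain j where j: "j < r" "j > k" "c j \<noteq> 0" using False by auto
    have d: "d < r \<and> c d \<noteq> 0" unfolding d_def by (rule GreatestI_nat[of _ j r]) (use j in auto)
    have dmax: "i \<le> d" if "i < r" "c i \<noteq> 0" for i 
      unfolding d_def by (rule Greatest_le_nat[of _ i r]) (use that in auto)
    have "d > k" using dmax[of j] j by simp
    have l: "(\<lambda>t. f t / real t ^ d) \<longlonglongrightarrow> c d / fact d"
      using lim[of d] dmax d by (force simp: sum.delta)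
    have "c d / fact d \<ge> 0"
      by (rule tendsto_lowerbound[OF l]) (auto simp: assms(2))
    then have pos: "c d / fact d > 0" using d by (simp add: order_less_le)
    have "filterlim (\<lambda>t. real t ^ (d - k)) at_top sequentially"
      using \<open>d > k\<close> by (intro filterlim_pow_at_top filterlim_real_sequentially) auto
    from filterlim_tendsto_pos_mult_at_top[OF l pos this]
    have "filterlim (\<lambda>t. f t / real t ^ d * real t ^ (d - k)) at_top sequentially" .
    moreover have "\<forall>\<^sub>F t in sequentially. ereal (f t / real t ^ d * real t ^ (d - k)) = ereal (f t) / ereal (real t ^ k)"
    proof (rule eventually_sequentiallyI)
      fix t :: nat assume t: "t \<ge> 1"
      have "real t ^ d = real t ^ k * real t ^ (d - k)" using \<open>d > k\<close> by (simp flip: power_add)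
      then show "ereal (f t / real t ^ d * real t ^ (d - k)) = ereal (f t) / ereal (real t ^ k)"
        using t by simp
    qed
    ultimately have "(\<lambda>t. ereal (f t) / ereal (real t ^ k)) \<longlonglongrightarrow> \<infinity>"
      unfolding tendsto_PInfty_eq_at_top[symmetric] by (blast intro: Lim_transform_eventually)
    then show ?thesis by blast
  qed
qed

section \<open>Monomials and sums of edges\<close>

abbreviation "lookup \<equiv> Poly_Mapping.lookup"
abbreviation "keys \<equiv> Poly_Mapping.keys"
abbreviation "single \<equiv> Poly_Mapping.single"

definition monomials :: "'v set \<Rightarrow> ('v \<Rightarrow>\<^sub>0 nat) set" where
  "monomials V = {u. keys u \<subseteq> V}"

definition mdeg :: "'v set \<Rightarrow> ('v \<Rightarrow>\<^sub>0 nat) \<Rightarrow> nat" where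
  "mdeg V u = (\<Sum>v\<in>V. lookup u v)"

definition edge_monomial :: "'v set \<Rightarrow> ('v \<Rightarrow>\<^sub>0 nat)" where
  "edge_monomial e = (\<Sum>v\<in>e. single v 1)"

text \<open>The first component of a generator counts the edges, so that sums of edges are graded by their
  number of summands.\<close>

definition edge_generators :: "'v set set \<Rightarrow> (nat \<times> ('v \<Rightarrow>\<^sub>0 nat)) set" where
  "edge_generators E = (\<lambda>e. (1, edge_monomial e)) ` E"

definition edge_sums :: "'v set set \<Rightarrow> nat \<Rightarrow> ('v \<Rightarrow>\<^sub>0 nat) set" where
  "edge_sums E s = {u. (s, u) \<in> msums (edge_generators E)}"

definition power_monomials :: "'v set \<Rightarrow> 'v set set \<Rightarrow> nat \<Rightarrow> ('v \<Rightarrow>\<^sub>0 nat) set" where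
  "power_monomials V E t = {u + r | u r. u \<in> edge_sums E t \<and> r \<in> monomials V}"

text \<open>The monomials of the next power belong to this set too (see
  \<open>power_monomials_Suc_subset\<close>), so that it describes an ideal between two consecutive
  powers; the torsion is the quotient.\<close>

definition saturated_monomials :: "'v set \<Rightarrow> 'v set set \<Rightarrow> nat \<Rightarrow> ('v \<Rightarrow>\<^sub>0 nat) set" where
  "saturated_monomials V E t = {u \<in> power_monomials V E t.
     \<exists>k. \<forall>w\<in>monomials V. mdeg V w \<ge> k \<longrightarrow> u + w \<in> power_monomials V E (Suc t)}"

lemma monomials_0 [simp]: "0 \<in> monomials V"
  by (simp add: monomials_def)

lemma monomials_add_iff [simp]:
  "u + w \<in> monomials V \<longleftrightarrow> u \<in> monomials V \<and> w \<in> monomials V"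
  by (auto simp: monomials_def in_keys_iff lookup_add subset_iff)

lemma monomials_sum: "(\<And>i. i \<in> I \<Longrightarrow> f i \<in> monomials V) \<Longrightarrow> sum f I \<in> monomials V"
  by (induction I rule: infinite_finite_induct) auto

lemma monomials_single [simp]: "v \<in> V \<Longrightarrow> single v k \<in> monomials V"
  by (auto simp: monomials_def)

lemma monomials_lookup_0: "u \<in> monomials V \<Longrightarrow> v \<notin> V \<Longrightarrow> lookup u v = 0"
  by (auto simp: monomials_def in_keys_iff subset_iff)

lemma monomials_eqI:
  assumes "u \<in> monomials V" "w \<in> monomials V"
    and "\<And>v. v \<in> V \<Longrightarrow> lookup u v = lookup w v"
  shows "u = w"
  using assms monomials_lookup_0 by (metis poly_mapping_eqI)

lemma mdeg_0 [simp]: "mdeg V 0 = 0"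
  by (simp add: mdeg_def)

lemma mdeg_add [simp]: "mdeg V (u + w) = mdeg V u + mdeg V w"
  by (simp add: mdeg_def lookup_add sum.distrib)

lemma mdeg_single: "finite V \<Longrightarrow> v \<in> V \<Longrightarrow> mdeg V (single v k) = k"
  by (simp add: mdeg_def lookup_single when_def sum.delta')

lemma lookup_le_mdeg: "finite V \<Longrightarrow> v \<in> V \<Longrightarrow> lookup u v \<le> mdeg V u"
  unfolding mdeg_def by (rule member_le_sum) auto

lemma mdeg_eq_0_iff:
  assumes "finite V" "u \<in> monomials V" shows "mdeg V u = 0 \<longleftrightarrow> u = 0"
proof
  assume "mdeg V u = 0"
  then show "u = 0" using assms by (intro monomials_eqI[of u V 0]) (auto simp: mdeg_def)
qed simp

lemma lookup_edge_monomial: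
  "finite e \<Longrightarrow> lookup (edge_monomial e) v = (if v \<in> e then 1 else 0)"
  by (simp add: edge_monomial_def lookup_sum lookup_single when_def sum.delta)

lemma edge_monomial_in: "e \<subseteq> V \<Longrightarrow> edge_monomial e \<in> monomials V"
  by (auto simp: edge_monomial_def intro!: monomials_sum)

lemma sum_edge_monomial:
  assumes "finite V" "e \<subseteq> V" "C \<subseteq> V"
  shows "(\<Sum>v\<in>C. lookup (edge_monomial e) v) = card (e \<inter> C)"
proof -
  have "finite e" "finite C" using assms by (auto intro: finite_subset)
  then show ?thesis by (simp add: lookup_edge_monomial sum.If_cases Int_commute Int_def)
qed

lemma mdeg_edge_monomial:
  assumes "finite V" "e \<subseteq> V" shows "mdeg V (edge_monomial e) = card e"
  using sum_edge_monomial[OF assms, of V] assms(2) by (simp add: mdeg_def Int_absorb2)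

lemma bounded_monomials:
  assumes "finite V"
  shows "finite {u \<in> monomials V. \<forall>v\<in>V. lookup u v \<le> k}" (is "finite ?A")
    and "card {u \<in> monomials V. \<forall>v\<in>V. lookup u v \<le> k} \<le> Suc k ^ card V"
proof -
  let ?r = "\<lambda>u. restrict (lookup u) V"
  have sub: "?r ` ?A \<subseteq> V \<rightarrow>\<^sub>E {..k}" by auto
  have inj: "inj_on ?r ?A"
  proof (rule inj_onI)
    fix u w assume "u \<in> ?A" "w \<in> ?A" and eq: "?r u = ?r w"
    moreover have "lookup u v = lookup w v" if "v \<in> V" for v
      using fun_cong[OF eq, of v] that by simp
    ultimately show "u = w" by (intro monomials_eqI[of u V w]) auto
  qed
  have fin: "finite (V \<rightarrow>\<^sub>E {..k})" using assms by (intro finite_PiE) auto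
  show "finite ?A" using finite_imageD[OF finite_subset[OF sub fin] inj] .
  show "card ?A \<le> Suc k ^ card V"
    using card_inj_on_le[OF inj sub fin] assms by (simp add: card_PiE)
qed

lemma finite_mdeg_le:
  assumes "finite V" shows "finite {u \<in> monomials V. mdeg V u \<le> k}"
  by (rule finite_subset[OF _ bounded_monomials(1)[OF assms, of k]])
     (auto dest: lookup_le_mdeg[OF assms] intro: order_trans)

lemma split_single:
  assumes "r \<in> monomials V" "lookup r v \<ge> m"
  obtains r' where "r' \<in> monomials V" "r = r' + single v m"
proof -
  have *: "r = (r - single v m) + single v m"
    using assms(2) by (intro poly_mapping_eqI) (auto simp: lookup_add lookup_minus lookup_single when_def)
  then have "r - single v m \<in> monomials V"
    using assms(1) monomials_add_iff by metis
  then show ?thesis using that * by blast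
qed

lemma edge_sums_0 [simp]: "0 \<in> edge_sums E 0"
  unfolding edge_sums_def using msums_0[of "edge_generators E"] unfolding zero_prod_def by simp

lemma edge_sums_add: "u \<in> edge_sums E s \<Longrightarrow> w \<in> edge_sums E t \<Longrightarrow> u + w \<in> edge_sums E (s + t)"
  unfolding edge_sums_def using msums_add by fastforce

lemma edge_sums_edge: "e \<in> E \<Longrightarrow> edge_monomial e \<in> edge_sums E 1"
  unfolding edge_sums_def edge_generators_def by (auto intro: msums_gen)

lemma edge_sums_sum:
  "(\<And>i. i \<in> I \<Longrightarrow> f i \<in> edge_sums E (g i)) \<Longrightarrow> sum f I \<in> edge_sums E (sum g I)"
  by (induction I rule: infinite_finite_induct) (auto intro: edge_sums_add)

lemma edge_sums_induct [consumes 1, case_names zero add]: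
  assumes "u \<in> edge_sums E s" and "P 0 0"
    and add: "\<And>s u e. e \<in> E \<Longrightarrow> u \<in> edge_sums E s \<Longrightarrow> P s u \<Longrightarrow> P (Suc s) (u + edge_monomial e)"
  shows "P s u"
proof -
  have "(s, u) \<in> msums (edge_generators E)" using assms(1) by (simp add: edge_sums_def)
  then have "P (fst (s, u)) (snd (s, u))"
    by (induction "(s, u)" arbitrary: s u rule: msums_induct)
       (auto simp: zero_prod_def assms(2) edge_generators_def edge_sums_def intro!: add)
  then show ?thesis by simp
qed

lemma power_monomialsI: "u \<in> edge_sums E t \<Longrightarrow> r \<in> monomials V \<Longrightarrow> u + r \<in> power_monomials V E t"
  by (auto simp: power_monomials_def)

lemma edge_sums_power: "u \<in> edge_sums E t \<Longrightarrow> u \<in> power_monomials V E t"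
  using power_monomialsI[of u E t 0 V] by simp

lemma power_monomials_shift:
  assumes "u \<in> power_monomials V E t" "r \<in> monomials V" shows "u + r \<in> power_monomials V E t"
  using assms unfolding power_monomials_def by (force simp: add.assoc)

lemma power_monomials_add:
  assumes "u \<in> edge_sums E s" "w \<in> power_monomials V E t" shows "u + w \<in> power_monomials V E (s + t)"
proof -
  obtain a r where "w = a + r" "a \<in> edge_sums E t" "r \<in> monomials V"
    using assms(2) by (auto simp: power_monomials_def)
  then show ?thesis
    using power_monomialsI[OF edge_sums_add[OF assms(1)]] by (metis add.assoc)
qed

lemma edge_sums_0_eq: "edge_sums E 0 = {0}"
proof -
  have "s = 0 \<longrightarrow> u = 0" if "u \<in> edge_sums E s" for s u
    using that by (induction rule: edge_sums_induct) auto
  then show ?thesis using edge_sums_0 by blast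
qed

lemma power_monomials_0: "power_monomials V E 0 = monomials V"
  by (simp add: power_monomials_def edge_sums_0_eq)

context
  fixes V :: "'v set" and E :: "'v set set"
  assumes finV: "finite V" and EV: "E \<subseteq> Pow V"
begin

lemma finE: "finite E"
  using finV EV finite_subset by blast

lemma edge_sums_monomials: "u \<in> edge_sums E s \<Longrightarrow> u \<in> monomials V"
  by (induction rule: edge_sums_induct) (use EV in \<open>auto intro!: edge_monomial_in\<close>)

lemma power_monomials_monomials: "u \<in> power_monomials V E s \<Longrightarrow> u \<in> monomials V"
  by (auto simp: power_monomials_def edge_sums_monomials)

text \<open>Both sides are additive in \<open>u\<close>, so a proportion valid for every edge passes
  to sums of edges.\<close>

lemma edge_sums_sum_lookup:
  assumes "u \<in> edge_sums E s" "C1 \<subseteq> V" "C2 \<subseteq> V" 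
    and "\<And>e. e \<in> E \<Longrightarrow> c2 * card (e \<inter> C1) = c1 * card (e \<inter> C2)"
  shows "c2 * (\<Sum>v\<in>C1. lookup u v) = c1 * (\<Sum>v\<in>C2. lookup u v)"
  using assms(1)
proof (induction rule: edge_sums_induct)
  case (add s u e)
  then have "e \<subseteq> V" using EV by blast
  then show ?case using add assms(4)[of e]
    by (simp add: lookup_add sum.distrib distrib_left sum_edge_monomial[OF finV] assms(2,3))
qed simp

text \<open>Pairs \<open>(t, u)\<close> gather all levels into one graded object:
  \<open>torsion_top\<close> outside \<open>torsion_bot\<close> is a monomial basis of the torsion
  of the associated graded ring, and \<open>edge_generators E\<close> acts on it in degree
  1.\<close>

definition torsion_top :: "(nat \<times> ('v \<Rightarrow>\<^sub>0 nat)) set" where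
  "torsion_top = {(t, u). u \<in> saturated_monomials V E t}"

definition torsion_bot :: "(nat \<times> ('v \<Rightarrow>\<^sub>0 nat)) set" where
  "torsion_bot = {(t, u). u \<in> power_monomials V E (Suc t)}"

lemma act_closed_torsion_bot: "act_closed (edge_generators E) torsion_bot"
  unfolding act_closed_def torsion_bot_def edge_generators_def
  using power_monomials_add[OF edge_sums_edge] by (fastforce simp: add.commute)

lemma saturated_add_monomial:
  "u \<in> saturated_monomials V E t \<Longrightarrow> r \<in> monomials V \<Longrightarrow> u + r \<in> saturated_monomials V E t"
  unfolding saturated_monomials_def
proof (clarsimp, intro conjI power_monomials_shift)
  fix k assume k: "\<forall>w\<in>monomials V. k \<le> mdeg V w \<longrightarrow> u + w \<in> power_monomials V E (Suc t)"
    and r: "r \<in> monomials V"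
  show "\<exists>k. \<forall>w\<in>monomials V. k \<le> mdeg V w \<longrightarrow> u + r + w \<in> power_monomials V E (Suc t)"
    using k r by (intro exI[of _ k]) (simp add: add.assoc)
qed auto

lemma saturated_add_edge:
  assumes "u \<in> saturated_monomials V E t" "e \<in> E"
  shows "u + edge_monomial e \<in> saturated_monomials V E (Suc t)"
proof -
  note a = power_monomials_add[OF edge_sums_edge[OF assms(2)], of _ V]
  obtain k where k: "\<forall>w\<in>monomials V. mdeg V w \<ge> k \<longrightarrow> u + w \<in> power_monomials V E (Suc t)"
    and u: "u \<in> power_monomials V E t"
    using assms(1) unfolding saturated_monomials_def by blast
  have "u + edge_monomial e + w \<in> power_monomials V E (Suc (Suc t))" 
    if "w \<in> monomials V" "mdeg V w \<ge> k" for w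
    using a[of "u + w" "Suc t"] k that by (simp add: ac_simps)
  moreover have "u + edge_monomial e \<in> power_monomials V E (Suc t)"
    using a[OF u] by (simp add: ac_simps)
  ultimately show ?thesis unfolding saturated_monomials_def by blast
qed

lemma act_closed_torsion_top:
  "act_closed (edge_generators E \<union> (\<lambda>v. (0, single v 1)) ` V) torsion_top"
  unfolding act_closed_def torsion_top_def edge_generators_def
  by (auto intro: saturated_add_edge intro!: saturated_add_monomial[OF _ monomials_single])

lemma msums_nodes: "r \<in> monomials V \<Longrightarrow> (0, r) \<in> msums ((\<lambda>v. (0::nat, single v (1::nat))) ` V)"
proof -
  assume r: "r \<in> monomials V"
  let ?G = "(\<lambda>v. (0::nat, single v (1::nat))) ` V"
  have "(\<Sum>v\<in>V. \<Sum>i<lookup r v. (0::nat, single v (1::nat))) \<in> msums ?G"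
    by (intro msums_sum msums_gen) auto
  also have "(\<Sum>v\<in>V. \<Sum>i<lookup r v. (0::nat, single v (1::nat))) = (0, r)"
  proof (rule prod_eqI)
    show "snd (\<Sum>v\<in>V. \<Sum>i<lookup r v. (0::nat, single v (1::nat))) = snd (0::nat, r)"
      unfolding snd_sum
      by (rule poly_mapping_eqI)
         (use r finV in \<open>auto simp: lookup_sum lookup_single when_def if_distrib[of "(*) _"] sum.delta monomials_lookup_0 cong: if_cong\<close>)
  qed (simp add: fst_sum)
  finally show ?thesis .
qed

lemma msums_mono: "G \<subseteq> H \<Longrightarrow> msums G \<subseteq> msums H"
  by (auto simp: msums_def)

text \<open>Edges and nodes together generate all \<open>power_monomials\<close> from 0, so
  \<open>fg_modulo_sub\<close> makes \<open>torsion_top\<close> finitely generated by them modulo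
  \<open>torsion_bot\<close>. The nodes are then eliminated: a multiple of a generator by a node
  monomial of high degree falls into \<open>torsion_bot\<close>, hence finitely many node multiples
  of each generator suffice.\<close>

lemma fg_modulo_torsion: "fg_modulo (edge_generators E) torsion_top torsion_bot"
proof -
  let ?N = "(\<lambda>v. (0::nat, single v (1::nat))) ` V"
  let ?G = "edge_generators E \<union> ?N"
  let ?W = "{(t, u). u \<in> power_monomials V E t}"
  have fin: "finite ?G" using finV finE by (simp add: edge_generators_def)
  have nodes: "(0, r) \<in> msums ?G" if "r \<in> monomials V" for r
    using msums_nodes[OF that] msums_mono[of ?N ?G] by blast
  have "\<exists>f\<in>{0}. \<exists>z\<in>msums ?G. x = f + z" if xW: "x \<in> ?W" for x
  proof -
    obtain t u r where x': "x = (t, u + r)" and u: "u \<in> edge_sums E t" "r \<in> monomials V"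
      using xW by (auto simp: power_monomials_def)
    then have x: "x = (t, u) + (0, r)" by simp
    have "(t, u) \<in> msums ?G" using u(1) msums_mono[of "edge_generators E" ?G] by (auto simp: edge_sums_def)
    then have "x \<in> msums ?G" unfolding x by (rule msums_add) (rule nodes[OF u(2)])
    then show ?thesis by simp
  qed
  moreover have "0 \<in> ?W" by (simp add: zero_prod_def power_monomials_0)
  ultimately have "fg_modulo ?G ?W torsion_bot"
    unfolding fg_modulo_def by (intro exI[of _ "{0}"]) auto
  moreover have "torsion_top \<subseteq> ?W" by (auto simp: torsion_top_def saturated_monomials_def)
  ultimately have "fg_modulo ?G torsion_top torsion_bot"
    by (rule fg_modulo_sub[OF fin _ act_closed_torsion_top])
  then obtain F where F: "finite F" "F \<subseteq> torsion_top" 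
    "\<forall>x\<in>torsion_top - torsion_bot. \<exists>f\<in>F. \<exists>z\<in>msums ?G. x = f + z"
    unfolding fg_modulo_def by blast
  have "\<forall>f\<in>F. \<exists>k. \<forall>w\<in>monomials V. mdeg V w \<ge> k \<longrightarrow> snd f + w \<in> power_monomials V E (Suc (fst f))"
    using F(2) by (force simp: torsion_top_def saturated_monomials_def)
  then obtain k where k: "\<And>f w. f \<in> F \<Longrightarrow> w \<in> monomials V \<Longrightarrow> mdeg V w \<ge> k f 
     \<Longrightarrow> snd f + w \<in> power_monomials V E (Suc (fst f))" by metis
  obtain K where K: "\<And>f. f \<in> F \<Longrightarrow> k f \<le> K"
    using finite_nat_set_iff_bounded_le[of "k ` F"] F(1) by auto
  define F' where "F' = (\<lambda>(f, r). f + (0, r)) ` (F \<times> {r \<in> monomials V. mdeg V r \<le> K})"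
  \<comment> \<open>A sum of generators is sorted into edges and nodes, so that the bound
    \<open>K\<close> can be applied to the node part.\<close>
  have split: "\<exists>z1\<in>msums (edge_generators E). \<exists>r\<in>monomials V. z = z1 + (0, r)" 
    if "z \<in> msums ?G" for z
    using that
  proof (induction rule: msums_induct)
    case zero
    have "0 = 0 + (0::nat, 0::'v \<Rightarrow>\<^sub>0 nat)" by (simp add: zero_prod_def)
    then show ?case using msums_0 monomials_0 by blast
  next
    case (add g z)
    then obtain z1 r where z: "z1 \<in> msums (edge_generators E)" "r \<in> monomials V" "z = z1 + (0, r)" by blast
    show ?case
    proof (cases "g \<in> edge_generators E")
      case True
      then show ?thesis using z msums_add[OF z(1) msums_gen[OF True]]
        by (intro bexI[of _ "z1 + g"] bexI[of _ r]) (auto simp: ac_simps)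
    next
      case False
      then obtain v where v: "v \<in> V" "g = (0, single v 1)" using add.hyps(1) by auto
      then show ?thesis using z
        by (intro bexI[of _ z1] bexI[of _ "r + single v 1"]) (auto simp: add.assoc)
    qed
  qed
  show ?thesis unfolding fg_modulo_def
  proof (intro exI[of _ F'] conjI ballI)
    show "finite F'" using F(1) finite_mdeg_le[OF finV] by (auto simp: F'_def)
    show "F' \<subseteq> torsion_top"
      using F(2) by (auto simp: F'_def torsion_top_def intro!: saturated_add_monomial)
    fix x assume x: "x \<in> torsion_top - torsion_bot"
    then obtain f z where f: "f \<in> F" "z \<in> msums ?G" "x = f + z" using F(3) by blast
    obtain z1 r where z: "z1 \<in> msums (edge_generators E)" "r \<in> monomials V" "z = z1 + (0, r)"
      using split[OF f(2)] by blast
    have "mdeg V r \<le> K"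
    proof (rule ccontr)
      assume "\<not> mdeg V r \<le> K"
      then have "snd f + r \<in> power_monomials V E (Suc (fst f))" using k[OF f(1) z(2)] K[OF f(1)] by simp
      then have "f + (0, r) \<in> torsion_bot" by (cases f) (simp add: torsion_bot_def)
      then have "f + (0, r) + z1 \<in> torsion_bot" using act_closed_msums[OF act_closed_torsion_bot] z(1) by blast
      then show False using x f(3) z(3) by (simp add: ac_simps)
    qed
    then show "\<exists>f\<in>F'. \<exists>z\<in>msums (edge_generators E). x = f + z"
      using f z by (intro bexI[of _ "f + (0, r)"] bexI[of _ z1]) (auto simp: F'_def ac_simps)
  qed
qed

text \<open>These monomials represent a basis of the zeroth local cohomology of \<open>I\<^sup>t / I\<^sup>t\<^sup>+\<^sup>1\<close>.\<close>

definition torsion_monomials :: "nat \<Rightarrow> ('v \<Rightarrow>\<^sub>0 nat) set" where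
  "torsion_monomials t = saturated_monomials V E t - power_monomials V E (Suc t)"

lemma torsion_level:
  "{x \<in> torsion_top - torsion_bot. fst x = t} = Pair t ` torsion_monomials t"
  by (auto simp: torsion_top_def torsion_bot_def torsion_monomials_def)

lemma finite_torsion_monomials: "finite (torsion_monomials t)"
proof -
  have "finite {x \<in> torsion_top - torsion_bot. fst x = t}"
    by (rule finite_level[OF _ _ _ _ fg_modulo_torsion]) (auto simp: edge_generators_def finE)
  then show ?thesis unfolding torsion_level by (rule finite_imageD) (auto intro: inj_onI)
qed

lemma torsion_limit:
  "\<exists>L. (\<lambda>t. ereal (real (card (torsion_monomials t))) / ereal (real t ^ k)) \<longlonglongrightarrow> L"
proof (rule ev_diff_limit)
  have "act_closed (edge_generators E) torsion_top"
    using act_closed_torsion_top by (rule act_closed_mono) simp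
  then have "ev_diff (card (edge_generators E)) (\<lambda>t. real (card {x \<in> torsion_top - torsion_bot. fst x = t}))"
    by (intro hilbert_function act_closed_torsion_bot fg_modulo_torsion) (auto simp: edge_generators_def finE)
  then show "ev_diff (card (edge_generators E)) (\<lambda>t. real (card (torsion_monomials t)))"
    unfolding torsion_level by (subst (asm) card_image) (auto intro: inj_onI)
qed simp

end

section \<open>The growth of the torsion\<close>

lemma mdeg_edge_sums:
  assumes "finite V" "E \<subseteq> Pow V" "uniform m E" "u \<in> edge_sums E s"
  shows "mdeg V u = m * s"
  using assms(4)
  by (induction rule: edge_sums_induct)
     (use assms in \<open>auto simp: mdeg_edge_monomial uniform_def subset_iff\<close>)

lemma mdeg_power_monomials:
  assumes "finite V" "E \<subseteq> Pow V" "uniform m E" "u \<in> power_monomials V E s"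
  shows "mdeg V u \<ge> m * s"
  using assms(4) mdeg_edge_sums[OF assms(1-3)] by (auto simp: power_monomials_def)

text \<open>All exponents but that of \<open>x0\<close> range freely up to
  \<open>q div card V\<close>; their sum is at most \<open>q\<close>, and the exponent of
  \<open>x0\<close> fills up the degree.\<close>

lemma card_monomials_of_degree:
  assumes "finite V" "V \<noteq> {}"
  shows "(q div card V + 1) ^ (card V - 1) \<le> card {r \<in> monomials V. mdeg V r = q}"
proof -
  obtain x0 where x0: "x0 \<in> V" using assms(2) by blast
  define V' where "V' = V - {x0}"
  have V': "finite V'" "V = insert x0 V'" "x0 \<notin> V'" using assms(1) x0 by (auto simp: V'_def)
  define d where "d = q div card V"
  define f where "f g = (\<Sum>v\<in>V'. single v (g v)) + single x0 (q - (\<Sum>v\<in>V'. g v))" for g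
  have lf: "lookup (f g) v = g v" if "v \<in> V'" for g v
    using that V' by (auto simp: f_def lookup_add lookup_sum lookup_single when_def sum.delta)
  have lf0: "lookup (f g) x0 = q - (\<Sum>v\<in>V'. g v)" for g
    using V' by (auto simp: f_def lookup_add lookup_sum lookup_single when_def sum.delta)
  have "f ` (V' \<rightarrow>\<^sub>E {..d}) \<subseteq> {r \<in> monomials V. mdeg V r = q}"
  proof
    fix r assume "r \<in> f ` (V' \<rightarrow>\<^sub>E {..d})"
    then obtain g where g: "g \<in> V' \<rightarrow>\<^sub>E {..d}" "r = f g" by blast
    have "(\<Sum>v\<in>V'. g v) \<le> card V' * d" using g(1) sum_bounded_above[of V' g d] by auto
    also have "\<dots> \<le> card V * d" using V' by simp
    also have "\<dots> \<le> q" by (simp add: d_def)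
    finally have "(\<Sum>v\<in>V'. g v) \<le> q" .
    then have "mdeg V r = q" using V' by (simp add: mdeg_def g(2) lf lf0)
    moreover have "r \<in> monomials V" unfolding g(2) f_def using V'
      by (auto intro!: monomials_sum)
    ultimately show "r \<in> {r \<in> monomials V. mdeg V r = q}" by simp
  qed
  moreover have "inj_on f (V' \<rightarrow>\<^sub>E {..d})"
  proof (rule inj_onI)
    fix g g' assume g: "g \<in> V' \<rightarrow>\<^sub>E {..d}" "g' \<in> V' \<rightarrow>\<^sub>E {..d}" "f g = f g'"
    show "g = g'" by (rule PiE_ext[OF g(1,2)]) (metis lf g(3))
  qed
  moreover have "finite {r \<in> monomials V. mdeg V r = q}"
    by (rule finite_subset[OF _ finite_mdeg_le[OF assms(1), of q]]) auto
  ultimately have "card (V' \<rightarrow>\<^sub>E {..d}) \<le> card {r \<in> monomials V. mdeg V r = q}"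
    by - (rule card_inj_on_le)
  moreover have "card (V' \<rightarrow>\<^sub>E {..d}) = (d + 1) ^ (card V - 1)"
    using V' by (simp add: card_PiE)
  ultimately show ?thesis by (simp add: d_def)
qed

text \<open>If \<open>W\<close> and all \<open>W + m x\<close> are sums of edges, then so is \<open>W + q W + m r\<close> for every \<open>r\<close> of degree \<open>q\<close>, and
  different \<open>r\<close> give different sums.\<close>

lemma card_torsion_monomials_lower:
  assumes V: "finite V" "V \<noteq> {}" and E: "E \<subseteq> Pow V" "uniform m E" and m: "m \<ge> 1"
    and piv: "\<And>v. v \<in> V \<Longrightarrow> \<exists>b w. w \<in> edge_sums E b \<and> w + single v m \<in> edge_sums E (Suc b)"
  shows "\<exists>a. \<forall>q. (q div card V + 1) ^ (card V - 1) \<le> card (torsion_monomials V E (a + q * Suc a))"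
proof -
  obtain b w where bw: "\<And>v. v \<in> V \<Longrightarrow> w v \<in> edge_sums E (b v)"
    "\<And>v. v \<in> V \<Longrightarrow> w v + single v m \<in> edge_sums E (Suc (b v))"
    using piv by metis
  \<comment> \<open>Summing over all nodes gives one \<open>W\<close> and one number
    \<open>a\<close> of edges that serve every \<open>v\<close>.\<close>
  define a W where "a = sum b V" and "W = sum w V"
  have W: "W \<in> edge_sums E a" unfolding a_def W_def using bw(1) by (intro edge_sums_sum) auto
  have Wv: "W + single v m \<in> edge_sums E (Suc a)" if v: "v \<in> V" for v
  proof -
    have "sum w (V - {v}) + (w v + single v m) \<in> edge_sums E (sum b (V - {v}) + Suc (b v))"
      using bw v by (intro edge_sums_add edge_sums_sum) auto
    then show ?thesis using v V(1) by (simp add: W_def a_def sum.remove ac_simps)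
  qed
  \<comment> \<open>One summand \<open>W + single v m\<close> for each unit of
    \<open>lookup r v\<close>: altogether \<open>mdeg V r\<close> copies of \<open>W\<close> plus
    \<open>m\<close> times \<open>r\<close>. The \<open>W\<close> part depends only on the degree of
    \<open>r\<close>, hence injectivity on each degree.\<close>
  define \<phi> where "\<phi> r = (\<Sum>v\<in>V. \<Sum>i<lookup r v. W + single v m)" for r :: "'a \<Rightarrow>\<^sub>0 nat"
  have phi_in: "\<phi> r \<in> edge_sums E (mdeg V r * Suc a)" for r
  proof -
    have "\<phi> r \<in> edge_sums E (\<Sum>v\<in>V. \<Sum>i<lookup r v. Suc a)"
      unfolding \<phi>_def by (intro edge_sums_sum Wv)
    moreover have "(\<Sum>v\<in>V. \<Sum>i<lookup r v. Suc a) = mdeg V r * Suc a"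
      by (simp add: mdeg_def sum_distrib_right del: mult_Suc_right)
    ultimately show ?thesis by simp
  qed
  have lookup_phi: "lookup (\<phi> r) x = mdeg V r * lookup W x + m * lookup r x"
    if "x \<in> V" for r x
  proof -
    have "lookup (\<phi> r) x = (\<Sum>v\<in>V. lookup r v * lookup W x 
       + (if v = x then m * lookup r x else 0))"
      by (auto simp: \<phi>_def lookup_sum lookup_add lookup_single when_def algebra_simps intro!: sum.cong)
    then show ?thesis using that V(1) by (simp add: sum.distrib sum.delta mdeg_def sum_distrib_right)
  qed
  show ?thesis
  proof (intro exI allI)
    fix q
    let ?D = "{r \<in> monomials V. mdeg V r = q}" and ?t = "a + q * Suc a"
    have "inj_on (\<lambda>r. W + \<phi> r) ?D"
    proof (rule inj_onI)
      fix r r' assume r: "r \<in> ?D" "r' \<in> ?D" "W + \<phi> r = W + \<phi> r'"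
      show "r = r'"
      proof (rule monomials_eqI[of r V])
        fix v assume v: "v \<in> V"
        have "\<phi> r = \<phi> r'" using r(3) by simp
        then show "lookup r v = lookup r' v"
          using r(1,2) m lookup_phi[OF v, of r] lookup_phi[OF v, of r'] by simp
      qed (use r in auto)
    qed
    moreover have "(\<lambda>r. W + \<phi> r) ` ?D \<subseteq> torsion_monomials V E ?t"
    proof
      fix u assume "u \<in> (\<lambda>r. W + \<phi> r) ` ?D"
      then obtain r where r: "r \<in> monomials V" "mdeg V r = q" "u = W + \<phi> r" by blast
      have u: "u \<in> edge_sums E ?t" unfolding r(3) using edge_sums_add[OF W phi_in[of r]] r(2) by simp
      \<comment> \<open>Homogeneity: a sum of \<open>?t\<close> edges has degree
        \<open>m * ?t\<close>, too small for the power \<open>Suc ?t\<close>.\<close>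
      have "u \<notin> power_monomials V E (Suc ?t)"
        using mdeg_edge_sums[OF V(1) E u] mdeg_power_monomials[OF V(1) E, of u "Suc ?t"] m by auto
      moreover have "u + x \<in> power_monomials V E (Suc ?t)" 
        if x: "x \<in> monomials V" "card V * m \<le> mdeg V x" for x
      proof -
        \<comment> \<open>By pigeonhole, degree \<open>card V * m\<close> forces an exponent of at
          least \<open>m\<close>. The resulting \<open>single v m\<close> is absorbed by the summand
          \<open>W\<close> held in reserve outside \<open>\<phi> r\<close>, which gains one
          edge.\<close>
        have "\<exists>v\<in>V. lookup x v \<ge> m"
        proof (rule ccontr)
          assume "\<not> ?thesis"
          then have "mdeg V x < (\<Sum>v\<in>V. m)" unfolding mdeg_def
            using V by (intro sum_strict_mono) auto
          then show False using x(2) by simp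
        qed
        then obtain v where v: "v \<in> V" "lookup x v \<ge> m" by blast
        obtain x' where x': "x' \<in> monomials V" "x = x' + single v m"
          using split_single[OF x(1) v(2)] .
        have "W + single v m + \<phi> r \<in> edge_sums E (Suc a + q * Suc a)"
          using edge_sums_add[OF Wv[OF v(1)] phi_in[of r]] r(2) by simp
        from power_monomialsI[OF this x'(1)] show ?thesis by (simp add: r(3) x'(2) ac_simps)
      qed
      ultimately show "u \<in> torsion_monomials V E ?t"
        unfolding torsion_monomials_def[OF V(1) E(1)] saturated_monomials_def
        using edge_sums_power[OF u] by blast
    qed
    ultimately have "card ?D \<le> card (torsion_monomials V E ?t)"
      using finite_torsion_monomials[OF V(1) E(1), of ?t] by - (rule card_inj_on_le)
    then show "(q div card V + 1) ^ (card V - 1) \<le> card (torsion_monomials V E ?t)"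
      using card_monomials_of_degree[OF V, of q] by linarith
  qed
qed

lemma ereal_divide_pos: "0 < y \<Longrightarrow> ereal x / ereal y = ereal (x / y)"
  by simp

text \<open>The lower bound covers only the levels \<open>a + q * Suc a\<close>; as the limit
  exists, this subsequence decides its sign.\<close>

lemma torsion_limit_pos:
  assumes V: "finite V" "V \<noteq> {}" and E: "E \<subseteq> Pow V" "uniform m E" and m: "m \<ge> 1"
    and piv: "\<And>v. v \<in> V \<Longrightarrow> \<exists>b w. w \<in> edge_sums E b \<and> w + single v m \<in> edge_sums E (Suc b)"
  shows "\<exists>L>0. (\<lambda>t. ereal (real (card (torsion_monomials V E t))) / ereal (real t ^ (card V - 1))) \<longlonglongrightarrow> L"
proof -
  let ?f = "\<lambda>t. ereal (real (card (torsion_monomials V E t))) / ereal (real t ^ (card V - 1))"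
  obtain L where L: "?f \<longlonglongrightarrow> L" using torsion_limit[OF V(1) E(1)] by blast
  obtain a where a: "\<And>q. (q div card V + 1) ^ (card V - 1) \<le> card (torsion_monomials V E (a + q * Suc a))"
    using card_torsion_monomials_lower[OF V E m piv] by blast
  define n where "n = card V"
  have n: "n \<ge> 1" using V by (simp add: n_def Suc_le_eq card_gt_0_iff)
  \<comment> \<open>From \<open>t \<le> 2 * q * Suc a\<close> and
    \<open>q / n \<le> q div n + 1\<close>, there are at least
    \<open>(t / (2 * n * Suc a)) ^ (n - 1)\<close> torsion monomials on level
    \<open>t\<close>.\<close>
  define c where "c = (1 / (2 * real n * real (Suc a))) ^ (n - 1)"
  have "ereal c \<le> ?f (a + q * Suc a)" if q: "q \<ge> 1" for q
  proof -
    let ?t = "a + q * Suc a"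
    have t: "?t \<ge> 1" using q by simp
    then have pos: "0 < real ?t" by (simp only: of_nat_0_less_iff)
    have "?t \<le> 2 * q * Suc a" using q by (cases q) auto
    then have "real ?t \<le> real (2 * q * Suc a)" by (rule of_nat_mono)
    then have "1 / (2 * real n * real (Suc a)) * real ?t \<le> 1 / (2 * real n * real (Suc a)) * real (2 * q * Suc a)"
      by (rule mult_left_mono) simp
    also have "real (2 * q * Suc a) = 2 * real q * real (Suc a)" by (simp only: of_nat_mult of_nat_numeral)
    also have "1 / (2 * real n * real (Suc a)) * (2 * real q * real (Suc a)) = real q / real n"
      using n by (simp add: divide_simps del: of_nat_Suc)
    also have "real q / real n \<le> real (q div n + 1)"
    proof -
      have "real q / real n < real_of_int \<lfloor>real q / real n\<rfloor> + 1" by linarith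
      then show ?thesis by (simp add: floor_divide_of_nat_eq)
    qed
    finally have "(1 / (2 * real n * real (Suc a)) * real ?t) ^ (n - 1) \<le> real (q div n + 1) ^ (n - 1)"
      by (intro power_mono) auto
    also have "\<dots> \<le> real (card (torsion_monomials V E ?t))" using a[of q] unfolding n_def
      by (metis of_nat_le_iff of_nat_power)
    finally have "c * real ?t ^ (n - 1) \<le> real (card (torsion_monomials V E ?t))"
      by (simp only: c_def power_mult_distrib)
    then have "c \<le> real (card (torsion_monomials V E ?t)) / real ?t ^ (n - 1)"
      by (simp only: pos_le_divide_eq[OF zero_less_power[OF pos]])
    moreover have "?f ?t = ereal (real (card (torsion_monomials V E ?t)) / real ?t ^ (n - 1))"
      unfolding n_def by (rule ereal_divide_pos) (rule zero_less_power[OF pos])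
    ultimately show ?thesis by simp
  qed
  moreover have "(\<lambda>q. ?f (a + q * Suc a)) \<longlonglongrightarrow> L"
    by (rule filterlim_compose[OF L]) (auto intro!: filterlim_subseq strict_monoI simp del: mult_Suc_right)
  ultimately have "ereal c \<le> L"
    by (intro tendsto_lowerbound[of _ L sequentially]) (auto intro: eventually_sequentiallyI[of 1])
  moreover have "c > 0" using n by (simp add: c_def)
  ultimately have "L > 0" by (metis ereal_less(2) order_less_le_trans)
  then show ?thesis using L by blast
qed

text \<open>The total degree is \<open>m * s\<close>, and the sums of exponents over
  \<open>C1\<close> and \<open>C2\<close> are in a fixed proportion. These two equations determine
  the exponents of \<open>x\<close> and \<open>y\<close> from the remaining
  \<open>card V - 2\<close>, which range over \<open>0..s\<close>.\<close>

lemma card_edge_sums_balanced: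
  assumes V: "finite V" and E: "E \<subseteq> Pow V" "uniform m E"
    and C: "C1 \<subseteq> V" "C2 \<subseteq> V" "C1 \<inter> C2 = {}" "x \<in> C1" "y \<in> C2"
    and bal: "\<And>e. e \<in> E \<Longrightarrow> c2 * card (e \<inter> C1) = c1 * card (e \<inter> C2)" and c: "c1 + c2 > (0::nat)"
  shows "finite (edge_sums E s)" "card (edge_sums E s) \<le> Suc s ^ (card V - 2)"
proof -
  \<comment> \<open>Elimination: shifting weight \<open>a - a'\<close> between \<open>x\<close> and
    \<open>y\<close> at constant degree changes the balance by \<open>(a2 + a1) * (a - a')\<close>.
    The determinant \<open>a2 + a1\<close> will be positive by \<open>c\<close>. Integers are used
    because of the subtractions.\<close>
  have aux: "(a2 + a1) * (a - a') = 0" 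
    if "a2 * S1 = a1 * S2" "a2 * S1' = a1 * S2'" "S1 + a' = S1' + a" "S2 + b' = S2' + b" "a + b = a' + b'"
    for a2 S1 a1 S2 S1' S2' a a' b b' :: int
  proof -
    have 1: "a - a' = S1 - S1'" and 2: "S2 - S2' = - (a - a')" using that by simp_all
    have 3: "a2 * (S1 - S1') = a1 * (S2 - S2')" using that by (simp add: right_diff_distrib)
    have "(a2 + a1) * (a - a') = a2 * (S1 - S1') + a1 * (a - a')" by (simp only: distrib_right 1)
    also have "\<dots> = a1 * (- (a - a')) + a1 * (a - a')" by (simp only: 3 2)
    also have "\<dots> = 0" by (simp add: right_diff_distrib)
    finally show ?thesis .
  qed
  \<comment> \<open>An edge has exponents at most 1, so \<open>s\<close> edges give at most
    \<open>s\<close>.\<close>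
  have bound: "lookup u v \<le> s" if "u \<in> edge_sums E s" "v \<in> V" for u v
    using that(1)
  proof (induction rule: edge_sums_induct)
    case (add s u e)
    have "finite e" using add(1) E(1) V by (auto intro: finite_subset)
    then show ?case using add by (simp add: lookup_add lookup_edge_monomial)
  qed simp
  show fin: "finite (edge_sums E s)"
    by (rule finite_subset[OF _ bounded_monomials(1)[OF V, of s]])
       (use bound edge_sums_monomials[OF V E(1)] in auto)
  define V' where "V' = V - {x, y}"
  have xy: "x \<in> V" "y \<in> V" "x \<noteq> y" using C by auto
  have V': "finite V'" "card V' = card V - 2" using V xy by (simp_all add: V'_def card_Diff_subset)
  let ?r = "\<lambda>u. restrict (lookup u) V'"
  have "inj_on ?r (edge_sums E s)"
  proof (rule inj_onI)
    fix u w assume u: "u \<in> edge_sums E s" and w: "w \<in> edge_sums E s" and eq: "?r u = ?r w"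
    have eq': "lookup u v = lookup w v" if "v \<in> V" "v \<noteq> x" "v \<noteq> y" for v
      using fun_cong[OF eq, of v] that by (simp add: V'_def)
    have sums: "(\<Sum>v\<in>C. lookup u v) + lookup w z
       = (\<Sum>v\<in>C. lookup w v) + lookup u z"
      if "C \<subseteq> V" "z \<in> C" "C \<inter> {x, y} = {z}" for C z
    proof -
      have "finite C" using V that(1) finite_subset by blast
      moreover have "(\<Sum>v\<in>C-{z}. lookup u v) = (\<Sum>v\<in>C-{z}. lookup w v)"
        by (rule sum.cong) (use that in \<open>auto intro!: eq'\<close>)
      ultimately show ?thesis using that(2) by (simp add: sum.remove)
    qed
    have "mdeg V u = mdeg V w" using mdeg_edge_sums[OF V E] u w by simp
    moreover have "mdeg V z = lookup z x + lookup z y + (\<Sum>v\<in>V'. lookup z v)" for z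
    proof -
      have "V = insert x (insert y V')" "x \<notin> insert y V'" "y \<notin> V'" using xy by (auto simp: V'_def)
      then show ?thesis using V'(1) by (metis (no_types, lifting) ab_semigroup_add_class.add_ac(1) finite_insert mdeg_def sum.insert)
    qed
    moreover have "(\<Sum>v\<in>V'. lookup u v) = (\<Sum>v\<in>V'. lookup w v)"
      by (rule sum.cong) (auto simp: V'_def intro!: eq')
    ultimately have A: "lookup u x + lookup u y = lookup w x + lookup w y"
      by simp
    note s1 = sums[OF C(1,4)] and s2 = sums[OF C(2,5)]
    have "c2 * (\<Sum>v\<in>C1. lookup u v) = c1 * (\<Sum>v\<in>C2. lookup u v)"
      "c2 * (\<Sum>v\<in>C1. lookup w v) = c1 * (\<Sum>v\<in>C2. lookup w v)"
      using edge_sums_sum_lookup[OF V E(1) u C(1,2) bal] edge_sums_sum_lookup[OF V E(1) w C(1,2) bal] by auto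
    moreover have "C1 \<inter> {x, y} = {x}" "C2 \<inter> {x, y} = {y}" using C by auto
    ultimately have "(int c2 + int c1) * (int (lookup u x) - int (lookup w x)) = 0"
      using s1 s2 A by (intro aux[of _ "int (\<Sum>v\<in>C1. lookup u v)" _ "int (\<Sum>v\<in>C2. lookup u v)"
        "int (\<Sum>v\<in>C1. lookup w v)" "int (\<Sum>v\<in>C2. lookup w v)" _ _
        "int (lookup w y)" "int (lookup u y)"])
        (simp_all only: of_nat_add[symmetric] of_nat_mult[symmetric])
    then have "lookup u x = lookup w x" "lookup u y = lookup w y"
      using A c by auto
    then have "lookup u v = lookup w v" if "v \<in> V" for v
      using eq'[OF that] by (cases "v = x"; cases "v = y") auto
    then show "u = w"
      by (rule monomials_eqI[OF edge_sums_monomials[OF V E(1) u] edge_sums_monomials[OF V E(1) w]])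
  qed
  moreover have "?r ` edge_sums E s \<subseteq> V' \<rightarrow>\<^sub>E {..s}"
    using bound[of _ v for v] by (auto simp: V'_def intro!: restrict_PiE_iff[THEN iffD2])
  ultimately have "card (edge_sums E s) \<le> card (V' \<rightarrow>\<^sub>E {..s})"
    using V'(1) by (intro card_inj_on_le finite_PiE) auto
  then show "card (edge_sums E s) \<le> Suc s ^ (card V - 2)" using V' by (simp add: card_PiE)
qed

text \<open>Every torsion monomial is one of finitely many generators plus a sum of edges, so the
  torsion inherits the order \<open>t ^ (card V - 2)\<close> from the sums of edges.\<close>

lemma torsion_limit_zero:
  assumes V: "finite V" and E: "E \<subseteq> Pow V" "uniform m E"
    and C: "C1 \<subseteq> V" "C2 \<subseteq> V" "C1 \<inter> C2 = {}" "x \<in> C1" "y \<in> C2"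
    and bal: "\<And>e. e \<in> E \<Longrightarrow> c2 * card (e \<inter> C1) = c1 * card (e \<inter> C2)" and c: "c1 + c2 > (0::nat)"
  shows "(\<lambda>t. ereal (real (card (torsion_monomials V E t))) / ereal (real t ^ (card V - 1))) \<longlonglongrightarrow> 0"
proof -
  note ES = card_edge_sums_balanced[OF V E C bal c]
  obtain F where F: "finite F" "F \<subseteq> torsion_top V E" 
    "\<forall>x\<in>torsion_top V E - torsion_bot V E. \<exists>f\<in>F. \<exists>z\<in>msums (edge_generators E). x = f + z"
    using fg_modulo_torsion[OF V E(1)] unfolding fg_modulo_def by blast
  have xy: "x \<in> V" "y \<in> V" "x \<noteq> y" using C by auto
  have n2: "card V \<ge> 2" using card_mono[OF V, of "{x,y}"] xy by simp
  have bound: "card (torsion_monomials V E t) \<le> card F * Suc t ^ (card V - 2)" for t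
  proof -
    \<comment> \<open>If \<open>fst f\<close> exceeds \<open>t\<close>, the truncated difference is
      0 and contributes just \<open>snd f\<close>, which is harmless in an upper bound.\<close>
    have "torsion_monomials V E t \<subseteq> (\<Union>f\<in>F. (\<lambda>w. snd f + w) ` edge_sums E (t - fst f))"
    proof
      fix u assume "u \<in> torsion_monomials V E t"
      then have "(t, u) \<in> torsion_top V E - torsion_bot V E"
        using torsion_level[OF V E(1), of t] by blast
      then obtain f z where f: "f \<in> F" "z \<in> msums (edge_generators E)" "(t, u) = f + z" using F(3) by blast
      then have "t = fst f + fst z" "u = snd f + snd z" by (metis fst_add fst_conv) (metis f(3) snd_add snd_conv)
      then have "u = snd f + snd z" "snd z \<in> edge_sums E (t - fst f)"
        using f(2) by (simp_all add: edge_sums_def)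
      then show "u \<in> (\<Union>f\<in>F. (\<lambda>w. snd f + w) ` edge_sums E (t - fst f))"
        using f(1) by blast
    qed
    then have "card (torsion_monomials V E t) \<le> card (\<Union>f\<in>F. (\<lambda>w. snd f + w) ` edge_sums E (t - fst f))"
      using F(1) ES(1) by (intro card_mono) auto
    also have "\<dots> \<le> (\<Sum>f\<in>F. card ((\<lambda>w. snd f + w) ` edge_sums E (t - fst f)))"
      by (rule card_UN_le[OF F(1)])
    also have "\<dots> \<le> (\<Sum>f\<in>F. Suc t ^ (card V - 2))"
    proof (rule sum_mono)
      fix f
      have "card ((\<lambda>w. snd f + w) ` edge_sums E (t - fst f)) \<le> card (edge_sums E (t - fst f))"
        by (rule card_image_le[OF ES(1)])
      also have "\<dots> \<le> Suc (t - fst f) ^ (card V - 2)" by (rule ES(2))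
      also have "\<dots> \<le> Suc t ^ (card V - 2)" by (rule power_mono) auto
      finally show "card ((\<lambda>w. snd f + w) ` edge_sums E (t - fst f)) \<le> Suc t ^ (card V - 2)" .
    qed
    finally show ?thesis by simp
  qed
  \<comment> \<open>\<open>Suc t \<le> 2 * t\<close> for \<open>t \<ge> 1\<close> yields the factor
    \<open>2 ^ (card V - 2)\<close>; one power of \<open>t\<close> is left in the
    denominator.\<close>
  let ?g = "\<lambda>t. real (card F) * 2 ^ (card V - 2) * inverse (real t)"
  have "(\<lambda>t. real (card (torsion_monomials V E t)) / real t ^ (card V - 1)) \<longlonglongrightarrow> 0"
  proof (rule tendsto_sandwich[where f = "\<lambda>_. 0" and h = ?g])
    have "?g \<longlonglongrightarrow> real (card F) * 2 ^ (card V - 2) * 0"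
      by (intro tendsto_mult tendsto_const lim_inverse_n)
    then show "?g \<longlonglongrightarrow> 0" by simp
    show "\<forall>\<^sub>F t in sequentially. real (card (torsion_monomials V E t)) / real t ^ (card V - 1) \<le> ?g t"
    proof (rule eventually_sequentiallyI)
      fix t :: nat assume t: "t \<ge> 1"
      have "real (card (torsion_monomials V E t)) \<le> real (card F * Suc t ^ (card V - 2))"
        using bound by (rule of_nat_mono)
      also have "\<dots> = real (card F) * real (Suc t) ^ (card V - 2)" by simp
      also have "\<dots> \<le> real (card F) * (2 * real t) ^ (card V - 2)"
        using t by (intro mult_left_mono power_mono) auto
      finally have "real (card (torsion_monomials V E t)) / real t ^ (card V - 1)
         \<le> real (card F) * (2 * real t) ^ (card V - 2) / real t ^ (card V - 1)"
        by (rule divide_right_mono) simp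
      also have "card V - 1 = Suc (card V - 2)" using n2 by simp
      finally have "real (card (torsion_monomials V E t)) / real t ^ Suc (card V - 2) \<le> ?g t"
        using t by (simp add: power_mult_distrib field_simps)
      then show "real (card (torsion_monomials V E t)) / real t ^ (card V - 1) \<le> ?g t"
        using \<open>card V - 1 = Suc (card V - 2)\<close> by simp
    qed
  qed auto
  then have "(\<lambda>t. ereal (real (card (torsion_monomials V E t)) / real t ^ (card V - 1))) \<longlonglongrightarrow> ereal 0"
    by (rule tendsto_ereal)
  moreover have "\<forall>\<^sub>F t in sequentially. ereal (real (card (torsion_monomials V E t)) / real t ^ (card V - 1))
    = ereal (real (card (torsion_monomials V E t))) / ereal (real t ^ (card V - 1))"
    by (rule eventually_sequentiallyI[of 1]) auto
  ultimately show ?thesis unfolding zero_ereal_def by (rule Lim_transform_eventually)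
qed

section \<open>Components and pivot equivalence\<close>

text \<open>Transitive and symmetric, but reflexive only at nodes covered by \<open>F\<close>; this
  is why connectedness treats \<open>x = y\<close> separately.\<close>

definition edge_path :: "'v set set \<Rightarrow> 'v \<Rightarrow> 'v \<Rightarrow> bool" where
  "edge_path F x y \<longleftrightarrow> (\<exists>es. es \<noteq> [] \<and> set es \<subseteq> F \<and> x \<in> hd es \<and> y \<in> last es \<and>
     successively (\<lambda>u v. u \<inter> v \<noteq> {}) es)"

lemma finite_edge: "hypergraph V E \<Longrightarrow> e \<in> E \<Longrightarrow> finite e"
  by (meson PowD finite_subset hypergraph_def subsetD)

lemma connected_hypergraph_edge_path:
  "connected_hypergraph V F \<longleftrightarrow> (\<forall>x\<in>V. \<forall>y\<in>V. x \<noteq> y \<longrightarrow> edge_path F x y)"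
  by (simp add: connected_hypergraph_def edge_path_def)

lemma edge_path_edge: "e \<in> F \<Longrightarrow> x \<in> e \<Longrightarrow> y \<in> e \<Longrightarrow> edge_path F x y"
  unfolding edge_path_def by (rule exI[of _ "[e]"]) simp

lemma edge_path_trans: "edge_path F x y \<Longrightarrow> edge_path F y z \<Longrightarrow> edge_path F x z"
  unfolding edge_path_def
proof (elim exE conjE)
  fix es fs
  assume "es \<noteq> []" "set es \<subseteq> F" "x \<in> hd es" "y \<in> last es" "successively (\<lambda>u v. u \<inter> v \<noteq> {}) es"
    "fs \<noteq> []" "set fs \<subseteq> F" "y \<in> hd fs" "z \<in> last fs" "successively (\<lambda>u v. u \<inter> v \<noteq> {}) fs"
  then show "\<exists>es. es \<noteq> [] \<and> set es \<subseteq> F \<and> x \<in> hd es \<and> z \<in> last es \<and> successively (\<lambda>u v. u \<inter> v \<noteq> {}) es"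
    by (intro exI[of _ "es @ fs"]) (auto simp: successively_append_iff)
qed

lemma edge_path_sym: "edge_path F x y \<Longrightarrow> edge_path F y x"
  unfolding edge_path_def
proof (elim exE conjE)
  fix es
  assume "es \<noteq> []" "set es \<subseteq> F" "x \<in> hd es" "y \<in> last es" "successively (\<lambda>u v. u \<inter> v \<noteq> {}) es"
  then show "\<exists>es. es \<noteq> [] \<and> set es \<subseteq> F \<and> y \<in> hd es \<and> x \<in> last es \<and> successively (\<lambda>u v. u \<inter> v \<noteq> {}) es"
    by (intro exI[of _ "rev es"]) (auto simp: hd_rev last_rev successively_rev Int_commute)
qed

lemma edge_path_mono: "edge_path F x y \<Longrightarrow> F \<subseteq> F' \<Longrightarrow> edge_path F' x y"
  unfolding edge_path_def by blast

text \<open>If \<open>e\<close> meets \<open>W\<close> in \<open>z\<close>, every node of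
  \<open>W \<union> e\<close> is joined to \<open>z\<close>. So \<open>W \<union> e\<close> is
  connected, and \<open>W\<close> is maximal.\<close>

lemma component_absorbs_edge:
  assumes "hypergraph V E" "W \<in> connected_components V E" "e \<in> E" "e \<inter> W \<noteq> {}"
  shows "e \<subseteq> W"
proof -
  obtain z where z: "z \<in> e" "z \<in> W" using assms(4) by blast
  let ?F = "induced_edges E (W \<union> e)"
  have W: "W \<subseteq> V" "connected_hypergraph W (induced_edges E W)"
    "\<And>W'. W \<subseteq> W' \<Longrightarrow> W' \<subseteq> V \<Longrightarrow> connected_hypergraph W' (induced_edges E W') \<Longrightarrow> W' = W"
    using assms(2) by (auto simp: connected_components_def)
  have e: "e \<in> ?F" using assms(3) by (simp add: induced_edges_def)
  have sub: "induced_edges E W \<subseteq> ?F" by (auto simp: induced_edges_def)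
  have toz: "edge_path ?F x z" if "x \<in> W \<union> e" for x
  proof (cases "x \<in> e")
    case True
    then show ?thesis using edge_path_edge[OF e _ z(1)] by blast
  next
    case False
    then have "edge_path (induced_edges E W) x z"
      using W(2) z that unfolding connected_hypergraph_edge_path by auto
    then show ?thesis using sub by (rule edge_path_mono)
  qed
  have "connected_hypergraph (W \<union> e) ?F"
    unfolding connected_hypergraph_edge_path
    by (intro ballI impI edge_path_trans[OF toz edge_path_sym[OF toz]])
  moreover have "W \<union> e \<subseteq> V" using W(1) assms(1,3) by (auto simp: hypergraph_def)
  ultimately have "W \<union> e = W" using W(3) by blast
  then show ?thesis by blast
qed

text \<open>An edge is connected as a node set, and by finiteness some connected set above it is
  maximal.\<close>

lemma edge_in_component:
  assumes "hypergraph V E" "e \<in> E" "e \<noteq> {}"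
  shows "\<exists>W\<in>connected_components V E. e \<subseteq> W"
proof -
  let ?S = "{W. e \<subseteq> W \<and> W \<subseteq> V \<and> connected_hypergraph W (induced_edges E W)}"
  have eS: "e \<in> ?S" using assms unfolding connected_hypergraph_edge_path
    by (auto simp: induced_edges_def hypergraph_def intro!: edge_path_edge[of e])
  have "finite ?S" using assms(1)
    by (intro finite_subset[of ?S "Pow V"]) (auto simp: hypergraph_def)
  from finite_has_maximal2[OF this eS]
  obtain W where W: "W \<in> ?S" "e \<subseteq> W" "\<forall>W'\<in>?S. W \<subseteq> W' \<longrightarrow> W = W'"
    by (elim bexE conjE)
  have "W' = W" if "W \<subseteq> W'" "W' \<subseteq> V" "connected_hypergraph W' (induced_edges E W')" for W'
  proof -
    have "W' \<in> ?S" using that W(2) by auto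
    then show ?thesis using W(3) that(1) by auto
  qed
  then have "W \<in> connected_components V E"
    using assms(3) W(1,2) unfolding connected_components_def by auto
  then show ?thesis using W(2) by blast
qed

text \<open>A pivot step through \<open>A\<close> exhibits the difference of two nodes as a
  difference of two edges, and along a chain these add up. Exponents are natural numbers, hence the
  form without subtraction; the common \<open>b\<close> keeps the grading.\<close>

lemma pivot_equivalent_edge_sums:
  assumes "hypergraph V E" and "pivot_equivalent V E x y"
  shows "\<exists>b w w'. w \<in> edge_sums E b \<and> w' \<in> edge_sums E b \<and>
    w + single x 1 = w' + single y 1"
  using assms(2) unfolding pivot_equivalent_def
proof (induction rule: rtranclp_induct)
  case base
  show ?case using edge_sums_0 by blast
next
  case (step y z)
  obtain b w w' where w: "w \<in> edge_sums E b" "w' \<in> edge_sums E b"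
    "w + single x 1 = w' + single y 1" using step.IH by blast
  obtain A where A: "A \<subseteq> V - {y, z}" "insert y A \<in> E" "insert z A \<in> E"
    using step.hyps(2) by (auto simp: pivot_def)
  have "finite A" using A(1) assms(1) by (meson finite_Diff finite_subset hypergraph_def)
  then have em: "edge_monomial (insert y A) = single y 1 + edge_monomial A"
    "edge_monomial (insert z A) = single z 1 + edge_monomial A"
    using A(1) by (simp_all add: edge_monomial_def subset_Diff_insert)
  have "(w + edge_monomial (insert z A)) + single x 1
    = (w + single x 1) + edge_monomial (insert z A)" by (simp add: ac_simps)
  also have "\<dots> = (w' + edge_monomial (insert y A)) + single z 1"
    unfolding w(3) em by (simp add: ac_simps)
  finally show ?case
    using edge_sums_add[OF w(1) edge_sums_edge[OF A(3)]] edge_sums_add[OF w(2) edge_sums_edge[OF A(2)]]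
    by blast
qed

text \<open>Adding the relations between \<open>x\<close> and the \<open>m\<close> nodes of
  \<open>e\<close> replaces every node of \<open>e\<close> by \<open>x\<close>: \<open>m\<close>
  times \<open>x\<close> is \<open>e\<close> plus a difference of equally long edge sums. This is
  the premise \<open>piv\<close> of \<open>torsion_limit_pos\<close>.\<close>

lemma pivot_equivalent_multiple:
  assumes V: "hypergraph V E" and "uniform m E" "e \<in> E"
    and "\<And>y. y \<in> e \<Longrightarrow> pivot_equivalent V E x y"
  shows "\<exists>b w. w \<in> edge_sums E b \<and> w + single x m \<in> edge_sums E (Suc b)"
proof -
  have fin: "finite e" using finite_edge[OF V assms(3)] .
  have "\<forall>y\<in>e. \<exists>b w w'. w \<in> edge_sums E b \<and> w' \<in> edge_sums E b \<and>
    w + single x 1 = w' + single y 1"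
    using pivot_equivalent_edge_sums[OF V assms(4)] by blast
  then obtain b w w' where w: "\<And>y. y \<in> e \<Longrightarrow> w y \<in> edge_sums E (b y)" "\<And>y. y \<in> e \<Longrightarrow> w' y \<in> edge_sums E (b y)"
    "\<And>y. y \<in> e \<Longrightarrow> w y + single x 1 = w' y + single y 1"
    by metis
  have "(\<Sum>y\<in>e. single x (1::nat)) = single x m"
    using fin assms(2,3) 
    by (intro poly_mapping_eqI) (auto simp: lookup_sum lookup_single when_def uniform_def)
  then have "sum w e + single x m = (\<Sum>y\<in>e. w y + single x 1)"
    by (simp add: sum.distrib)
  also have "\<dots> = sum w' e + edge_monomial e"
    unfolding edge_monomial_def sum.distrib[symmetric] by (intro sum.cong refl w(3))
  also have "\<dots> \<in> edge_sums E (sum b e + 1)"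
    using w(2) assms(3) by (intro edge_sums_add edge_sums_sum edge_sums_edge) auto
  finally show ?thesis using edge_sums_sum[of e w E b] w(1) by (intro exI[of _ "sum b e"] exI[of _ "sum w e"]) simp
qed

text \<open>Edges that share \<open>m - 1\<close> nodes differ by the exchange of one node
  \<open>a\<close> for another node \<open>b\<close>. The common part witnesses that
  \<open>a\<close> and \<open>b\<close> are pivot, so a class contains both or neither.\<close>

lemma pivot_step_card:
  assumes V: "hypergraph V E" and "m \<ge> 1" "uniform m E"
    and e: "e \<in> E" "f \<in> E" "card (e \<inter> f) = m - 1" "e \<subseteq> W" "f \<subseteq> W"
  shows "card (e \<inter> {z\<in>W. pivot_equivalent V E x z}) = card (f \<inter> {z\<in>W. pivot_equivalent V E x z})"
proof -
  let ?C = "{z\<in>W. pivot_equivalent V E x z}"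
  have fin: "finite e" "finite f" using finite_edge[OF V] e by auto
  have card: "card e = m" "card f = m" using assms(3) e by (auto simp: uniform_def)
  \<comment> \<open>With \<open>m \<ge> 1\<close> the truncated \<open>m - (m - 1)\<close> equals 1;
    in particular \<open>e \<noteq> f\<close>.\<close>
  have "card (e - f) = 1" "card (f - e) = 1"
    using e(3) card assms(2) card_Diff_subset_Int[of e f] card_Diff_subset_Int[of f e] fin by (simp_all add: Int_commute)
  then obtain a b where ab: "e - f = {a}" "f - e = {b}" by (meson card_1_singletonE)
  define A where "A = e \<inter> f"
  have A: "e = insert a A" "f = insert b A" "a \<notin> A" "b \<notin> A" "finite A" using ab fin by (auto simp: A_def)
  have sub: "e \<subseteq> V" "f \<subseteq> V" using V e by (auto simp: hypergraph_def)
  have "pivot V E a b" "pivot V E b a" using A sub e unfolding pivot_def by blast+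
  then have "pivot_equivalent V E x a \<longleftrightarrow> pivot_equivalent V E x b"
    unfolding pivot_equivalent_def by (meson rtranclp.rtrancl_into_rtrancl)
  then have "a \<in> ?C \<longleftrightarrow> b \<in> ?C" using A e(4,5) by auto
  then show ?thesis using A(3-5) unfolding A(1,2) by (auto simp: Int_insert_left)
qed

text \<open>No step of a proper path changes the number of nodes in the class, and any two edges of
  the component are joined by such a path.\<close>

lemma component_class_card:
  assumes V: "hypergraph V E" and m: "m \<ge> 1" "uniform m E"
    and W: "W \<in> connected_components V E" "properly_connected m (induced_edges E W)"
  shows "\<exists>c. \<forall>e\<in>E. e \<subseteq> W \<longrightarrow> card (e \<inter> {z\<in>W. pivot_equivalent V E x z}) = c"
proof -
  let ?n = "\<lambda>e. card (e \<inter> {z\<in>W. pivot_equivalent V E x z})"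
  have path: "?n (hd es) = ?n (last es)"
    if "es \<noteq> []" "set es \<subseteq> induced_edges E W" "successively (\<lambda>e f. card (e \<inter> f) = m - 1) es" for es
    using that
  proof (induction es rule: induct_list012)
    case (3 e f es)
    have "?n e = ?n f" using 3 by (intro pivot_step_card[OF V m]) (auto simp: induced_edges_def)
    then show ?case using 3 by simp
  qed auto
  show ?thesis
  proof (cases "induced_edges E W = {}")
    case True
    then show ?thesis by (auto simp: induced_edges_def)
  next
    case False
    then obtain u where u: "u \<in> induced_edges E W" by blast
    have "?n e = ?n u" if e: "e \<in> E" "e \<subseteq> W" for e
    proof -
      have eW: "e \<in> induced_edges E W" using e by (simp add: induced_edges_def)
      obtain es where "es \<noteq> []" "set es \<subseteq> induced_edges E W" "hd es = u" "last es = e"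
        "successively (\<lambda>e f. card (e \<inter> f) = m - 1) es"
        using bspec[OF bspec[OF W(2)[unfolded properly_connected_def] u] eW] by (elim exE conjE)
      then show ?thesis using path[of es] by simp
    qed
    then show ?thesis by blast
  qed
qed

theorem torsion_limit_pivot:
  assumes V: "hypergraph V E" and m: "m \<ge> 1" "uniform m E"
    and iso: "\<forall>v\<in>V. \<not> isolated_node E v"
    and pc: "\<forall>W\<in>connected_components V E. properly_connected m (induced_edges E W)"
  shows "\<exists>L. (\<lambda>t. ereal (real (card (torsion_monomials V E t))) / ereal (real t ^ (card V - 1))) \<longlonglongrightarrow> L \<and>
    (L \<noteq> 0 \<longleftrightarrow> (\<forall>W\<in>connected_components V E. \<forall>x\<in>W. \<forall>y\<in>W. pivot_equivalent V E x y))"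
proof -
  have V': "finite V" "V \<noteq> {}" "E \<subseteq> Pow V" using V by (auto simp: hypergraph_def)
  have edge: "\<exists>e\<in>E. v \<in> e" if "v \<in> V" for v
    using iso that by (auto simp: isolated_node_def)
  show ?thesis
  proof (cases "\<forall>W\<in>connected_components V E. \<forall>x\<in>W. \<forall>y\<in>W. pivot_equivalent V E x y")
    case True
    \<comment> \<open>Every node lies in an edge, whose nodes share its component and therefore its
      pivot class.\<close>
    have "\<exists>b w. w \<in> edge_sums E b \<and> w + single v m \<in> edge_sums E (Suc b)" if v: "v \<in> V" for v
    proof -
      obtain e where e: "e \<in> E" "v \<in> e" using edge[OF v] by blast
      then obtain W where "W \<in> connected_components V E" "e \<subseteq> W" using edge_in_component[OF V] by blast
      then show ?thesis using True e by (intro pivot_equivalent_multiple[OF V m(2) e(1)]) blast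
    qed
    then obtain L where "L > 0" 
      "(\<lambda>t. ereal (real (card (torsion_monomials V E t))) / ereal (real t ^ (card V - 1))) \<longlonglongrightarrow> L"
      using torsion_limit_pos[OF V' m(2,1)] by blast
    then show ?thesis using True by (intro exI[of _ L]) auto
  next
    case False
    then obtain W x y where W: "W \<in> connected_components V E" and xy: "x \<in> W" "y \<in> W" "\<not> pivot_equivalent V E x y"
      by blast
    have WV: "W \<subseteq> V" using W by (auto simp: connected_components_def)
    \<comment> \<open>The classes of \<open>x\<close> and \<open>y\<close> inside \<open>W\<close>
      serve as \<open>C1\<close> and \<open>C2\<close>; the constant numbers \<open>c x\<close> and
      \<open>c y\<close> of common nodes with an edge give the proportion.\<close>
    define C where "C z = {w\<in>W. pivot_equivalent V E z w}" for z
    obtain c where c: "\<And>z e. e \<in> E \<Longrightarrow> e \<subseteq> W \<Longrightarrow> card (e \<inter> C z) = c z"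
      using component_class_card[OF V m W] pc W unfolding C_def by metis
    have sym: "pivot_equivalent V E a b" if "pivot_equivalent V E b a" for a b
    proof -
      have "symp (pivot V E)" by (rule sympI) (auto simp: pivot_def insert_commute)
      then show ?thesis using that unfolding pivot_equivalent_def by (metis symp_rtranclp sympD)
    qed
    have disj: "C x \<inter> C y = {}"
      using xy(3) sym unfolding C_def pivot_equivalent_def by (auto dest: rtranclp_trans)
    have mem: "x \<in> C x" "y \<in> C y" using xy by (auto simp: C_def pivot_equivalent_def)
    \<comment> \<open>An edge through \<open>x\<close>, available because no node is isolated, makes
      \<open>c x\<close> positive; with \<open>c x = c y = 0\<close> the balance would say
      nothing.\<close>
    obtain e where e: "e \<in> E" "x \<in> e" using edge xy(1) WV by blast
    have "e \<subseteq> W" using component_absorbs_edge[OF V W e(1)] e(2) xy(1) by blast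
    moreover have "finite e" using finite_edge[OF V e(1)] .
    ultimately have "c x > 0" using c[OF e(1), of x] mem(1) e(2) by (auto simp: card_gt_0_iff simp flip: c[OF e(1)])
    \<comment> \<open>Edges of other components miss both classes, so for them the balance reads
      \<open>0 = 0\<close>.\<close>
    moreover have "c y * card (f \<inter> C x) = c x * card (f \<inter> C y)" if f: "f \<in> E" for f
    proof (cases "f \<subseteq> W")
      case True
      then show ?thesis using c[OF f] by simp
    next
      case False
      then have "f \<inter> W = {}" using component_absorbs_edge[OF V W f] by blast
      then have "f \<inter> C x = {}" "f \<inter> C y = {}" by (auto simp: C_def)
      then show ?thesis by simp
    qed
    ultimately have "(\<lambda>t. ereal (real (card (torsion_monomials V E t))) / ereal (real t ^ (card V - 1))) \<longlonglongrightarrow> 0"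
      using V' m(2) disj mem WV
      by (intro torsion_limit_zero[where ?C1.0 = "C x" and ?C2.0 = "C y" and ?c1.0 = "c x" and ?c2.0 = "c y" and x = x and y = y])
         (auto simp: C_def)
    then show ?thesis using False by blast
  qed
qed

section \<open>The polynomial ring\<close>

text \<open>Maximising one coordinate after another picks lexicographically leading elements of
  \<open>F\<close> and \<open>G\<close>; no other pair has the same sum, up to coordinates outside
  \<open>W\<close>. The order of the coordinates is immaterial, so no monomial order has to be
  fixed.\<close>

lemma unique_sum:
  fixes F G :: "('v \<Rightarrow>\<^sub>0 nat) set"
  assumes "finite W"
  shows "finite F \<Longrightarrow> F \<noteq> {} \<Longrightarrow> finite G \<Longrightarrow> G \<noteq> {} \<Longrightarrow>
    \<exists>u\<in>F. \<exists>w\<in>G. \<forall>u'\<in>F. \<forall>w'\<in>G. u' + w' = u + w \<longrightarrow>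
      (\<forall>x\<in>W. lookup u' x = lookup u x \<and> lookup w' x = lookup w x)"
  using assms
proof (induction W arbitrary: F G rule: finite_induct)
  case empty
  then show ?case by blast
next
  case (insert x W)
  define top where "top H = {u\<in>H. lookup u x = Max ((\<lambda>u. lookup u x) ` H)}" 
    for H :: "('v \<Rightarrow>\<^sub>0 nat) set"
  have top: "finite (top H)" "top H \<noteq> {}" 
    "\<And>u w. u \<in> top H \<Longrightarrow> w \<in> H \<Longrightarrow> lookup w x \<le> lookup u x"
    "\<And>u w. u \<in> top H \<Longrightarrow> w \<in> H \<Longrightarrow> lookup w x = lookup u x \<Longrightarrow> w \<in> top H"
    if "finite H" "H \<noteq> {}" for H
  proof -
    have "Max ((\<lambda>u. lookup u x) ` H) \<in> (\<lambda>u. lookup u x) ` H"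
      using that by (intro Max_in) auto
    then show "top H \<noteq> {}" by (auto simp: top_def)
  qed (use that in \<open>auto simp: top_def\<close>)
  note tF = top[OF insert.prems(1,2)] and tG = top[OF insert.prems(3,4)]
  obtain u w where uw: "u \<in> top F" "w \<in> top G"
    and un: "\<And>u' w'. u' \<in> top F \<Longrightarrow> w' \<in> top G \<Longrightarrow> u' + w' = u + w \<Longrightarrow>
      (\<forall>x\<in>W. lookup u' x = lookup u x \<and> lookup w' x = lookup w x)"
    using insert.IH[OF tF(1,2) tG(1,2)] by blast
  have "lookup u' z = lookup u z \<and> lookup w' z = lookup w z"
    if "u' \<in> F" "w' \<in> G" "u' + w' = u + w" "z \<in> insert x W" for u' w' z
  proof -
    have "lookup u' x + lookup w' x = lookup u x + lookup w x"
      using that(3) by (metis lookup_add)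
    then have "lookup u' x = lookup u x" "lookup w' x = lookup w x"
      using tF(3)[OF uw(1) that(1)] tG(3)[OF uw(2) that(2)] by linarith+
    then show ?thesis using un[of u' w'] tF(4)[OF uw(1) that(1)] tG(4)[OF uw(2) that(2)] that by auto
  qed
  moreover have "u \<in> F" "w \<in> G" using uw by (auto simp: top_def)
  ultimately show ?case by blast
qed

lemma poly_mapping_sum_single:
  "p = (\<Sum>a\<in>keys p. single a (lookup p a))"
  by (rule poly_mapping_eqI)
     (auto simp: lookup_sum lookup_single when_def sum.delta in_keys_iff)

lemma lookup_times:
  fixes p q :: "'a::comm_monoid_add \<Rightarrow>\<^sub>0 'k::comm_semiring_0"
  shows "lookup (p * q) k = (\<Sum>a\<in>keys p. \<Sum>b\<in>keys q. 
    (if a + b = k then lookup p a * lookup q b else 0))"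
proof -
  have "p * q = (\<Sum>a\<in>keys p. single a (lookup p a)) *
     (\<Sum>b\<in>keys q. single b (lookup q b))"
    using poly_mapping_sum_single[of p] poly_mapping_sum_single[of q] by argo
  then show ?thesis
    by (simp add: sum_product mult_single lookup_sum lookup_single when_def)
qed

text \<open>At the uniquely represented exponent of \<open>unique_sum\<close>, the coefficient of
  the product is a product of two nonzero field elements.\<close>

lemma mpoly_no_zero_divisors:
  fixes p q :: "('v, 'k::field) mpoly"
  assumes "p * q = 0" shows "p = 0 \<or> q = 0"
proof (rule ccontr)
  assume "\<not> ?thesis"
  then have ne: "keys p \<noteq> {}" "keys q \<noteq> {}" by auto
  let ?W = "(\<Union>u\<in>keys p \<union> keys q. keys u)"
  have "finite ?W" by simp
  from unique_sum[OF this finite_keys ne(1) finite_keys ne(2)]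
  obtain u w where u: "u \<in> keys p" "w \<in> keys q" and
    uw: "\<forall>u'\<in>keys p. \<forall>w'\<in>keys q. u' + w' = u + w \<longrightarrow>
      (\<forall>x\<in>?W. lookup u' x = lookup u x \<and> lookup w' x = lookup w x)"
    by (elim bexE)
  have mon: "a \<in> monomials ?W" if "a \<in> keys p \<union> keys q" for a
    using that by (auto simp: monomials_def)
  have eq: "u' = u \<and> w' = w" if "u' \<in> keys p" "w' \<in> keys q" "u' + w' = u + w" for u' w'
  proof
    note l = bspec[OF mp[OF bspec[OF bspec[OF uw that(1)] that(2)] that(3)]]
    show "u' = u" by (rule monomials_eqI[of u' ?W]) (use l mon u that(1) in simp_all)
    show "w' = w" by (rule monomials_eqI[of w' ?W]) (use l mon u that(2) in simp_all)
  qed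
  have "lookup (p * q) (u + w) = (\<Sum>a\<in>keys p. \<Sum>b\<in>keys q. 
    (if a = u then if b = w then lookup p u * lookup q w else 0 else 0))"
    unfolding lookup_times by (intro sum.cong refl) (use eq in auto)
  also have "\<dots> = (\<Sum>a\<in>keys p. if a = u then 
      (\<Sum>b\<in>keys q. if b = w then lookup p u * lookup q w else 0) else 0)"
    by (intro sum.cong) auto
  also have "\<dots> = lookup p u * lookup q w"
    using u by (simp add: sum.delta)
  also have "\<dots> \<noteq> 0" using u by (simp add: in_keys_iff)
  finally show False using assms by simp
qed

lemma mpoly_mult_cancel:
  fixes p q r :: "('v, 'k::field) mpoly"
  assumes "r \<noteq> 0" "r * p = r * q" shows "p = q"
  using mpoly_no_zero_divisors[of r "p - q"] assms by (simp add: algebra_simps)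

abbreviation polys :: "'v set \<Rightarrow> ('v, 'k::field) mpoly set" where
  "polys V \<equiv> carrier (mpoly_ring V)"

lemma polys_iff: "p \<in> polys V \<longleftrightarrow> keys p \<subseteq> monomials V"
  by (auto simp: mpoly_ring_def monomials_def)

lemma mpoly_ring_simps [simp]:
  "monoid.mult (mpoly_ring V) = (*)" "one (mpoly_ring V) = 1" "zero (mpoly_ring V) = 0" "add (mpoly_ring V) = (+)"
  by (simp_all add: mpoly_ring_def)

lemma keys_add_subset: "keys p \<subseteq> U \<Longrightarrow> keys q \<subseteq> U \<Longrightarrow> keys (p + q) \<subseteq> U"
  using keys_add[of p q] by blast

lemma keys_uminus [simp]: "keys (- p) = keys (p :: 'a \<Rightarrow>\<^sub>0 'k::ab_group_add)"
  by (auto simp: in_keys_iff)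

lemma keys_sum_subset: "(\<And>i. i \<in> I \<Longrightarrow> keys (f i) \<subseteq> U) \<Longrightarrow> keys (sum f I) \<subseteq> U"
proof (induction I rule: infinite_finite_induct)
  case (insert x F)
  then show ?case by (simp add: keys_add_subset)
qed simp_all

lemma polys_0 [simp]: "0 \<in> polys V" and polys_1 [simp]: "1 \<in> polys V"
  by (simp_all add: polys_iff)

lemma polys_add [simp, intro]: "p \<in> polys V \<Longrightarrow> q \<in> polys V \<Longrightarrow> p + q \<in> polys V"
  unfolding polys_iff by (rule keys_add_subset)

lemma polys_uminus [simp, intro]: "p \<in> polys V \<Longrightarrow> - p \<in> polys V"
  by (simp add: polys_iff)

lemma polys_mult [simp, intro]: "p \<in> polys V \<Longrightarrow> q \<in> polys V \<Longrightarrow> p * q \<in> polys V"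
  using keys_mult[of p q] unfolding polys_iff by fastforce

lemma cring_mpoly_ring: "cring (mpoly_ring V :: ('v, 'k::field) mpoly ring)"
proof (rule cringI)
  show "abelian_group (mpoly_ring V :: ('v, 'k) mpoly ring)"
  proof (rule abelian_groupI; simp?)
    fix x :: "('v, 'k) mpoly" assume "x \<in> polys V"
    then show "\<exists>y\<in>polys V. y + x = 0" by (intro bexI[of _ "- x"]) auto
  qed
  show "comm_monoid (mpoly_ring V :: ('v, 'k) mpoly ring)"
    by (rule comm_monoidI) (auto simp: ac_simps)
qed (auto simp: algebra_simps)

lemma mpoly_ring_minus:
  fixes p q :: "('v, 'k::field) mpoly"
  assumes "p \<in> polys V" "q \<in> polys V"
  shows "p \<ominus>\<^bsub>mpoly_ring V\<^esub> q = p - q"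
proof -
  interpret cring "mpoly_ring V :: ('v, 'k) mpoly ring" by (rule cring_mpoly_ring)
  have "\<ominus>\<^bsub>mpoly_ring V\<^esub> q = - q"
    using minus_equality[of "- q" q] assms(2) by simp
  then show ?thesis by (simp add: a_minus_def)
qed

lemma single_neq_0: "k \<noteq> 0 \<Longrightarrow> single v k \<noteq> 0"
  by (metis insert_not_empty keys_single keys_zero)

lemma mpoly_var_in: "v \<in> V \<Longrightarrow> mpoly_var v \<in> polys V"
  by (auto simp: mpoly_var_def polys_iff)

lemma lookup_times_0:
  fixes p q :: "('v, 'k::field) mpoly"
  shows "lookup (p * q) 0 = lookup p 0 * lookup q 0"
proof -
  have z: "a + b = 0 \<longleftrightarrow> a = 0 \<and> b = 0" for a b :: "'v \<Rightarrow>\<^sub>0 nat"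
    by (auto simp: poly_mapping_eq_iff lookup_add fun_eq_iff)
  have "lookup (p * q) 0 = (\<Sum>a\<in>keys p. \<Sum>b\<in>keys q. 
    (if a = 0 then if b = 0 then lookup p 0 * lookup q 0 else 0 else 0))"
    unfolding lookup_times z by (intro sum.cong refl) auto
  also have "\<dots> = (\<Sum>a\<in>keys p. if a = 0 then 
      (\<Sum>b\<in>keys q. if b = 0 then lookup p 0 * lookup q 0 else 0) else 0)"
    by (intro sum.cong) auto
  also have "\<dots> = lookup p 0 * lookup q 0"
    by (auto simp: sum.delta in_keys_iff)
  finally show ?thesis .
qed

text \<open>Upward closed sets of monomials correspond to the monomial ideals of the polynomial ring, and by
  \<open>monomial_ideal\<close> to ideals of its localization.\<close>

definition upset :: "'v set \<Rightarrow> ('v \<Rightarrow>\<^sub>0 nat) set \<Rightarrow> bool" where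
  "upset V U \<longleftrightarrow> U \<subseteq> monomials V \<and> (\<forall>u\<in>U. \<forall>r\<in>monomials V. u + r \<in> U)"

lemma keys_mult_upset:
  assumes "upset V U" "keys p \<subseteq> U" "q \<in> polys V"
  shows "keys (q * p) \<subseteq> U"
proof
  fix x assume "x \<in> keys (q * p)"
  then obtain a b where ab: "x = b + a" "a \<in> keys q" "b \<in> keys p"
    using keys_mult[of q p] by (auto simp: add.commute)
  then have "a \<in> monomials V" "b \<in> U" using assms(2,3) by (auto simp: polys_iff)
  then show "x \<in> U" using assms(1) ab(1) by (simp add: upset_def)
qed

text \<open>A polynomial without constant term is a sum of nonconstant terms, each divisible by a
  node; hence the ideal of the nodes is the kernel of the constant term.\<close>

lemma node_denominators_eq:
  "node_denominators V = {s \<in> polys V. lookup (s :: ('v, 'k::field) mpoly) 0 \<noteq> 0}"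
proof -
  let ?A = "mpoly_ring V :: ('v, 'k) mpoly ring"
  interpret cring ?A by (rule cring_mpoly_ring)
  let ?I = "{p \<in> polys V. lookup (p :: ('v, 'k) mpoly) 0 = 0}"
  have I: "ideal ?I ?A"
  proof (rule idealI)
    show "subgroup ?I (add_monoid ?A)"
    proof (rule add.subgroupI)
      show "?I \<noteq> {}" by (auto intro!: exI[of _ 0])
      fix p assume p: "p \<in> ?I"
      then have "\<ominus>\<^bsub>?A\<^esub> p = - p" using minus_equality[of "- p" p] by simp
      then show "\<ominus>\<^bsub>?A\<^esub> p \<in> ?I" using p by simp
    qed (auto simp: lookup_add)
  qed (auto simp: lookup_times_0 ring_axioms)
  have "mpoly_var ` V \<subseteq> ?I" by (auto simp: mpoly_var_in) (auto simp: mpoly_var_def lookup_single when_def single_neq_0)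
  then have 1: "Idl\<^bsub>?A\<^esub> (mpoly_var ` V) \<subseteq> ?I" by (rule genideal_minimal[OF I])
  have 2: "?I \<subseteq> J" if J: "ideal J ?A" "mpoly_var ` V \<subseteq> J" for J
  proof
    interpret J: ideal J ?A by fact
    fix p assume p: "p \<in> ?I"
    have sum: "(\<And>i. i \<in> K \<Longrightarrow> f i \<in> J) \<Longrightarrow> sum f K \<in> J" for f :: "('v \<Rightarrow>\<^sub>0 nat) \<Rightarrow> ('v, 'k) mpoly" and K
      by (induction K rule: infinite_finite_induct) (use J.zero_closed J.a_closed in auto)
    have "single a (lookup p a) \<in> J" if a: "a \<in> keys p" for a
    proof -
      have "a \<noteq> 0" using a p by (auto simp: in_keys_iff)
      moreover have aV: "a \<in> monomials V" using a p by (auto simp: polys_iff)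
      ultimately obtain v where v: "v \<in> V" "lookup a v \<ge> 1"
        using monomials_eqI[OF aV monomials_0] by (metis lookup_zero less_one not_le)
      obtain a' where a': "a' \<in> monomials V" "a = a' + single v 1"
        using split_single[OF aV v(2)] .
      have "single a (lookup p a) = single a' (lookup p a) * mpoly_var v"
        by (simp add: mpoly_var_def mult_single a'(2))
      moreover have "single a' (lookup p a) \<in> polys V"
        using a'(1) by (auto simp: polys_iff)
      ultimately show ?thesis using J.I_l_closed[of "mpoly_var v"] J(2) v(1) by auto
    qed
    then have "(\<Sum>a\<in>keys p. single a (lookup p a)) \<in> J" by (rule sum)
    then show "p \<in> J" using poly_mapping_sum_single[of p] by simp
  qed
  have "mpoly_var ` V \<subseteq> carrier ?A" by (intro image_subsetI mpoly_var_in)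
  then have "?I \<subseteq> Idl\<^bsub>?A\<^esub> (mpoly_var ` V)" by (intro 2 genideal_ideal genideal_self)
  with 1 have "Idl\<^bsub>?A\<^esub> (mpoly_var ` V) = ?I" by (rule equalityI)
  then show ?thesis unfolding node_denominators_def by auto
qed

section \<open>The local ring and its monomial ideals\<close>

abbreviation denoms :: "'v set \<Rightarrow> ('v, 'k::field) mpoly set" where
  "denoms V \<equiv> node_denominators V"

abbreviation node_frac :: "'v set \<Rightarrow> ('v, 'k::field) mpoly \<Rightarrow> ('v, 'k) mpoly \<Rightarrow> (('v, 'k) mpoly \<times> ('v, 'k) mpoly) set" where
  "node_frac V \<equiv> loc_frac (mpoly_ring V) (denoms V)"

abbreviation loc :: "'v set \<Rightarrow> (('v, 'k::field) mpoly \<times> ('v, 'k) mpoly) set ring" where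
  "loc V \<equiv> localization (mpoly_ring V) (denoms V)"

lemma denoms_polys: "s \<in> denoms V \<Longrightarrow> s \<in> polys V"
  by (simp add: node_denominators_eq)

lemma denoms_nz [simp]: "0 \<notin> denoms V"
  by (simp add: node_denominators_eq)

lemma denoms_1 [simp]: "1 \<in> denoms V"
  by (simp add: node_denominators_eq lookup_one)

lemma denoms_mult [simp, intro]: "s \<in> denoms V \<Longrightarrow> t \<in> denoms V \<Longrightarrow> s * t \<in> denoms V"
  by (auto simp: node_denominators_eq lookup_times_0)

declare denoms_polys [simp, intro]

text \<open>In a domain the factor \<open>u\<close> of \<open>loc_frac\<close> cancels, 0 not being
  a denominator, and fractions are compared by cross-multiplication.\<close>

lemma frac_eq:
  fixes a s :: "('v, 'k::field) mpoly"
  assumes "a \<in> polys V" "s \<in> denoms V"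
  shows "node_frac V a s = {(b, t). b \<in> polys V \<and> t \<in> denoms V \<and> t * a = s * b}"
proof -
  have "(\<exists>u\<in>denoms V. u * (t * a \<ominus>\<^bsub>mpoly_ring V\<^esub> s * b) = 0) \<longleftrightarrow> t * a = s * b"
    if "b \<in> polys V" "t \<in> denoms V" for b t :: "('v, 'k) mpoly"
  proof -
    have "t * a \<ominus>\<^bsub>mpoly_ring V\<^esub> s * b = t * a - s * b"
      using that assms by (intro mpoly_ring_minus) auto
    then show ?thesis using denoms_1 denoms_nz mpoly_no_zero_divisors
      by (metis eq_iff_diff_eq_0 mult_zero_right)
  qed
  then show ?thesis unfolding loc_frac_def by auto
qed

lemma frac_self: "a \<in> polys V \<Longrightarrow> s \<in> denoms V \<Longrightarrow> (a, s) \<in> node_frac V a s"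
  by (simp add: frac_eq mult.commute)

lemma frac_eq_iff:
  fixes a s b t :: "('v, 'k::field) mpoly"
  assumes "a \<in> polys V" "s \<in> denoms V" "b \<in> polys V" "t \<in> denoms V"
  shows "node_frac V a s = node_frac V b t \<longleftrightarrow> t * a = s * b"
proof
  assume "node_frac V a s = node_frac V b t"
  then have "(b, t) \<in> node_frac V a s" using frac_self assms by blast
  then show "t * a = s * b" using assms by (simp add: frac_eq)
next
  assume eq: "t * a = s * b"
  have nz: "s \<noteq> 0" "t \<noteq> 0" using assms denoms_nz by blast+
  have "r * a = s * c \<longleftrightarrow> r * b = t * c" for r c
  proof
    assume "r * a = s * c"
    then have "s * (r * b) = s * (t * c)" using eq by (metis mult.left_commute)
    then show "r * b = t * c" by (rule mpoly_mult_cancel[OF nz(1)])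
  next
    assume "r * b = t * c"
    then have "t * (r * a) = t * (s * c)" using eq by (metis mult.left_commute)
    then show "r * a = s * c" by (rule mpoly_mult_cancel[OF nz(2)])
  qed
  then show "node_frac V a s = node_frac V b t" using assms by (simp add: frac_eq)
qed

text \<open>The operations of \<open>localization\<close> are unions over representatives; a
  constant family over non-empty sets collapses to its value.\<close>

lemma UN_pairs_const:
  assumes "X \<noteq> {}" "Y \<noteq> {}" "\<And>a s b t. (a, s) \<in> X \<Longrightarrow> (b, t) \<in> Y \<Longrightarrow> f a s b t = Z"
  shows "(\<Union>(a, s)\<in>X. \<Union>(b, t)\<in>Y. f a s b t) = Z"
  using assms by fast

lemma loc_mult:
  fixes a s b t :: "('v, 'k::field) mpoly"
  assumes "a \<in> polys V" "s \<in> denoms V" "b \<in> polys V" "t \<in> denoms V"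
  shows "node_frac V a s \<otimes>\<^bsub>loc V\<^esub> node_frac V b t = node_frac V (a * b) (s * t)"
proof -
  have "(\<Union>(a', s')\<in>node_frac V a s. \<Union>(b', t')\<in>node_frac V b t. node_frac V (a' * b') (s' * t')) = node_frac V (a * b) (s * t)"
  proof (rule UN_pairs_const)
    fix a' s' b' t' assume "(a', s') \<in> node_frac V a s" "(b', t') \<in> node_frac V b t"
    then have *: "a' \<in> polys V" "s' \<in> denoms V" "s' * a = s * a'" "b' \<in> polys V" "t' \<in> denoms V" "t' * b = t * b'"
      using assms by (simp_all add: frac_eq)
    have "s' * t' * (a * b) = (s' * a) * (t' * b)" by (simp add: ac_simps)
    also have "\<dots> = s * t * (a' * b')" unfolding *(3,6) by (simp add: ac_simps)
    finally show "node_frac V (a' * b') (s' * t') = node_frac V (a * b) (s * t)"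
      using assms * by (subst frac_eq_iff) auto
  qed (use frac_self assms in blast)+
  then show ?thesis by (simp add: localization_def)
qed

lemma loc_add:
  fixes a s b t :: "('v, 'k::field) mpoly"
  assumes "a \<in> polys V" "s \<in> denoms V" "b \<in> polys V" "t \<in> denoms V"
  shows "node_frac V a s \<oplus>\<^bsub>loc V\<^esub> node_frac V b t = node_frac V (a * t + b * s) (s * t)"
proof -
  have "(\<Union>(a', s')\<in>node_frac V a s. \<Union>(b', t')\<in>node_frac V b t. node_frac V (a' * t' + b' * s') (s' * t')) 
    = node_frac V (a * t + b * s) (s * t)"
  proof (rule UN_pairs_const)
    fix a' s' b' t' assume "(a', s') \<in> node_frac V a s" "(b', t') \<in> node_frac V b t"
    then have *: "a' \<in> polys V" "s' \<in> denoms V" "s' * a = s * a'" "b' \<in> polys V" "t' \<in> denoms V" "t' * b = t * b'"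
      using assms by (simp_all add: frac_eq)
    have "s' * t' * (a * t + b * s) = (s' * a) * (t' * t) + (t' * b) * (s' * s)" by (simp add: algebra_simps)
    also have "\<dots> = s * t * (a' * t' + b' * s')" unfolding *(3,6) by (simp add: algebra_simps)
    finally show "node_frac V (a' * t' + b' * s') (s' * t') = node_frac V (a * t + b * s) (s * t)"
      using assms * by (subst frac_eq_iff) auto
  qed (use frac_self assms in blast)+
  then show ?thesis by (simp add: localization_def)
qed

lemma loc_zero: "\<zero>\<^bsub>loc V\<^esub> = node_frac V 0 1" and loc_one: "\<one>\<^bsub>loc V\<^esub> = node_frac V 1 1"
  by (simp_all add: localization_def)

lemma frac_in [simp, intro]: "a \<in> polys V \<Longrightarrow> s \<in> denoms V \<Longrightarrow> node_frac V a s \<in> carrier (loc V)"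
  by (auto simp: localization_def)

lemma loc_cases:
  assumes "x \<in> carrier (loc V)"
  obtains a s where "x = node_frac V a s" "a \<in> polys V" "s \<in> denoms V"
  using assms by (auto simp: localization_def)

lemma cring_loc: "cring (loc V :: (('v, 'k::field) mpoly \<times> ('v, 'k) mpoly) set ring)"
proof (rule cringI)
  let ?R = "loc V :: (('v, 'k) mpoly \<times> ('v, 'k) mpoly) set ring"
  show "abelian_group ?R"
  proof (rule abelian_groupI)
    fix x y z assume "x \<in> carrier ?R" "y \<in> carrier ?R" "z \<in> carrier ?R"
    then show "x \<oplus>\<^bsub>?R\<^esub> y \<oplus>\<^bsub>?R\<^esub> z = x \<oplus>\<^bsub>?R\<^esub> (y \<oplus>\<^bsub>?R\<^esub> z)"
      by (elim loc_cases) (auto simp: loc_add frac_eq_iff algebra_simps)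
  next
    fix x assume "x \<in> carrier ?R"
    then obtain a s where x: "x = node_frac V a s" "a \<in> polys V" "s \<in> denoms V" by (rule loc_cases)
    show "\<exists>y\<in>carrier ?R. y \<oplus>\<^bsub>?R\<^esub> x = \<zero>\<^bsub>?R\<^esub>"
      using x by (intro bexI[of _ "node_frac V (- a) s"]) (auto simp: loc_add loc_zero frac_eq_iff algebra_simps)
  qed (auto elim!: loc_cases simp: loc_add loc_zero frac_eq_iff algebra_simps)
  show "comm_monoid ?R"
    by (rule comm_monoidI) (auto elim!: loc_cases simp: loc_mult loc_one frac_eq_iff algebra_simps)
  fix x y z assume "x \<in> carrier ?R" "y \<in> carrier ?R" "z \<in> carrier ?R"
  then show "(x \<oplus>\<^bsub>?R\<^esub> y) \<otimes>\<^bsub>?R\<^esub> z = x \<otimes>\<^bsub>?R\<^esub> z \<oplus>\<^bsub>?R\<^esub> y \<otimes>\<^bsub>?R\<^esub> z"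
    by (elim loc_cases) (auto simp: loc_add loc_mult frac_eq_iff algebra_simps)
qed

lemma loc_uminus:
  fixes a s :: "('v, 'k::field) mpoly"
  assumes "a \<in> polys V" "s \<in> denoms V"
  shows "\<ominus>\<^bsub>loc V\<^esub> node_frac V a s = node_frac V (- a) s"
proof -
  interpret cring "loc V :: (('v, 'k) mpoly \<times> ('v, 'k) mpoly) set ring" by (rule cring_loc)
  show ?thesis using assms
    by (intro minus_equality) (auto simp: loc_add loc_zero frac_eq_iff algebra_simps)
qed

definition monomial_ideal :: "'v set \<Rightarrow> ('v \<Rightarrow>\<^sub>0 nat) set \<Rightarrow> (('v, 'k::field) mpoly \<times> ('v, 'k) mpoly) set set" where
  "monomial_ideal V U = {node_frac V p s | p s. keys p \<subseteq> U \<and> s \<in> denoms V}"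

lemma upset_polys: "upset V U \<Longrightarrow> keys p \<subseteq> U \<Longrightarrow> p \<in> polys V"
  unfolding upset_def polys_iff by blast

text \<open>A denominator has a constant term, so it cannot move a monomial of least degree into the upset.\<close>

lemma keys_denoms_mult:
  fixes p s :: "('v, 'k::field) mpoly"
  assumes V: "finite V" and U: "upset V U" and s: "s \<in> denoms V" and p: "p \<in> polys V"
    and sub: "keys (s * p) \<subseteq> U"
  shows "keys p \<subseteq> U"
proof (rule ccontr)
  assume "\<not> ?thesis"
  then have "keys p - U \<noteq> {}" by blast
  then obtain a where a: "a \<in> keys p" "a \<notin> U" 
    and min: "\<And>b. b \<in> keys p - U \<Longrightarrow> mdeg V a \<le> mdeg V b"
    using arg_min_if_finite[of "keys p - U" "mdeg V"] by (metis Diff_iff finite_Diff finite_keys not_less)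
  have pm: "keys p \<subseteq> monomials V" "keys s \<subseteq> monomials V"
    using p s denoms_polys by (auto simp: polys_iff)
  have key: "c = 0 \<and> b = a" if "c \<in> keys s" "b \<in> keys p" "c + b = a" for b c
  proof -
    have m: "c \<in> monomials V" using that(1) pm by blast
    have "b \<notin> U" using a(2) U m that(3) unfolding upset_def by (metis add.commute)
    then have "mdeg V a \<le> mdeg V b" using min that(2) by blast
    then have "mdeg V c = 0" using that(3) by auto
    then show ?thesis using mdeg_eq_0_iff[OF V m] that(3) by simp
  qed
  have "lookup (s * p) a = (\<Sum>c\<in>keys s. if c = 0 then 
      (\<Sum>b\<in>keys p. if b = a then lookup s 0 * lookup p a else 0) else 0)"
    unfolding lookup_times by (intro sum.cong refl) (auto dest: key intro!: sum.cong sum.neutral)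
  also have "\<dots> = lookup s 0 * lookup p a"
    using a by (auto simp: sum.delta in_keys_iff)
  also have "\<dots> \<noteq> 0" using a s[unfolded node_denominators_eq] by (simp add: in_keys_iff)
  finally show False using a(2) sub by (auto simp: in_keys_iff)
qed

text \<open>Two representations of a fraction satisfy \<open>t * p = s * q\<close>. The right side
  has support in \<open>U\<close>, and by \<open>keys_denoms_mult\<close> cancelling the denominator
  \<open>t\<close> keeps the support there. So membership may be tested on any numerator.\<close>

lemma monomial_ideal_iff:
  assumes "finite V" "upset V U" "p \<in> polys V" "s \<in> denoms V"
  shows "node_frac V p s \<in> monomial_ideal V U \<longleftrightarrow> keys p \<subseteq> U"
proof
  assume "node_frac V p s \<in> monomial_ideal V U"
  then obtain q t where q: "node_frac V p s = node_frac V q t" "keys q \<subseteq> U" "t \<in> denoms V"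
    by (auto simp: monomial_ideal_def)
  note qp = upset_polys[OF assms(2) q(2)]
  have "t * p = s * q" using q(1) assms(3,4) qp q(3) by (simp add: frac_eq_iff)
  then have "keys (t * p) \<subseteq> U"
    using keys_mult_upset[OF assms(2) q(2)] assms(4) by auto
  then show "keys p \<subseteq> U" using keys_denoms_mult[OF assms(1,2) q(3) assms(3)] by blast
qed (use assms in \<open>auto simp: monomial_ideal_def\<close>)

lemma monomial_ideal_cases:
  assumes "x \<in> monomial_ideal V U" "upset V U"
  obtains p s where "x = node_frac V p s" "keys p \<subseteq> U" "p \<in> polys V" "s \<in> denoms V"
  using assms upset_polys[OF assms(2)] unfolding monomial_ideal_def by blast

lemma monomial_idealI: "keys p \<subseteq> U \<Longrightarrow> s \<in> denoms V \<Longrightarrow> node_frac V p s \<in> monomial_ideal V U"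
  unfolding monomial_ideal_def by blast

lemma monomial_ideal_mono: "U \<subseteq> U' \<Longrightarrow> monomial_ideal V U \<subseteq> monomial_ideal V U'"
  unfolding monomial_ideal_def by blast

lemma ideal_monomial_ideal:
  fixes V :: "'v set"
  assumes "upset V U"
  shows "ideal (monomial_ideal V U) (loc V :: (('v, 'k::field) mpoly \<times> ('v, 'k) mpoly) set ring)"
proof -
  let ?R = "loc V :: (('v, 'k) mpoly \<times> ('v, 'k) mpoly) set ring"
  let ?I = "monomial_ideal V U :: (('v, 'k) mpoly \<times> ('v, 'k) mpoly) set set"
  interpret cring ?R by (rule cring_loc)
  note up = upset_polys[OF assms] and km = keys_mult_upset[OF assms]
  have mult: "x \<otimes>\<^bsub>?R\<^esub> a \<in> ?I" if ax: "a \<in> ?I" "x \<in> carrier ?R" for a x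
  proof -
    obtain p s where p: "a = node_frac V p s" "keys p \<subseteq> U" "p \<in> polys V" "s \<in> denoms V"
      using monomial_ideal_cases[OF ax(1) assms] .
    obtain q t where q: "x = node_frac V q t" "q \<in> polys V" "t \<in> denoms V"
      using loc_cases[OF ax(2)] .
    show ?thesis unfolding p q using p q by (simp add: loc_mult) (intro monomial_idealI km; simp)
  qed
  have add: "a \<oplus>\<^bsub>?R\<^esub> b \<in> ?I" if ax: "a \<in> ?I" "b \<in> ?I" for a b
  proof -
    obtain p s where p: "a = node_frac V p s" "keys p \<subseteq> U" "p \<in> polys V" "s \<in> denoms V"
      using monomial_ideal_cases[OF ax(1) assms] .
    obtain q t where q: "b = node_frac V q t" "keys q \<subseteq> U" "q \<in> polys V" "t \<in> denoms V"
      using monomial_ideal_cases[OF ax(2) assms] .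
    have "keys (t * p + s * q) \<subseteq> U"
      using p q by (intro keys_add_subset km) auto
    then show ?thesis unfolding p q using p q
      by (simp add: loc_add mult.commute) (intro monomial_idealI; simp add: mult.commute)
  qed
  have sub: "?I \<subseteq> carrier ?R" by (auto elim!: monomial_ideal_cases[OF _ assms])
  show ?thesis
  proof (rule idealI)
    show "subgroup ?I (add_monoid ?R)"
    proof (rule add.subgroupI)
      have "node_frac V 0 1 \<in> ?I" by (rule monomial_idealI) auto
      then show "?I \<noteq> {}" by blast
      fix a assume "a \<in> ?I"
      then show "\<ominus>\<^bsub>?R\<^esub> a \<in> ?I"
        by (elim monomial_ideal_cases[OF _ assms]) (auto simp: loc_uminus intro!: monomial_idealI)
    qed (use sub add in auto)
    show "ring ?R" by (rule ring_axioms)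
    fix a x assume a: "a \<in> ?I" and x: "x \<in> carrier ?R"
    show "x \<otimes>\<^bsub>?R\<^esub> a \<in> ?I" by (rule mult[OF a x])
    then show "a \<otimes>\<^bsub>?R\<^esub> x \<in> ?I" using a x sub m_comm[of a x] by auto
  qed
qed

lemma frac_mult_one:
  assumes "p \<in> polys V" "s \<in> denoms V"
  shows "node_frac V p s = node_frac V 1 s \<otimes>\<^bsub>loc V\<^esub> node_frac V p 1"
  using assms by (simp add: loc_mult)

lemma frac_add_one:
  assumes "p \<in> polys V" "q \<in> polys V"
  shows "node_frac V p 1 \<oplus>\<^bsub>loc V\<^esub> node_frac V q 1 = node_frac V (p + q) 1"
  using assms by (simp add: loc_add)

lemmas ideal_add = additive_subgroup.a_closed[OF ideal.axioms(1)]
lemmas ideal_zero = additive_subgroup.zero_closed[OF ideal.axioms(1)]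

lemma monomial_ideal_subset:
  fixes V :: "'v set" and J :: "(('v, 'k::field) mpoly \<times> ('v, 'k) mpoly) set set"
  assumes "upset V U" "ideal J (loc V)"
    and mon: "\<And>u. u \<in> U \<Longrightarrow> node_frac V (single u 1) 1 \<in> J"
  shows "monomial_ideal V U \<subseteq> J"
proof
  interpret J: ideal J "loc V" by fact
  fix x :: "(('v, 'k) mpoly \<times> ('v, 'k) mpoly) set" assume "x \<in> monomial_ideal V U"
  then obtain p s where p: "x = node_frac V p s" "keys p \<subseteq> U" "p \<in> polys V" "s \<in> denoms V"
    using assms(1) by (elim monomial_ideal_cases)
  have m: "single u c \<in> polys V" if "u \<in> U" for u and c :: 'k
    using that assms(1) by (auto simp: polys_iff upset_def)
  have single: "node_frac V (single u c) 1 \<in> J" if u: "u \<in> U" for u and c :: 'k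
  proof -
    have "single u c = single 0 c * single u 1" by (simp add: mult_single)
    then have "node_frac V (single u c) 1 = node_frac V (single 0 c) 1 \<otimes>\<^bsub>loc V\<^esub> node_frac V (single u 1) 1"
      using m[OF u] by (subst loc_mult) (use m[OF u, of 1] in \<open>simp_all add: polys_iff\<close>)
    then show ?thesis using J.I_l_closed[OF mon[OF u]] by (auto simp: polys_iff)
  qed
  have "K \<subseteq> U \<Longrightarrow> (\<Sum>u\<in>K. single u (f u)) \<in> polys V \<and> node_frac V (\<Sum>u\<in>K. single u (f u)) 1 \<in> J"
    for K and f :: "('v \<Rightarrow>\<^sub>0 nat) \<Rightarrow> 'k"
  proof (induction K rule: infinite_finite_induct)
    case (insert u K)
    then have IH: "(\<Sum>u\<in>K. single u (f u)) \<in> polys V" 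
      "node_frac V (\<Sum>u\<in>K. single u (f u)) 1 \<in> J" and u: "u \<in> U" by auto
    show ?case using insert.hyps m[OF u] IH(1) ideal_add[OF assms(2) single[OF u, of "f u"] IH(2)]
      by (simp add: frac_add_one)
  qed (use ideal_zero[OF assms(2)] in \<open>auto simp: loc_zero\<close>)
  from this[OF p(2), of "lookup p"]
  have "node_frac V p 1 \<in> J" by (simp flip: poly_mapping_sum_single)
  then show "x \<in> J" unfolding p(1) frac_mult_one[OF p(3,4)] using p(4) by (intro J.I_l_closed) auto
qed

definition shifts :: "'v set \<Rightarrow> ('v \<Rightarrow>\<^sub>0 nat) set \<Rightarrow> ('v \<Rightarrow>\<^sub>0 nat) set" where
  "shifts V B = {b + r | b r. b \<in> B \<and> r \<in> monomials V}"

lemma upset_shifts: "B \<subseteq> monomials V \<Longrightarrow> upset V (shifts V B)"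
  unfolding upset_def shifts_def
  by (auto simp: add.assoc) (metis monomials_add_iff)

lemma genideal_monomials:
  fixes V :: "'v set"
  assumes "B \<subseteq> monomials V"
  shows "Idl\<^bsub>loc V\<^esub> ((\<lambda>b. node_frac V (single b (1::'k::field)) 1) ` B) = monomial_ideal V (shifts V B)"
    (is "Idl\<^bsub>?R\<^esub> ?G = ?I")
proof
  interpret cring ?R by (rule cring_loc)
  have up: "upset V (shifts V B)" using upset_shifts[OF assms] .
  have B: "b \<in> shifts V B" if "b \<in> B" for b
    unfolding shifts_def using that by (intro CollectI exI[of _ b] exI[of _ 0]) auto
  have "?G \<subseteq> ?I" using B by (auto intro!: monomial_idealI)
  then show "Idl\<^bsub>?R\<^esub> ?G \<subseteq> ?I" by (rule genideal_minimal[OF ideal_monomial_ideal[OF up]])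
  have G: "?G \<subseteq> carrier ?R" using assms by (auto simp: polys_iff)
  show "?I \<subseteq> Idl\<^bsub>?R\<^esub> ?G"
  proof (rule monomial_ideal_subset[OF up genideal_ideal[OF G]])
    interpret I: ideal "Idl\<^bsub>?R\<^esub> ?G" ?R by (rule genideal_ideal[OF G])
    fix u assume "u \<in> shifts V B"
    then obtain b r where b: "u = b + r" "b \<in> B" "r \<in> monomials V" by (auto simp: shifts_def)
    have "node_frac V (single r (1::'k)) 1 \<otimes>\<^bsub>?R\<^esub> node_frac V (single b 1) 1 \<in> Idl\<^bsub>?R\<^esub> ?G"
      using b genideal_self[OF G] by (intro I.I_l_closed) (auto simp: polys_iff)
    also have "node_frac V (single r (1::'k)) 1 \<otimes>\<^bsub>?R\<^esub> node_frac V (single b 1) 1 = node_frac V (single u 1) 1"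
      using b assms by (subst loc_mult) (auto simp: polys_iff mult_single add.commute)
    finally show "node_frac V (single u (1::'k)) 1 \<in> Idl\<^bsub>?R\<^esub> ?G" .
  qed
qed

lemma monomial_ideal_prod:
  fixes V :: "'v set"
  assumes U: "upset V U" and W: "upset V W"
  shows "monomial_ideal V U \<cdot>\<^bsub>loc V\<^esub> monomial_ideal V W = 
    (monomial_ideal V {u + w | u w. u \<in> U \<and> w \<in> W} :: (('v, 'k::field) mpoly \<times> ('v, 'k) mpoly) set set)"
    (is "?I \<cdot>\<^bsub>?R\<^esub> ?J = monomial_ideal V ?UW")
proof
  interpret cring ?R by (rule cring_loc)
  have up: "upset V ?UW"
    using U W unfolding upset_def by (auto simp: add.assoc) blast
  note iU = ideal_monomial_ideal[OF U] and iW = ideal_monomial_ideal[OF W]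
  show "?I \<cdot>\<^bsub>?R\<^esub> ?J \<subseteq> monomial_ideal V ?UW"
  proof
    fix x assume "x \<in> ?I \<cdot>\<^bsub>?R\<^esub> ?J"
    then show "x \<in> monomial_ideal V ?UW"
    proof (induction rule: ideal_prod.induct)
      case (prod i j)
      obtain p s where p: "i = node_frac V p s" "keys p \<subseteq> U" "p \<in> polys V" "s \<in> denoms V"
        using monomial_ideal_cases[OF prod(1) U] .
      obtain q t where q: "j = node_frac V q t" "keys q \<subseteq> W" "q \<in> polys V" "t \<in> denoms V"
        using monomial_ideal_cases[OF prod(2) W] .
      have "keys (p * q) \<subseteq> ?UW" using keys_mult[of p q] p(2) q(2) by blast
      then show ?case using p q by (auto simp: loc_mult intro!: monomial_idealI)
    qed (rule ideal_add[OF ideal_monomial_ideal[OF up]])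
  qed
  show "monomial_ideal V ?UW \<subseteq> ?I \<cdot>\<^bsub>?R\<^esub> ?J"
  proof (rule monomial_ideal_subset[OF up ideal_prod_is_ideal[OF iU iW]])
    fix u assume "u \<in> ?UW"
    then obtain a b where ab: "u = a + b" "a \<in> U" "b \<in> W" by blast
    then have m: "a \<in> monomials V" "b \<in> monomials V" using U W by (auto simp: upset_def)
    have "node_frac V (single a (1::'k)) 1 \<otimes>\<^bsub>?R\<^esub> node_frac V (single b 1) 1 \<in> ?I \<cdot>\<^bsub>?R\<^esub> ?J"
      using ab by (intro ideal_prod.prod monomial_idealI) auto
    then show "node_frac V (single u (1::'k)) 1 \<in> ?I \<cdot>\<^bsub>?R\<^esub> ?J"
      using m by (simp add: loc_mult polys_iff mult_single ab(1))
  qed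
qed

lemma monomial_ideal_UNIV: "monomial_ideal V (monomials V) = carrier (loc V)"
proof -
  have "upset V (monomials V)" by (auto simp: upset_def)
  then show ?thesis
    by (auto elim!: monomial_ideal_cases loc_cases intro: monomial_idealI simp: polys_iff)
qed

lemma ideal_power_0: "ideal_power R I 0 = carrier R"
  by (simp add: ideal_power_def ideals_set_def nat_pow_def)

lemma ideal_power_Suc: "ideal_power R I (Suc t) = ideal_power R I t \<cdot>\<^bsub>R\<^esub> I"
  by (simp add: ideal_power_def ideals_set_def nat_pow_def)

lemma edge_sums_Suc:
  "edge_sums E (Suc s) = {u + edge_monomial e | u e. u \<in> edge_sums E s \<and> e \<in> E}"
proof
  have "s' = Suc s \<longrightarrow> (\<exists>u' e. u = u' + edge_monomial e \<and> u' \<in> edge_sums E s \<and> e \<in> E)"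
    if "u \<in> edge_sums E s'" for u s'
    using that by (induction rule: edge_sums_induct) auto
  then show "edge_sums E (Suc s) \<subseteq> {u + edge_monomial e | u e. u \<in> edge_sums E s \<and> e \<in> E}"
    by blast
  show "{u + edge_monomial e | u e. u \<in> edge_sums E s \<and> e \<in> E} \<subseteq> edge_sums E (Suc s)"
    using edge_sums_add[OF _ edge_sums_edge] by fastforce
qed

lemma power_monomials_shifts: "power_monomials V E t = shifts V (edge_sums E t)"
  by (simp add: power_monomials_def shifts_def)

lemma upset_power_monomials:
  assumes "finite V" "E \<subseteq> Pow V" shows "upset V (power_monomials V E t)"
  unfolding power_monomials_shifts using edge_sums_monomials[OF assms] by (intro upset_shifts) auto

lemma power_monomials_Suc:
  "power_monomials V E (Suc t) = {u + w | u w. u \<in> power_monomials V E t \<and> w \<in> power_monomials V E 1}"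
proof (intro equalityI subsetI)
  fix x assume "x \<in> power_monomials V E (Suc t)"
  then obtain u e r where x: "x = u + edge_monomial e + r" "u \<in> edge_sums E t" "e \<in> E" "r \<in> monomials V"
    by (auto simp: power_monomials_def edge_sums_Suc)
  have "u \<in> power_monomials V E t" using edge_sums_power[OF x(2)] .
  moreover have "edge_monomial e + r \<in> power_monomials V E 1"
    using power_monomialsI[OF edge_sums_edge[OF x(3)] x(4)] .
  ultimately show "x \<in> {u + w | u w. u \<in> power_monomials V E t \<and> w \<in> power_monomials V E 1}"
    using x(1) by (auto simp: add.assoc)
next
  fix x assume "x \<in> {u + w | u w. u \<in> power_monomials V E t \<and> w \<in> power_monomials V E 1}"
  then obtain a w where a: "x = a + w" "a \<in> power_monomials V E t" "w \<in> power_monomials V E 1" by blast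
  obtain u r where u: "a = u + r" "u \<in> edge_sums E t" "r \<in> monomials V"
    using a(2) by (auto simp: power_monomials_def)
  have "u + w + r \<in> power_monomials V E (t + 1)"
    by (intro power_monomials_shift power_monomials_add u a)
  then show "x \<in> power_monomials V E (Suc t)" using a(1) u(1) by (simp add: ac_simps)
qed

lemma prod_mpoly_var: "finite e \<Longrightarrow> (\<Prod>v\<in>e. mpoly_var v) = single (edge_monomial e) (1::'k::field)"
  by (induction e rule: finite_induct) (simp_all add: edge_monomial_def mpoly_var_def mult_single)

lemma edge_ideal_eq:
  fixes V :: "'v set"
  assumes V: "finite V" and E: "E \<subseteq> Pow V"
  shows "edge_ideal TYPE('k::field) V E = monomial_ideal V (power_monomials V E 1)"
proof -
  have fin: "finite e" if "e \<in> E" for e using that V E by (meson PowD finite_subset subsetD)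
  have "(\<lambda>e. node_frac V (\<Prod>v\<in>e. mpoly_var v) (1::('v, 'k) mpoly)) ` E
    = (\<lambda>b. node_frac V (single b (1::'k)) 1) ` edge_monomial ` E"
    unfolding image_image using fin by (intro image_cong) (simp_all add: prod_mpoly_var)
  moreover have "edge_monomial ` E \<subseteq> monomials V" using E by (auto intro!: edge_monomial_in)
  moreover have "edge_sums E 1 = edge_monomial ` E"
    unfolding One_nat_def edge_sums_Suc edge_sums_0_eq by auto
  ultimately show ?thesis
    unfolding edge_ideal_def node_local_ring_def power_monomials_shifts
    by (simp only: genideal_monomials)
qed

lemma edge_ideal_power:
  assumes V: "finite V" and E: "E \<subseteq> Pow V"
  shows "ideal_power (node_local_ring TYPE('k::field) V) (edge_ideal TYPE('k) V E) t
    = monomial_ideal V (power_monomials V E t)"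
proof (induction t)
  case 0
  show ?case by (simp add: ideal_power_0 power_monomials_0 monomial_ideal_UNIV node_local_ring_def)
next
  case (Suc t)
  show ?case
    unfolding ideal_power_Suc Suc.IH power_monomials_Suc[of V E t]
    unfolding edge_ideal_eq[OF V E] node_local_ring_def
    by (rule monomial_ideal_prod) (intro upset_power_monomials V E)+
qed

section \<open>The maximal ideal and its powers\<close>

definition high_monomials :: "'v set \<Rightarrow> nat \<Rightarrow> ('v \<Rightarrow>\<^sub>0 nat) set" where
  "high_monomials V k = {u \<in> monomials V. mdeg V u \<ge> k}"

lemma upset_high_monomials: "upset V (high_monomials V k)"
  by (auto simp: upset_def high_monomials_def)

lemma high_monomials_Suc:
  assumes "finite V"
  shows "high_monomials V (Suc k) = {u + w | u w. u \<in> high_monomials V k \<and> w \<in> high_monomials V 1}"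
proof (intro equalityI subsetI)
  fix u assume u: "u \<in> high_monomials V (Suc k)"
  have "\<exists>v\<in>V. lookup u v \<ge> 1"
  proof (rule ccontr)
    assume "\<not> ?thesis"
    then have "mdeg V u = 0" unfolding mdeg_def by (intro sum.neutral) (auto simp: not_less_eq_eq)
    then show False using u by (simp add: high_monomials_def)
  qed
  then obtain v where v: "v \<in> V" "lookup u v \<ge> 1" by blast
  have "u \<in> monomials V" using u by (simp add: high_monomials_def)
  then obtain w where w: "w \<in> monomials V" "u = w + single v 1" using v(2) by (rule split_single)
  then have "w \<in> high_monomials V k" "single v 1 \<in> high_monomials V 1"
    using u v assms by (auto simp: high_monomials_def mdeg_single)
  then show "u \<in> {u + w | u w. u \<in> high_monomials V k \<and> w \<in> high_monomials V 1}"
    using w(2) by blast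
qed (auto simp: high_monomials_def)

text \<open>\<open>max_ideal\<close> is a definite description, which requires uniqueness besides
  maximality. Both come from one fact: an ideal not contained in \<open>?M\<close> contains a
  unit.\<close>

lemma max_ideal_loc:
  assumes V: "finite V"
  shows "max_ideal (loc V :: (('v, 'k::field) mpoly \<times> ('v, 'k) mpoly) set ring) = monomial_ideal V (high_monomials V 1)"
proof -
  let ?R = "loc V :: (('v, 'k) mpoly \<times> ('v, 'k) mpoly) set ring"
  let ?M = "monomial_ideal V (high_monomials V 1) :: (('v, 'k) mpoly \<times> ('v, 'k) mpoly) set set"
  interpret cring ?R by (rule cring_loc)
  interpret M: ideal ?M ?R by (rule ideal_monomial_ideal[OF upset_high_monomials])
  have unit: "carrier ?R \<subseteq> J" if J: "ideal J ?R" and JM: "\<not> J \<subseteq> ?M" for J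
  proof -
    obtain x where x: "x \<in> J" "x \<notin> ?M" using JM by blast
    have "x \<in> carrier ?R" using x(1) J by (meson ideal.Icarr)
    then obtain a s where a: "x = node_frac V a s" "a \<in> polys V" "s \<in> denoms V" by (rule loc_cases)
    \<comment> \<open>A fraction outside \<open>?M\<close> has a numerator with a nonzero constant
      term. Such a numerator is itself a denominator, so the fraction can be inverted.\<close>
    have "a \<in> denoms V"
    proof (rule ccontr)
      assume "a \<notin> denoms V"
      then have "0 \<notin> keys a"
        using a(2) unfolding node_denominators_eq by (simp add: in_keys_iff)
      then have "keys a \<subseteq> high_monomials V 1"
        using a(2) mdeg_eq_0_iff[OF V] by (force simp: polys_iff high_monomials_def Suc_le_eq)
      then show False using x(2) a monomial_idealI by blast
    qed
    then have "node_frac V s a \<otimes>\<^bsub>?R\<^esub> x = \<one>\<^bsub>?R\<^esub>" "node_frac V s a \<in> carrier ?R"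
      using a by (auto simp: loc_mult loc_one frac_eq_iff mult.commute)
    then have "\<one>\<^bsub>?R\<^esub> \<in> J" using ideal.I_l_closed[OF J x(1)] by metis
    then show "carrier ?R \<subseteq> J" using ideal.one_imp_carrier[OF J] by simp
  qed
  have one: "\<one>\<^bsub>?R\<^esub> \<notin> ?M"
    unfolding loc_one using monomial_ideal_iff[OF V upset_high_monomials, of 1 1 1] 
    by (auto simp: high_monomials_def)
  have max: "maximalideal ?M ?R"
  proof (rule maximalidealI)
    show "carrier ?R \<noteq> ?M" using one by auto
    fix J assume J: "ideal J ?R" "?M \<subseteq> J" "J \<subseteq> carrier ?R"
    then show "J = ?M \<or> J = carrier ?R" using unit[OF J(1)] by blast
  qed (rule M.ideal_axioms)
  show ?thesis unfolding max_ideal_def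
  proof (rule the_equality[where a = ?M])
    fix J assume J: "maximalideal J ?R"
    interpret J: maximalideal J ?R by fact
    have "J \<subseteq> ?M" using unit[OF J.ideal_axioms] J.I_notcarr J.a_subset by blast
    then show "J = ?M" using J.I_maximal[OF M.ideal_axioms] M.a_subset one by auto
  qed (rule max)
qed

lemma max_ideal_power:
  assumes V: "finite V"
  shows "ideal_power (loc V :: (('v, 'k::field) mpoly \<times> ('v, 'k) mpoly) set ring) (max_ideal (loc V)) k
    = monomial_ideal V (high_monomials V k)"
proof (induction k)
  case 0
  have "high_monomials V 0 = monomials V" by (auto simp: high_monomials_def)
  then show ?case by (simp add: ideal_power_0 monomial_ideal_UNIV)
next
  case (Suc k)
  show ?case
    unfolding ideal_power_Suc Suc.IH high_monomials_Suc[OF V, of k]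
    unfolding max_ideal_loc[OF V]
    by (rule monomial_ideal_prod) (rule upset_high_monomials)+
qed

section \<open>Lengths\<close>

text \<open>The module \<open>H / N\<close>. The ideal \<open>I\<close> only serves to match the shape of the local cohomology of \<open>I / N\<close>.\<close>

definition subquotient :: "('a, 'b) ring_scheme \<Rightarrow> 'a set \<Rightarrow> 'a set \<Rightarrow> 'a set \<Rightarrow> ('a, 'a set) module" where
  "subquotient R I N H = (quot_module (ideal_module R I) N)\<lparr>carrier := (\<lambda>x. N +>\<^bsub>R\<^esub> x) ` H\<rparr>"

lemma subquotient_simps [simp]:
  "carrier (subquotient R I N H) = (\<lambda>x. N +>\<^bsub>R\<^esub> x) ` H"
  "zero (subquotient R I N H) = N"
  "add (subquotient R I N H) = set_add R"
  "smult (subquotient R I N H) r X = (\<Union>x\<in>X. N +>\<^bsub>R\<^esub> (r \<otimes>\<^bsub>R\<^esub> x))"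
  by (auto simp: subquotient_def quot_module_def ideal_module_def set_add_def set_mult_def fun_eq_iff a_r_coset_def r_coset_def)

section \<open>The correspondence theorem for \<open>H / N\<close>\<close>

context cring
begin

context
  fixes N H :: "'a set" and I :: "'a set"
  assumes N: "ideal N R" and H: "ideal H R" and NH: "N \<subseteq> H"
begin

interpretation N: ideal N R by (rule N)
interpretation H: ideal H R by (rule H)

lemma coset_add:
  "x \<in> carrier R \<Longrightarrow> y \<in> carrier R \<Longrightarrow> (N +> x) <+> (N +> y) = N +> (x \<oplus> y)"
  by (rule N.a_rcos_sum)

lemma coset_smult:
  assumes "r \<in> carrier R" "x \<in> carrier R"
  shows "r \<odot>\<^bsub>subquotient R I N H\<^esub> (N +> x) = N +> (r \<otimes> x)"
proof -
  have "N +> (r \<otimes> y) = N +> (r \<otimes> x)" if y: "y \<in> N +> x" for y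
  proof -
    obtain n where n: "n \<in> N" "y = n \<oplus> x" using y by (auto simp: a_r_coset_def r_coset_def)
    then have "r \<otimes> y = r \<otimes> n \<oplus> r \<otimes> x" using assms N.Icarr by (simp add: r_distr)
    moreover have "r \<otimes> n \<in> N" using n(1) assms by (simp add: N.I_l_closed)
    ultimately have "r \<otimes> y \<in> N +> (r \<otimes> x)" by (auto simp: a_r_coset_def r_coset_def)
    then show ?thesis using assms by (intro N.a_repr_independence'[symmetric]) auto
  qed
  moreover have "N +> x \<noteq> {}" using assms N.a_rcos_self by blast
  ultimately show ?thesis unfolding subquotient_simps by (intro SUP_eq_const)
qed

lemma coset_zero_iff: "x \<in> carrier R \<Longrightarrow> N +> x = N \<longleftrightarrow> x \<in> N"
  using a_coset_join2[OF _ N.a_subgroup, of x] N.a_rcos_self[of x] by auto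

lemma submodule_of_ideal:
  assumes J: "ideal J R" "N \<subseteq> J" "J \<subseteq> H"
  shows "submodule ((\<lambda>x. N +> x) ` J) R (subquotient R I N H)"
proof -
  interpret J: ideal J R by (rule J)
  let ?M = "subquotient R I N H"
  have Jc: "x \<in> carrier R" if "x \<in> J" for x using that by (rule J.Icarr)
  have Hc: "x \<in> carrier R" if "x \<in> H" for x using that by (rule H.Icarr)
  have neg: "(N +> (\<ominus> x)) <+> (N +> x) = N" if "x \<in> carrier R" for x
    using that by (simp add: coset_add l_neg coset_zero_iff)
  have grp: "group (add_monoid ?M)"
  proof (rule groupI)
    fix X Y Z assume "X \<in> carrier (add_monoid ?M)" "Y \<in> carrier (add_monoid ?M)" "Z \<in> carrier (add_monoid ?M)"
    then show "X \<otimes>\<^bsub>add_monoid ?M\<^esub> Y \<otimes>\<^bsub>add_monoid ?M\<^esub> Z = X \<otimes>\<^bsub>add_monoid ?M\<^esub> (Y \<otimes>\<^bsub>add_monoid ?M\<^esub> Z)"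
      using Hc by (auto simp: coset_add a_assoc)
  next
    fix X Y assume "X \<in> carrier (add_monoid ?M)" "Y \<in> carrier (add_monoid ?M)"
    then show "X \<otimes>\<^bsub>add_monoid ?M\<^esub> Y \<in> carrier (add_monoid ?M)"
      using Hc H.a_closed by (auto simp: coset_add additive_subgroup.a_closed[OF H.is_additive_subgroup])
  next
    have "N +> \<zero> = N" by (simp add: coset_zero_iff)
    then show "\<one>\<^bsub>add_monoid ?M\<^esub> \<in> carrier (add_monoid ?M)"
      using H.zero_closed by (auto intro!: image_eqI[of _ _ \<zero>])
  next
    fix X assume "X \<in> carrier (add_monoid ?M)"
    then obtain x where x: "X = N +> x" "x \<in> H" by auto
    have "N +> \<zero> = N" by (simp add: coset_zero_iff)
    then show "\<one>\<^bsub>add_monoid ?M\<^esub> \<otimes>\<^bsub>add_monoid ?M\<^esub> X = X" using x Hc[OF x(2)] coset_add[of \<zero> x] by simp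
    show "\<exists>Y\<in>carrier (add_monoid ?M). Y \<otimes>\<^bsub>add_monoid ?M\<^esub> X = \<one>\<^bsub>add_monoid ?M\<^esub>"
      using x neg[OF Hc[OF x(2)]] H.a_inv_closed[OF x(2)] by (intro bexI[of _ "N +> (\<ominus> x)"]) auto
  qed
  have "subgroup ((\<lambda>x. N +> x) ` J) (add_monoid ?M)"
  proof (rule group.subgroupI[OF grp])
    show "(\<lambda>x. N +> x) ` J \<subseteq> carrier (add_monoid ?M)" using J(3) by auto
    show "(\<lambda>x. N +> x) ` J \<noteq> {}" using J.zero_closed by blast
  next
    fix X assume "X \<in> (\<lambda>x. N +> x) ` J"
    then obtain x where x: "X = N +> x" "x \<in> J" by blast
    then have nx: "\<ominus> x \<in> J" by (simp add: J.a_inv_closed)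
    have "inv\<^bsub>add_monoid ?M\<^esub> X = N +> (\<ominus> x)"
      using x nx J(3) neg[OF Jc[OF x(2)]] by (intro group.inv_equality[OF grp]) auto
    then show "inv\<^bsub>add_monoid ?M\<^esub> X \<in> (\<lambda>x. N +> x) ` J" using nx by simp
  next
    fix X Y assume "X \<in> (\<lambda>x. N +> x) ` J" "Y \<in> (\<lambda>x. N +> x) ` J"
    then show "X \<otimes>\<^bsub>add_monoid ?M\<^esub> Y \<in> (\<lambda>x. N +> x) ` J"
      using Jc by (auto simp: coset_add additive_subgroup.a_closed[OF J.is_additive_subgroup])
  qed
  then show ?thesis
    by (intro submodule.intro submodule_axioms.intro)
       (auto simp: coset_smult Jc J.I_l_closed simp del: subquotient_simps(4))
qed

text \<open>The preimage under the coset map, inverse to the image formed in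
  \<open>submodule_of_ideal\<close>.\<close>

lemma ideal_of_submodule:
  assumes K: "submodule K R (subquotient R I N H)"
  defines "J \<equiv> {x \<in> H. N +> x \<in> K}"
  shows "ideal J R" "N \<subseteq> J" "K = (\<lambda>x. N +> x) ` J"
proof -
  interpret K: submodule K R "subquotient R I N H" by (rule K)
  have Hc: "x \<in> carrier R" if "x \<in> H" for x using that by (rule H.Icarr)
  have add: "x \<oplus> y \<in> J" if "x \<in> J" "y \<in> J" for x y
    using that K.m_closed[of "N +> x" "N +> y"] Hc
    by (auto simp: J_def coset_add additive_subgroup.a_closed[OF H.is_additive_subgroup])
  have smult: "r \<otimes> x \<in> J" if "x \<in> J" "r \<in> carrier R" for r x
    using that K.smult_closed[of r "N +> x"] Hc
    by (auto simp: J_def coset_smult H.I_l_closed simp del: subquotient_simps(4))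
  show NJ: "N \<subseteq> J"
  proof
    fix x assume "x \<in> N"
    then have "N +> x = N" "x \<in> H" using NH by (auto simp: coset_zero_iff N.Icarr)
    then show "x \<in> J" using K.one_closed by (simp add: J_def)
  qed
  show "K = (\<lambda>x. N +> x) ` J" using K.subset by (auto simp: J_def)
  show "ideal J R"
  proof (rule idealI)
    show "ring R" by (rule ring_axioms)
    show "subgroup J (add_monoid R)"
    proof (rule add.subgroupI)
      show "J \<subseteq> carrier R" using Hc by (auto simp: J_def)
      show "J \<noteq> {}" using NJ N.zero_closed by blast
      fix x assume x: "x \<in> J"
      then have "\<ominus> x = (\<ominus> \<one>) \<otimes> x" using Hc by (simp add: J_def l_minus)
      then show "\<ominus> x \<in> J" using smult[OF x, of "\<ominus> \<one>"] by simp
    qed (rule add)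
    fix x r assume x: "x \<in> J" and r: "r \<in> carrier R"
    show "r \<otimes> x \<in> J" by (rule smult[OF x r])
    then show "x \<otimes> r \<in> J" using x r Hc by (simp add: J_def m_comm)
  qed
qed

text \<open>A coset of \<open>N\<close> that meets an ideal above \<open>N\<close> lies inside it.
  This keeps strict inclusions strict under the coset map.\<close>

lemma coset_image_subset_iff:
  assumes J: "ideal J R" "N \<subseteq> J" and J': "J' \<subseteq> carrier R"
  shows "(\<lambda>x. N +> x) ` J' \<subseteq> (\<lambda>x. N +> x) ` J \<longleftrightarrow> J' \<subseteq> J"
proof
  interpret J: ideal J R by (rule J)
  assume sub: "(\<lambda>x. N +> x) ` J' \<subseteq> (\<lambda>x. N +> x) ` J"
  show "J' \<subseteq> J"
  proof
    fix x assume x: "x \<in> J'"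
    then obtain y where y: "y \<in> J" "N +> x = N +> y" using sub by blast
    have "x \<in> N +> y" using x J' y N.a_rcos_self[of x] by auto
    then obtain n where "n \<in> N" "x = n \<oplus> y" by (auto simp: a_r_coset_def r_coset_def)
    then show "x \<in> J" using J(2) y(1) additive_subgroup.a_closed[OF J.is_additive_subgroup] by blast
  qed
qed blast

text \<open>The correspondence theorem exchanges chains of submodules for chains of ideals between
  \<open>N\<close> and \<open>H\<close>, which can be studied through supports of
  polynomials.\<close>

lemma module_length_subquotient:
  "module_length R (subquotient R I N H) = (SUP n \<in> {n. \<exists>J. (\<forall>i\<le>n. ideal (J i) R \<and> N \<subseteq> J i \<and> J i \<subseteq> H) \<and>
     (\<forall>i<n. J i \<subset> J (Suc i))}. enat n)"
proof -
  let ?c = "\<lambda>x. N +> x"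
  have "(\<exists>K. (\<forall>i\<le>n. submodule (K i) R (subquotient R I N H)) \<and> (\<forall>i<n. K i \<subset> K (Suc i))) \<longleftrightarrow>
    (\<exists>J. (\<forall>i\<le>n. ideal (J i) R \<and> N \<subseteq> J i \<and> J i \<subseteq> H) \<and> (\<forall>i<n. J i \<subset> J (Suc i)))" (is "?l \<longleftrightarrow> ?r") for n
  proof
    assume ?l
    then obtain K where K: "\<And>i. i \<le> n \<Longrightarrow> submodule (K i) R (subquotient R I N H)" "\<And>i. i < n \<Longrightarrow> K i \<subset> K (Suc i)"
      by blast
    define J where "J i = {x \<in> H. ?c x \<in> K i}" for i
    note J = ideal_of_submodule[OF K(1), folded J_def]
    have "J i \<subset> J (Suc i)" if "i < n" for i
    proof -
      have "J i \<subseteq> J (Suc i)" using K(2)[OF that] by (auto simp: J_def)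
      moreover have "J i \<noteq> J (Suc i)"
        using K(2)[OF that] J(3)[of i] J(3)[of "Suc i"] that by auto
      ultimately show ?thesis by blast
    qed
    moreover have "J i \<subseteq> H" for i by (auto simp: J_def)
    ultimately show ?r using J(1,2) by blast
  next
    assume ?r
    then obtain J where J: "\<And>i. i \<le> n \<Longrightarrow> ideal (J i) R \<and> N \<subseteq> J i \<and> J i \<subseteq> H" "\<And>i. i < n \<Longrightarrow> J i \<subset> J (Suc i)"
      by blast
    have "?c ` J i \<subset> ?c ` J (Suc i)" if "i < n" for i
    proof -
      have "J (Suc i) \<subseteq> carrier R" using J(1)[of "Suc i"] that H.a_subset by auto
      then have "\<not> ?c ` J (Suc i) \<subseteq> ?c ` J i"
        using coset_image_subset_iff[of "J i" "J (Suc i)"] J(1)[of i] J(2)[OF that] that by auto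
      then show ?thesis using J(2)[OF that] by blast
    qed
    then show ?l using J(1) submodule_of_ideal by (intro exI[of _ "\<lambda>i. ?c ` J i"]) auto
  qed
  then show ?thesis by (simp add: module_length_def)
qed

end

end

section \<open>Linear algebra of supports and chains of ideals\<close>

definition mscale :: "'k::field \<Rightarrow> ('v, 'k) mpoly \<Rightarrow> ('v, 'k) mpoly" where
  "mscale c p = single 0 c * p"

interpretation mpoly_vs: vector_space mscale
  by unfold_locales
     (simp_all add: mscale_def single_add distrib_left distrib_right mult_single flip: mult.assoc)

lemma keys_mscale: "keys p \<subseteq> B \<Longrightarrow> keys (mscale c p) \<subseteq> B"
  using keys_mult[of "single 0 c" p] by (auto simp: mscale_def split: if_splits)

text \<open>Steinitz exchange against the monomials of \<open>B\<close>, which span all polynomials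
  with support in \<open>B\<close>.\<close>

lemma mpoly_independent_card:
  fixes S :: "('v, 'k::field) mpoly set"
  assumes "finite B" and "\<And>p. p \<in> S \<Longrightarrow> keys p \<subseteq> B" and "mpoly_vs.independent S"
  shows "card S \<le> card B"
proof -
  let ?T = "(\<lambda>b. single b (1::'k)) ` B"
  have "p \<in> mpoly_vs.span ?T" if p: "p \<in> S" for p
  proof -
    have "p = (\<Sum>b\<in>keys p. mscale (lookup p b) (single b 1))"
      by (simp add: mscale_def mult_single flip: poly_mapping_sum_single)
    also have "\<dots> \<in> mpoly_vs.span ?T"
      using assms(2)[OF p] by (intro mpoly_vs.span_sum mpoly_vs.span_scale mpoly_vs.span_base) auto
    finally show ?thesis .
  qed
  then have "card S \<le> card ?T"
    using mpoly_vs.independent_span_bound[of ?T S] assms(1,3) by blast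
  then show ?thesis using card_image_le[OF assms(1), of "\<lambda>b. single b (1::'k)"] by linarith
qed

text \<open>One vector is chosen from each gap of the chain; it lies outside the span of its
  predecessors, so the chosen vectors are independent.\<close>

lemma mpoly_subspace_chain:
  fixes W :: "nat \<Rightarrow> ('v, 'k::field) mpoly set"
  assumes "finite B" and W: "\<And>i. i \<le> n \<Longrightarrow> mpoly_vs.subspace (W i)"
    and B: "\<And>p. p \<in> W n \<Longrightarrow> keys p \<subseteq> B"
    and chain: "\<And>i. i < n \<Longrightarrow> W i \<subset> W (Suc i)"
  shows "n \<le> card B"
proof -
  have "\<forall>i. \<exists>w. i < n \<longrightarrow> w \<in> W (Suc i) - W i" using chain by blast
  then obtain w where w: "\<And>i. i < n \<Longrightarrow> w i \<in> W (Suc i) - W i" by metis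
  have "mpoly_vs.independent (w ` {..<k}) \<and> card (w ` {..<k}) = k \<and> w ` {..<k} \<subseteq> W k" if "k \<le> n" for k
    using that
  proof (induction k)
    case 0
    then show ?case by (simp add: mpoly_vs.independent_empty)
  next
    case (Suc k)
    then have k: "k < n" and IH: "mpoly_vs.independent (w ` {..<k})" "card (w ` {..<k}) = k" "w ` {..<k} \<subseteq> W k"
      by auto
    have "mpoly_vs.span (w ` {..<k}) \<subseteq> W k"
      using IH(3) W[of k] k by (intro mpoly_vs.span_minimal) auto
    then have nin: "w k \<notin> mpoly_vs.span (w ` {..<k})" using w[OF k] by blast
    then have "w k \<notin> w ` {..<k}" by (metis mpoly_vs.span_base)
    moreover have "mpoly_vs.independent (insert (w k) (w ` {..<k}))"
      using nin IH(1) by (rule mpoly_vs.independent_insertI)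
    moreover have "insert (w k) (w ` {..<k}) \<subseteq> W (Suc k)"
      using IH(3) chain[OF k] w[OF k] by auto
    ultimately show ?case using IH(2) by (simp add: lessThan_Suc)
  qed
  then have ind: "mpoly_vs.independent (w ` {..<n})" "card (w ` {..<n}) = n" "w ` {..<n} \<subseteq> W n" by blast+
  have "card (w ` {..<n}) \<le> card B"
    by (rule mpoly_independent_card[OF assms(1) B ind(1)]) (use ind(3) in blast)
  then show ?thesis by (simp only: ind(2))
qed

text \<open>A monomial of least degree in \<open>S - U\<close> is no proper multiple of an element
  of \<open>S\<close>, so its removal leaves an upward closed set. The chain is built downwards from
  \<open>S\<close> in this way.\<close>

lemma upset_chain:
  assumes V: "finite V" and U: "upset V U" and S: "upset V S" "U \<subseteq> S" "finite (S - U)"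
  shows "\<exists>C. (\<forall>i\<le>card (S - U). upset V (C i) \<and> U \<subseteq> C i \<and> C i \<subseteq> S) \<and> 
    (\<forall>i<card (S - U). C i \<subset> C (Suc i)) \<and> C (card (S - U)) = S"
  using S
proof (induction "card (S - U)" arbitrary: S)
  case 0
  then have "S = U" by auto
  then show ?case using U by (intro exI[of _ "\<lambda>_. U"]) auto
next
  case (Suc n)
  note up = Suc.prems(1) and US = Suc.prems(2) and fin = Suc.prems(3)
  have "S - U \<noteq> {}" using Suc.hyps(2) by (metis card.empty nat.distinct(1))
  then obtain b where b: "b \<in> S - U" and min: "\<And>c. c \<in> S - U \<Longrightarrow> mdeg V b \<le> mdeg V c"
    using arg_min_if_finite[OF fin, of "mdeg V"] by (metis not_less)
  let ?S = "S - {b}"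
  have "upset V ?S" unfolding upset_def
  proof (intro conjI ballI)
    show "?S \<subseteq> monomials V" using up by (auto simp: upset_def)
    fix u r assume u: "u \<in> ?S" and r: "r \<in> monomials V"
    have "u + r \<noteq> b"
    proof
      assume eq: "u + r = b"
      then have "u \<notin> U" using b U r unfolding upset_def by blast
      then have "mdeg V b \<le> mdeg V u" using u min by blast
      then have "mdeg V r = 0" unfolding eq[symmetric] by simp
      then have "r = 0" using mdeg_eq_0_iff[OF V r] by blast
      then show False using eq u by simp
    qed
    then show "u + r \<in> ?S" using up u r by (auto simp: upset_def)
  qed
  moreover have "U \<subseteq> ?S" using US b by blast
  moreover have eq: "?S - U = (S - U) - {b}" by blast
  then have "finite (?S - U)" and n: "card (?S - U) = n"
    using fin b Suc.hyps(2) by simp_all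
  ultimately obtain C where C: "\<forall>i\<le>n. upset V (C i) \<and> U \<subseteq> C i \<and> C i \<subseteq> ?S"
    "\<forall>i<n. C i \<subset> C (Suc i)" "C n = ?S"
    using Suc.hyps(1)[of ?S] unfolding n by auto
  show ?case unfolding Suc.hyps(2)[symmetric]
  proof (intro exI[of _ "C(Suc n := S)"] conjI allI impI)
    fix i assume i: "i \<le> Suc n"
    have "i = Suc n \<or> upset V (C i) \<and> U \<subseteq> C i \<and> C i \<subseteq> S \<and> i \<noteq> Suc n"
      using C(1) i le_Suc_eq[of i n] by auto
    then show "upset V ((C(Suc n := S)) i)" "U \<subseteq> (C(Suc n := S)) i" "(C(Suc n := S)) i \<subseteq> S"
      using up US by (elim disjE; simp)+
  next
    fix i assume i: "i < Suc n"
    show "(C(Suc n := S)) i \<subset> (C(Suc n := S)) (Suc i)"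
      using C(2,3) i b by (cases "i = n") auto
  qed simp
qed

lemma monomial_ideal_strict:
  assumes V: "finite V" and "upset V U" "upset V U'" "U \<subset> U'"
  shows "(monomial_ideal V U :: (('v, 'k::field) mpoly \<times> ('v, 'k) mpoly) set set) \<subset> monomial_ideal V U'"
proof -
  obtain u where u: "u \<in> U'" "u \<notin> U" using assms(4) by blast
  then have p: "single u (1::'k) \<in> polys V" using assms(3) by (auto simp: polys_iff upset_def)
  have "node_frac V (single u (1::'k)) 1 \<in> monomial_ideal V U'"
    "node_frac V (single u (1::'k)) 1 \<notin> monomial_ideal V U"
    using u p by (simp_all add: monomial_ideal_iff[OF V] assms(2,3))
  then show ?thesis using monomial_ideal_mono[of U U' V] assms(4) by blast
qed

lemma split_keys:
  fixes p :: "'a \<Rightarrow>\<^sub>0 'k::comm_monoid_add"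
  obtains q r where "p = q + r" "keys q \<subseteq> keys p - U" "keys r \<subseteq> U \<inter> keys p"
proof
  let ?f = "\<lambda>K. \<Sum>a\<in>K. single a (lookup p a)"
  have "p = ?f (keys p)" by (rule poly_mapping_sum_single)
  also have "\<dots> = ?f (keys p - U) + ?f (U \<inter> keys p)"
    by (subst sum.union_disjoint[symmetric]) (auto intro!: sum.cong)
  finally show "p = ?f (keys p - U) + ?f (U \<inter> keys p)" .
  show "keys (?f (keys p - U)) \<subseteq> keys p - U"
    "keys (?f (U \<inter> keys p)) \<subseteq> U \<inter> keys p"
    by (intro keys_sum_subset; auto)+
qed

text \<open>Each ideal is replaced by the space of its polynomials with support in
  \<open>S - U\<close>. Strict steps stay strict: clearing the denominator of a new element gives a
  polynomial, and its terms in \<open>U\<close> may be dropped because all ideals of the chain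
  contain them.\<close>

lemma ideal_chain_bound:
  fixes J :: "nat \<Rightarrow> (('v, 'k::field) mpoly \<times> ('v, 'k) mpoly) set set"
  assumes V: "finite V" and U: "upset V U" and S: "upset V S" "U \<subseteq> S" "finite (S - U)"
    and J: "\<And>i. i \<le> n \<Longrightarrow> ideal (J i) (loc V) \<and> monomial_ideal V U \<subseteq> J i \<and> J i \<subseteq> monomial_ideal V S"
    and chain: "\<And>i. i < n \<Longrightarrow> J i \<subset> J (Suc i)"
  shows "n \<le> card (S - U)"
proof -
  define W where "W i = {p :: ('v, 'k) mpoly. keys p \<subseteq> S - U \<and> node_frac V p 1 \<in> J i}" for i
  have pol: "p \<in> polys V" if "keys p \<subseteq> S" for p :: "('v, 'k) mpoly"
    using upset_polys[OF S(1) that] .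
  show ?thesis
  proof (rule mpoly_subspace_chain[OF S(3), of n W])
    fix i assume i: "i \<le> n"
    note I = conjunct1[OF J[OF i]]
    show "mpoly_vs.subspace (W i)"
    proof (rule mpoly_vs.subspaceI)
      show "0 \<in> W i" using ideal_zero[OF I] by (simp add: W_def loc_zero)
      fix p q assume pq: "p \<in> W i" "q \<in> W i"
      then have k: "keys p \<subseteq> S - U" "keys q \<subseteq> S - U" by (simp_all add: W_def)
      then have "p \<in> polys V" "q \<in> polys V" using pol by blast+
      then show "p + q \<in> W i" using pq ideal_add[OF I, of "node_frac V p 1" "node_frac V q 1"] keys_add_subset[OF k]
        by (simp add: W_def frac_add_one)
    next
      fix c :: 'k and p assume p: "p \<in> W i"
      then have k: "keys p \<subseteq> S - U" by (simp add: W_def)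
      have c: "single 0 c \<in> polys V" "p \<in> polys V" using pol k by (auto simp: polys_iff)
      have "node_frac V (single 0 c) 1 \<otimes>\<^bsub>loc V\<^esub> node_frac V p 1 \<in> J i"
        using p c by (intro ideal.I_l_closed[OF I]) (auto simp: W_def)
      then show "mscale c p \<in> W i" using keys_mscale[OF k] c by (simp add: W_def loc_mult mscale_def)
    qed
  next
    fix i assume i: "i < n"
    then have Ji: "ideal (J i) (loc V)" "monomial_ideal V U \<subseteq> J i"
      and Jn: "ideal (J (Suc i)) (loc V)" "monomial_ideal V U \<subseteq> J (Suc i)" "J (Suc i) \<subseteq> monomial_ideal V S"
      using J[of i] J[of "Suc i"] by auto
    obtain x where x: "x \<in> J (Suc i)" "x \<notin> J i" using chain[OF i] by blast
    obtain p s where p: "x = node_frac V p s" "keys p \<subseteq> S" "p \<in> polys V" "s \<in> denoms V"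
      using x(1) Jn(3) S(1) by (meson monomial_ideal_cases subsetD)
    have p1: "node_frac V p 1 \<in> J (Suc i)"
    proof -
      have "node_frac V p 1 = node_frac V s 1 \<otimes>\<^bsub>loc V\<^esub> x"
        using p by (auto simp: loc_mult frac_eq_iff)
      then show ?thesis using ideal.I_l_closed[OF Jn(1) x(1)] p(4) by auto
    qed
    have p2: "node_frac V p 1 \<notin> J i"
      using x(2) ideal.I_l_closed[OF Ji(1), of "node_frac V p 1" "node_frac V 1 s"] p(4) 
      unfolding p(1) frac_mult_one[OF p(3,4)] by auto
    obtain q r where qr: "p = q + r" "keys q \<subseteq> keys p - U" "keys r \<subseteq> U \<inter> keys p"
      by (rule split_keys)
    then have qS: "keys q \<subseteq> S - U" and rU: "keys r \<subseteq> U" using p(2) by auto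
    have pl: "q \<in> polys V" "r \<in> polys V" "- r \<in> polys V" using pol[of q] qS upset_polys[OF U rU] by auto
    have r: "node_frac V r 1 \<in> monomial_ideal V U" "node_frac V (- r) 1 \<in> monomial_ideal V U"
      using rU by (auto intro!: monomial_idealI)
    have "node_frac V q 1 = node_frac V p 1 \<oplus>\<^bsub>loc V\<^esub> node_frac V (- r) 1"
      using p(3) pl by (simp add: frac_add_one qr(1))
    then have "q \<in> W (Suc i)" using ideal_add[OF Jn(1) p1] r(2) Jn(2) qS by (auto simp: W_def)
    moreover have "q \<notin> W i"
    proof
      assume "q \<in> W i"
      then have "node_frac V q 1 \<oplus>\<^bsub>loc V\<^esub> node_frac V r 1 \<in> J i"
        using r(1) Ji by (intro ideal_add[OF Ji(1)]) (auto simp: W_def)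
      then show False using p2 pl by (simp add: frac_add_one qr(1))
    qed
    moreover have "W i \<subseteq> W (Suc i)" using chain[OF i] by (auto simp: W_def)
    ultimately show "W i \<subset> W (Suc i)" by blast
  qed (auto simp: W_def)
qed

text \<open>The monomial chain of \<open>upset_chain\<close> attains the value, and
  \<open>ideal_chain_bound\<close> limits all chains, also those of ideals that are not
  monomial.\<close>

lemma module_length_monomial:
  fixes I :: "(('v, 'k::field) mpoly \<times> ('v, 'k) mpoly) set set"
  assumes V: "finite V" and U: "upset V U" and S: "upset V S" "U \<subseteq> S" "finite (S - U)"
  shows "module_length (loc V) (subquotient (loc V) I (monomial_ideal V U) (monomial_ideal V S)) = enat (card (S - U))"
proof -
  let ?R = "loc V :: (('v, 'k) mpoly \<times> ('v, 'k) mpoly) set ring"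
  interpret cring ?R by (rule cring_loc)
  let ?P = "\<lambda>n. \<exists>J. (\<forall>i\<le>n. ideal (J i) ?R \<and> monomial_ideal V U \<subseteq> J i \<and> J i \<subseteq> monomial_ideal V S) \<and>
     (\<forall>i<n. J i \<subset> J (Suc i))"
  have "?P (card (S - U))"
  proof -
    obtain C where C: "\<forall>i\<le>card (S - U). upset V (C i) \<and> U \<subseteq> C i \<and> C i \<subseteq> S" "\<forall>i<card (S - U). C i \<subset> C (Suc i)"
      using upset_chain[OF V U S] by blast
    show ?thesis
    proof (intro exI[of _ "\<lambda>i. monomial_ideal V (C i)"] conjI allI impI)
      fix i assume "i \<le> card (S - U)"
      then show "ideal (monomial_ideal V (C i)) ?R" "monomial_ideal V U \<subseteq> monomial_ideal V (C i)"
        "monomial_ideal V (C i) \<subseteq> monomial_ideal V S"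
        using C(1) by (auto intro!: ideal_monomial_ideal monomial_ideal_mono)
    next
      fix i assume "i < card (S - U)"
      then show "monomial_ideal V (C i) \<subset> monomial_ideal V (C (Suc i))"
        using C by (intro monomial_ideal_strict[OF V]) auto
    qed
  qed
  moreover have "n \<le> card (S - U)" if "?P n" for n
    using that ideal_chain_bound[OF V U S] by blast
  ultimately show ?thesis
    unfolding module_length_subquotient[OF ideal_monomial_ideal[OF U] ideal_monomial_ideal[OF S(1)] monomial_ideal_mono[OF S(2)]]
    by (intro antisym SUP_least SUP_upper) auto
qed

lemma keys_single_mult:
  fixes p :: "('v, 'k::field) mpoly"
  assumes "u \<in> keys p"
  shows "u + w \<in> keys (single w 1 * p)"
proof -
  have "lookup (single w 1 * p) (u + w) = (\<Sum>b\<in>keys p. if b = u then lookup p b else 0)"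
    unfolding lookup_times by (simp add: add.commute[of w] cong: if_cong)
  also have "\<dots> = lookup p u" using assms by (simp add: sum.delta')
  finally show ?thesis using assms by (simp add: in_keys_iff)
qed

text \<open>Multiplication by one monomial merely shifts the support, so nothing cancels and
  annihilation modulo the next power can be read term by term. Conversely, the finitely many terms
  of \<open>p\<close> admit a common degree bound.\<close>

lemma saturated_iff:
  fixes p s :: "('v, 'k::field) mpoly"
  assumes V: "finite V" and E: "E \<subseteq> Pow V" and p: "keys p \<subseteq> power_monomials V E t" and s: "s \<in> denoms V"
  shows "(\<exists>k. \<forall>a\<in>monomial_ideal V (high_monomials V k). a \<otimes>\<^bsub>loc V\<^esub> node_frac V p s \<in> monomial_ideal V (power_monomials V E (Suc t)))
    \<longleftrightarrow> keys p \<subseteq> saturated_monomials V E t"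
proof
  note up = upset_power_monomials[OF V E]
  have pp: "p \<in> polys V" using upset_polys[OF up p] .
  {
    assume "\<exists>k. \<forall>a\<in>monomial_ideal V (high_monomials V k). a \<otimes>\<^bsub>loc V\<^esub> node_frac V p s \<in> monomial_ideal V (power_monomials V E (Suc t))"
    then obtain k where k: "\<And>a. a \<in> monomial_ideal V (high_monomials V k) \<Longrightarrow> a \<otimes>\<^bsub>loc V\<^esub> node_frac V p s \<in> monomial_ideal V (power_monomials V E (Suc t))"
      by blast
    have "u + w \<in> power_monomials V E (Suc t)" if u: "u \<in> keys p" and w: "w \<in> monomials V" "mdeg V w \<ge> k" for u w
    proof -
      have wp: "single w (1::'k) \<in> polys V" using w by (simp add: polys_iff)
      have "node_frac V (single w (1::'k)) 1 \<in> monomial_ideal V (high_monomials V k)"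
        using w by (intro monomial_idealI) (auto simp: high_monomials_def)
      from k[OF this] have "keys (single w 1 * p) \<subseteq> power_monomials V E (Suc t)"
        using wp pp s by (simp add: loc_mult monomial_ideal_iff[OF V up])
      then show ?thesis using keys_single_mult[OF u] by blast
    qed
    then show "keys p \<subseteq> saturated_monomials V E t"
      using p unfolding saturated_monomials_def by blast
  }
  {
    assume sat: "keys p \<subseteq> saturated_monomials V E t"
    then have "\<forall>u\<in>keys p. \<exists>k. \<forall>w\<in>monomials V. mdeg V w \<ge> k \<longrightarrow> u + w \<in> power_monomials V E (Suc t)"
      by (auto simp: saturated_monomials_def)
    then obtain k where k: "\<And>u w. u \<in> keys p \<Longrightarrow> w \<in> monomials V \<Longrightarrow> mdeg V w \<ge> k u \<Longrightarrow> u + w \<in> power_monomials V E (Suc t)"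
      by metis
    obtain K where K: "\<And>u. u \<in> keys p \<Longrightarrow> k u \<le> K"
      using finite_nat_set_iff_bounded_le[of "k ` keys p"] by auto
    have "a \<otimes>\<^bsub>loc V\<^esub> node_frac V p s \<in> monomial_ideal V (power_monomials V E (Suc t))" 
      if a: "a \<in> monomial_ideal V (high_monomials V K)" for a
    proof -
      obtain q r where q: "a = node_frac V q r" "keys q \<subseteq> high_monomials V K" "q \<in> polys V" "r \<in> denoms V"
        using monomial_ideal_cases[OF a upset_high_monomials] .
      have "keys (q * p) \<subseteq> power_monomials V E (Suc t)"
      proof
        fix x assume "x \<in> keys (q * p)"
        then obtain b c where bc: "x = c + b" "b \<in> keys q" "c \<in> keys p"
          using keys_mult[of q p] by (auto simp: add.commute)
        then have "b \<in> monomials V" "mdeg V b \<ge> K" using q(2) by (auto simp: high_monomials_def)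
        then show "x \<in> power_monomials V E (Suc t)" using k[OF bc(3)] K[OF bc(3)] bc(1) by auto
      qed
      then show ?thesis using q pp s by (simp add: loc_mult) (intro monomial_idealI; auto)
    qed
    then show "\<exists>k. \<forall>a\<in>monomial_ideal V (high_monomials V k). a \<otimes>\<^bsub>loc V\<^esub> node_frac V p s \<in> monomial_ideal V (power_monomials V E (Suc t))"
      by blast
  }
qed

lemma upset_saturated:
  assumes "finite V" "E \<subseteq> Pow V" shows "upset V (saturated_monomials V E t)"
  using saturated_add_monomial[OF assms] upset_power_monomials[OF assms, of t]
  unfolding upset_def by (auto simp: saturated_monomials_def)

lemma power_monomials_Suc_subset:
  assumes "finite V" "E \<subseteq> Pow V"
  shows "power_monomials V E (Suc t) \<subseteq> saturated_monomials V E t"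
proof
  fix u assume u: "u \<in> power_monomials V E (Suc t)"
  then obtain a w where a: "u = a + w" "a \<in> power_monomials V E t" "w \<in> power_monomials V E 1"
    unfolding power_monomials_Suc[of V E t] by blast
  have "w \<in> monomials V" using power_monomials_monomials[OF assms a(3)] .
  then have "u \<in> power_monomials V E t" using a power_monomials_shift by blast
  then show "u \<in> saturated_monomials V E t"
    using power_monomials_shift[OF u] unfolding saturated_monomials_def by blast
qed

text \<open>An equality of module records rather than an isomorphism: both sides modify only the
  carrier of the same quotient module, so comparing carriers is enough.\<close>

lemma local_cohomology_subquotient:
  fixes V :: "'v set"
  assumes V: "finite V" and E: "E \<subseteq> Pow V"
  defines "R \<equiv> loc V :: (('v, 'k::field) mpoly \<times> ('v, 'k) mpoly) set ring"
  shows "local_cohomology_0 R (max_ideal R) (quot_module (ideal_module R (monomial_ideal V (power_monomials V E t)))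
      (monomial_ideal V (power_monomials V E (Suc t))))
    = subquotient R (monomial_ideal V (power_monomials V E t)) (monomial_ideal V (power_monomials V E (Suc t)))
      (monomial_ideal V (saturated_monomials V E t))"
proof -
  let ?I = "monomial_ideal V (power_monomials V E t) :: (('v, 'k) mpoly \<times> ('v, 'k) mpoly) set set"
  let ?N = "monomial_ideal V (power_monomials V E (Suc t)) :: (('v, 'k) mpoly \<times> ('v, 'k) mpoly) set set"
  let ?H = "monomial_ideal V (saturated_monomials V E t) :: (('v, 'k) mpoly \<times> ('v, 'k) mpoly) set set"
  let ?Q = "quot_module (ideal_module R ?I) ?N"
  interpret cring R unfolding R_def by (rule cring_loc)
  note up = upset_power_monomials[OF V E] and us = upset_saturated[OF V E]
  have iN: "ideal ?N R" and iH: "ideal ?H R" and iI: "ideal ?I R"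
    unfolding R_def by (rule ideal_monomial_ideal[OF up] ideal_monomial_ideal[OF us])+
  have HI: "?H \<subseteq> ?I" by (rule monomial_ideal_mono) (auto simp: saturated_monomials_def)
  have carr: "carrier ?Q = (\<lambda>x. ?N +>\<^bsub>R\<^esub> x) ` ?I"
    unfolding quot_module_def by (auto simp: A_RCOSETS_def' ideal_module_def a_r_coset_def r_coset_def)
  have sm: "a \<odot>\<^bsub>?Q\<^esub> (?N +>\<^bsub>R\<^esub> x) = ?N +>\<^bsub>R\<^esub> (a \<otimes>\<^bsub>R\<^esub> x)" if "a \<in> carrier R" "x \<in> carrier R" for a x
    using coset_smult[OF iN iH monomial_ideal_mono[OF power_monomials_Suc_subset[OF V E]] that, of ?I]
    by (simp add: subquotient_def)
  have key: "(\<exists>k. \<forall>a\<in>ideal_power R (max_ideal R) k. a \<odot>\<^bsub>?Q\<^esub> (?N +>\<^bsub>R\<^esub> x) = \<zero>\<^bsub>?Q\<^esub>) \<longleftrightarrow> x \<in> ?H"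
    if x: "x \<in> ?I" for x
  proof -
    obtain p s where p: "x = node_frac V p s" "keys p \<subseteq> power_monomials V E t" "p \<in> polys V" "s \<in> denoms V"
      using monomial_ideal_cases[OF x up] .
    have xc: "x \<in> carrier R" using x iI by (meson ideal.Icarr)
    have ac: "a \<in> carrier R" if "a \<in> monomial_ideal V (high_monomials V k)" for a k
      using that ideal_monomial_ideal[OF upset_high_monomials] unfolding R_def by (meson ideal.Icarr)
    have "(\<exists>k. \<forall>a\<in>ideal_power R (max_ideal R) k. a \<odot>\<^bsub>?Q\<^esub> (?N +>\<^bsub>R\<^esub> x) = \<zero>\<^bsub>?Q\<^esub>)
      \<longleftrightarrow> (\<exists>k. \<forall>a\<in>monomial_ideal V (high_monomials V k). ?N +>\<^bsub>R\<^esub> (a \<otimes>\<^bsub>R\<^esub> x) = ?N)"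
      unfolding R_def max_ideal_power[OF V] using sm ac xc
      by (simp add: quot_module_def R_def cong: bex_cong ball_cong)
    also have "\<dots> \<longleftrightarrow> (\<exists>k. \<forall>a\<in>monomial_ideal V (high_monomials V k). a \<otimes>\<^bsub>R\<^esub> x \<in> ?N)"
      using ac xc coset_zero_iff[OF iN iH monomial_ideal_mono[OF power_monomials_Suc_subset[OF V E]]]
      by (simp cong: ball_cong)
    also have "\<dots> \<longleftrightarrow> keys p \<subseteq> saturated_monomials V E t"
      using saturated_iff[OF V E p(2,4)] by (simp add: p(1) R_def)
    also have "\<dots> \<longleftrightarrow> x \<in> ?H" using p by (simp add: monomial_ideal_iff[OF V us])
    finally show ?thesis .
  qed
  have "{X \<in> carrier ?Q. \<exists>k. \<forall>a\<in>ideal_power R (max_ideal R) k. a \<odot>\<^bsub>?Q\<^esub> X = \<zero>\<^bsub>?Q\<^esub>} = (\<lambda>x. ?N +>\<^bsub>R\<^esub> x) ` ?H"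
    unfolding carr using key HI by blast
  then show ?thesis unfolding local_cohomology_0_def subquotient_def by simp
qed

theorem length_local_cohomology:
  fixes V :: "'v set"
  assumes V: "finite V" and E: "E \<subseteq> Pow V"
  defines "R \<equiv> node_local_ring TYPE('k::field) V"
  defines "I \<equiv> edge_ideal TYPE('k) V E"
  shows "module_length R (local_cohomology_0 R (max_ideal R) (quot_module (ideal_module R (ideal_power R I t))
      (ideal_power R I (Suc t)))) = enat (card (torsion_monomials V E t))"
proof -
  have "module_length (loc V) (subquotient (loc V) (monomial_ideal V (power_monomials V E t))
     (monomial_ideal V (power_monomials V E (Suc t))) (monomial_ideal V (saturated_monomials V E t) ::
        (('v, 'k) mpoly \<times> ('v, 'k) mpoly) set set)) = enat (card (torsion_monomials V E t))"
    unfolding torsion_monomials_def[OF V E]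
    using finite_torsion_monomials[OF V E, of t, unfolded torsion_monomials_def[OF V E]]
    by (intro module_length_monomial V upset_power_monomials upset_saturated power_monomials_Suc_subset E)
  then show ?thesis
    unfolding R_def I_def edge_ideal_power[OF V E] unfolding node_local_ring_def local_cohomology_subquotient[OF V E] .
qed

section \<open>Krull dimension\<close>

lemma polys_sum: "(\<And>i. i \<in> I \<Longrightarrow> f i \<in> polys V) \<Longrightarrow> sum f I \<in> polys V"
  by (induction I rule: infinite_finite_induct) auto

lemma polys_prod: "(\<And>i. i \<in> I \<Longrightarrow> f i \<in> polys V) \<Longrightarrow> prod f I \<in> polys V"
  by (induction I rule: infinite_finite_induct) auto

lemma polys_power: "p \<in> polys V \<Longrightarrow> p ^ k \<in> polys V"
  by (induction k) auto

lemma polys_mscale: "p \<in> polys V \<Longrightarrow> mscale c p \<in> polys V"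
  unfolding polys_iff by (rule keys_mscale)

lemma mscale_mult: "mscale c (p * q) = p * mscale c q"
  by (simp add: mscale_def mult.left_commute)

text \<open>The elements \<open>a i\<close> of a strict chain of primes \<open>Q\<close> are algebraically independent: of the terms of a
  relation, those of least degree in \<open>a j\<close> survive division by a power of \<open>a j\<close> and reduction modulo \<open>Q (Suc j)\<close>.\<close>

lemma prime_chain_independent:
  fixes Q :: "nat \<Rightarrow> ('v, 'k::field) mpoly set" and a :: "nat \<Rightarrow> ('v, 'k) mpoly"
  assumes add: "\<And>i p q. i \<le> r \<Longrightarrow> p \<in> Q i \<Longrightarrow> q \<in> Q i \<Longrightarrow> p + q \<in> Q i"
    and mult: "\<And>i p q. i \<le> r \<Longrightarrow> p \<in> Q i \<Longrightarrow> q \<in> polys V \<Longrightarrow> q * p \<in> Q i"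
    and prime: "\<And>i p q. i \<le> r \<Longrightarrow> p \<in> polys V \<Longrightarrow> q \<in> polys V \<Longrightarrow> p * q \<in> Q i \<Longrightarrow> p \<in> Q i \<or> q \<in> Q i"
    and const: "\<And>i c. i \<le> r \<Longrightarrow> c \<noteq> 0 \<Longrightarrow> single 0 c \<notin> Q i"
    and chain: "\<And>i. i < r \<Longrightarrow> Q i \<subseteq> Q (Suc i)"
    and a: "\<And>i. i < r \<Longrightarrow> a i \<in> polys V \<and> a i \<in> Q (Suc i) \<and> a i \<notin> Q i"
    and j: "j \<le> r"
    and C: "finite C" "C \<noteq> {}" "\<And>c. c \<in> C \<Longrightarrow> l c \<noteq> 0"
      "\<And>c c'. c \<in> C \<Longrightarrow> c' \<in> C \<Longrightarrow> (\<And>i. j \<le> i \<Longrightarrow> i < r \<Longrightarrow> c i = c' i) \<Longrightarrow> c = c'"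
  shows "(\<Sum>c\<in>C. mscale (l c) (\<Prod>i\<in>{j..<r}. a i ^ c i)) \<notin> Q j"
  using j C
proof (induction j arbitrary: C rule: inc_induct)
  \<comment> \<open>For \<open>j = r\<close> the exponent vectors agree vacuously on the empty
    range, so \<open>C\<close> is a singleton, and the empty product leaves a nonzero
    constant.\<close>
  case base
  obtain c where "c \<in> C" using base(2) by blast
  then have "C = {c}" using base(4) by auto
  then show ?case using const[of r "l c"] base(3)[of c] by (simp add: mscale_def)
next
  case (step j)
  note C = step.prems
  let ?m = "\<lambda>k c. \<Prod>i\<in>{k..<r}. a i ^ c i"
  have jr: "j < r" "j \<le> r" "Suc j \<le> r" using step.hyps by auto
  note aj = a[OF jr(1)]
  have pm: "?m k c \<in> polys V" for k c using a by (intro polys_prod polys_power) auto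
  \<comment> \<open>Factoring out the least power \<open>a j ^ \<mu>\<close> leaves
    \<open>Y\<close>, a combination of products of later elements, plus the multiple
    \<open>a j * X\<close>.\<close>
  define \<mu> where "\<mu> = Min ((\<lambda>c. c j) ` C)"
  have mu: "\<mu> \<le> c j" if "c \<in> C" for c using that C(1) by (simp add: \<mu>_def)
  have "\<mu> \<in> (\<lambda>c. c j) ` C" unfolding \<mu>_def using C(1,2) by (intro Min_in) auto
  then obtain c0 where c0: "c0 \<in> C" "c0 j = \<mu>" by auto
  define C' where "C' = {c \<in> C. c j = \<mu>}"
  define X where "X = (\<Sum>c\<in>C - C'. mscale (l c) (a j ^ (c j - \<mu> - 1) * ?m (Suc j) c))"
  define Y where "Y = (\<Sum>c\<in>C'. mscale (l c) (?m (Suc j) c))"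
  have X: "X \<in> polys V" unfolding X_def using aj pm by (intro polys_sum polys_mscale polys_mult polys_power) auto
  have Y: "Y \<in> polys V" unfolding Y_def using pm by (intro polys_sum polys_mscale) auto
  have split: "?m j c = a j ^ c j * ?m (Suc j) c" for c
    using jr(1) by (simp add: prod.atLeast_Suc_lessThan)
  have "(\<Sum>c\<in>C. mscale (l c) (?m j c)) = (\<Sum>c\<in>C'. mscale (l c) (?m j c)) + (\<Sum>c\<in>C - C'. mscale (l c) (?m j c))"
    using C(1) by (subst sum.subset_diff[of C' C]) (auto simp: C'_def add.commute)
  also have "(\<Sum>c\<in>C'. mscale (l c) (?m j c)) = a j ^ \<mu> * Y"
    unfolding Y_def sum_distrib_left by (rule sum.cong) (auto simp: split C'_def mscale_mult)
  also have "(\<Sum>c\<in>C - C'. mscale (l c) (?m j c)) = a j ^ \<mu> * (a j * X)"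
    unfolding X_def sum_distrib_left
  proof (rule sum.cong)
    fix c assume "c \<in> C - C'"
    then have "c j > \<mu>" using mu[of c] by (auto simp: C'_def order_less_le)
    then have "c j = \<mu> + (1 + (c j - \<mu> - 1))" by simp
    then have "a j ^ c j = a j ^ \<mu> * (a j * a j ^ (c j - \<mu> - 1))" by (metis power_add power_one_right)
    then show "mscale (l c) (?m j c) = a j ^ \<mu> * (a j * mscale (l c) (a j ^ (c j - \<mu> - 1) * ?m (Suc j) c))"
      by (simp add: split mscale_def ac_simps)
  qed simp
  finally have sum: "(\<Sum>c\<in>C. mscale (l c) (?m j c)) = a j ^ \<mu> * (Y + a j * X)"
    by (simp add: distrib_left)
  have pw: "a j ^ k \<notin> Q j" for k
  proof (induction k)
    case 0
    show ?case using const[OF jr(2), of 1] by simp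
  next
    case (Suc k)
    then show ?case using prime[OF jr(2), of "a j" "a j ^ k"] aj polys_power by auto
  qed
  show ?case
  proof
    assume "(\<Sum>c\<in>C. mscale (l c) (?m j c)) \<in> Q j"
    then have "Y + a j * X \<in> Q j"
      unfolding sum using prime[OF jr(2), of "a j ^ \<mu>" "Y + a j * X"] pw aj X Y polys_power by blast
    \<comment> \<open>Since \<open>a j\<close> lies in \<open>Q (Suc j)\<close>, only
      \<open>Y\<close> remains there, and \<open>Y\<close> is a relation that the induction
      hypothesis excludes.\<close>
    then have "Y + a j * X \<in> Q (Suc j)" using chain[OF jr(1)] by blast
    moreover have "(- X) * a j \<in> Q (Suc j)" using mult[OF jr(3), of "a j" "- X"] aj X by blast
    ultimately have "(Y + a j * X) + (- X) * a j \<in> Q (Suc j)" by (rule add[OF jr(3)])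
    then have "Y \<in> Q (Suc j)" by (simp add: mult.commute)
    moreover have "Y \<notin> Q (Suc j)" unfolding Y_def
    proof (rule step.IH)
      show "finite C'" "C' \<noteq> {}" "\<And>c. c \<in> C' \<Longrightarrow> l c \<noteq> 0" using C c0 by (auto simp: C'_def)
      fix c c' assume c: "c \<in> C'" "c' \<in> C'" and eq: "\<And>i. Suc j \<le> i \<Longrightarrow> i < r \<Longrightarrow> c i = c' i"
      show "c = c'"
      proof (rule C(4))
        fix i assume "j \<le> i" "i < r"
        then show "c i = c' i" using eq[of i] c by (cases "i = j") (auto simp: C'_def)
      qed (use c in \<open>auto simp: C'_def\<close>)
    qed
    ultimately show False by blast
  qed
qed

section \<open>Counting monomials with bounded exponents\<close>

definition box :: "'v set \<Rightarrow> nat \<Rightarrow> ('v \<Rightarrow>\<^sub>0 nat) set" where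
  "box V N = {u \<in> monomials V. \<forall>v\<in>V. lookup u v \<le> N}"

lemma box_mult:
  assumes "keys p \<subseteq> box V M" "keys q \<subseteq> box V N"
  shows "keys (p * q) \<subseteq> box V (M + N)"
proof
  fix x assume "x \<in> keys (p * q)"
  then obtain u w where "x = u + w" "u \<in> box V M" "w \<in> box V N" using keys_mult[of p q] assms by blast
  then show "x \<in> box V (M + N)" by (auto simp: box_def lookup_add add_mono)
qed

lemma box_one: "keys (1 :: ('v, 'k::field) mpoly) \<subseteq> box V N"
  by (simp add: box_def)

lemma box_mono: "M \<le> N \<Longrightarrow> box V M \<subseteq> box V N"
  by (auto simp: box_def)

lemma box_power: 
  fixes p :: "('v, 'k::field) mpoly"
  shows "keys p \<subseteq> box V M \<Longrightarrow> keys (p ^ k) \<subseteq> box V (k * M)"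
  by (induction k) (simp_all add: box_one box_mult del: keys_one)

lemma box_prod:
  fixes f :: "'i \<Rightarrow> ('v, 'k::field) mpoly"
  shows "(\<And>i. i \<in> I \<Longrightarrow> keys (f i) \<subseteq> box V M) \<Longrightarrow> keys (prod f I) \<subseteq> box V (card I * M)"
  by (induction I rule: infinite_finite_induct) (simp_all add: box_one box_mult del: keys_one)

lemma exists_box:
  assumes "finite V" "finite I" "\<And>i. i \<in> I \<Longrightarrow> f i \<in> polys V"
  shows "\<exists>D. \<forall>i\<in>I. keys (f i) \<subseteq> box V D"
proof -
  let ?K = "\<Union>i\<in>I. keys (f i)"
  have "finite (mdeg V ` ?K)" using assms(2) by auto
  then obtain D where D: "\<And>u. u \<in> ?K \<Longrightarrow> mdeg V u \<le> D"
    unfolding finite_nat_set_iff_bounded_le by blast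
  have "u \<in> box V D" if "i \<in> I" "u \<in> keys (f i)" for i u
    using that D[of u] assms(3)[of i] lookup_le_mdeg[OF assms(1), of _ u]
    by (auto simp: box_def polys_iff intro: order_trans)
  then show ?thesis by blast
qed

lemma exponent_bound:
  fixes r n K :: nat
  assumes "\<And>d. d \<ge> 1 \<Longrightarrow> d ^ r \<le> (d * K + 1) ^ n"
  shows "r \<le> n"
proof (rule ccontr)
  assume "\<not> r \<le> n"
  \<comment> \<open>As \<open>(d * K + 1) ^ n \<le> (K + 1) ^ n * d ^ n\<close> for
    \<open>d \<ge> 1\<close>, any \<open>d\<close> above \<open>(K + 1) ^ n\<close> refutes
    \<open>r > n\<close>.\<close>
  define d where "d = (K + 1) ^ n + 1"
  have "d * d ^ n \<le> d ^ r" using \<open>\<not> r \<le> n\<close> power_increasing[of "Suc n" r d] by (simp add: d_def)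
  also have "\<dots> \<le> (d * K + 1) ^ n" using assms[of d] by (simp add: d_def)
  also have "\<dots> \<le> (d * (K + 1)) ^ n" by (rule power_mono) (simp_all add: d_def)
  also have "\<dots> = (K + 1) ^ n * d ^ n" by (simp only: power_mult_distrib mult.commute)
  finally have "d \<le> (K + 1) ^ n" by (simp add: d_def)
  then show False by (simp add: d_def)
qed

text \<open>A dimension count: the \<open>d ^ r\<close> products of the \<open>a i\<close> with
  exponents below \<open>d\<close> are linearly independent by
  \<open>prime_chain_independent\<close>, and they live in a box whose side is linear in
  \<open>d\<close>. Comparing growth in \<open>d\<close> bounds \<open>r\<close> by the number of
  nodes.\<close>

lemma prime_chain_bound:
  fixes Q :: "nat \<Rightarrow> ('v, 'k::field) mpoly set" and a :: "nat \<Rightarrow> ('v, 'k) mpoly"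
  assumes V: "finite V"
    and zero: "0 \<in> Q 0"
    and add: "\<And>i p q. i \<le> r \<Longrightarrow> p \<in> Q i \<Longrightarrow> q \<in> Q i \<Longrightarrow> p + q \<in> Q i"
    and mult: "\<And>i p q. i \<le> r \<Longrightarrow> p \<in> Q i \<Longrightarrow> q \<in> polys V \<Longrightarrow> q * p \<in> Q i"
    and prime: "\<And>i p q. i \<le> r \<Longrightarrow> p \<in> polys V \<Longrightarrow> q \<in> polys V \<Longrightarrow> p * q \<in> Q i \<Longrightarrow> p \<in> Q i \<or> q \<in> Q i"
    and const: "\<And>i c. i \<le> r \<Longrightarrow> c \<noteq> 0 \<Longrightarrow> single 0 c \<notin> Q i"
    and chain: "\<And>i. i < r \<Longrightarrow> Q i \<subseteq> Q (Suc i)"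
    and a: "\<And>i. i < r \<Longrightarrow> a i \<in> polys V \<and> a i \<in> Q (Suc i) \<and> a i \<notin> Q i"
  shows "r \<le> card V"
proof -
  obtain D where D: "\<And>i. i < r \<Longrightarrow> keys (a i) \<subseteq> box V D"
    using exists_box[OF V, of "{..<r}" a] a by auto
  have "d ^ r \<le> (d * (r * D) + 1) ^ card V" for d
  proof -
    let ?E = "{..<r} \<rightarrow>\<^sub>E {..<d}" and ?m = "\<lambda>c. \<Prod>i\<in>{0..<r}. a i ^ c i"
    have finE: "finite ?E" by (intro finite_PiE) auto
    have ind: "(\<Sum>c\<in>C. mscale (l c) (?m c)) \<noteq> 0" if "C \<subseteq> ?E" "C \<noteq> {}" "\<And>c. c \<in> C \<Longrightarrow> l c \<noteq> 0" for C l
    proof -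
      have "(\<Sum>c\<in>C. mscale (l c) (?m c)) \<notin> Q 0"
      proof (rule prime_chain_independent[where r = r and Q = Q and a = a and V = V, OF add mult prime const chain a])
        show "finite C" by (rule finite_subset[OF that(1) finE])
        fix c c' assume "c \<in> C" "c' \<in> C" and eq: "\<And>i. 0 \<le> i \<Longrightarrow> i < r \<Longrightarrow> c i = c' i"
        then have "c \<in> ?E" "c' \<in> ?E" by (simp_all only: subsetD[OF that(1)])
        then show "c = c'" using eq by (intro PiE_ext) auto
      qed (use that in auto)
      then show ?thesis using zero by metis
    qed
    have inj: "inj_on ?m ?E"
    proof (rule inj_onI, rule ccontr)
      fix c c' assume c: "c \<in> ?E" "c' \<in> ?E" "?m c = ?m c'" "c \<noteq> c'"
      \<comment> \<open>Two equal products would satisfy the relation with coefficients 1 and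
        -1.\<close>
      have "(\<Sum>x\<in>{c, c'}. mscale (if x = c then 1 else - 1) (?m x)) = 0"
        using c(3,4) by (simp add: mscale_def single_uminus)
      then show False using ind[of "{c, c'}" "\<lambda>x. if x = c then 1 else - 1"] c(1,2) by simp
    qed
    have indep: "mpoly_vs.independent (?m ` ?E)"
    proof
      assume "mpoly_vs.dependent (?m ` ?E)"
      then obtain u where u: "\<exists>v\<in>?m ` ?E. u v \<noteq> 0" "(\<Sum>v\<in>?m ` ?E. mscale (u v) v) = 0"
        using mpoly_vs.dependent_finite[of "?m ` ?E"] finE by blast
      let ?C = "{c \<in> ?E. u (?m c) \<noteq> 0}"
      have "(\<Sum>v\<in>?m ` ?E. mscale (u v) v) = (\<Sum>c\<in>?E. mscale (u (?m c)) (?m c))"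
        by (subst sum.reindex[OF inj]) simp
      also have "\<dots> = (\<Sum>c\<in>?C. mscale (u (?m c)) (?m c))"
        using finE by (intro sum.mono_neutral_right) auto
      finally have "(\<Sum>c\<in>?C. mscale (u (?m c)) (?m c)) = 0" unfolding u(2) ..
      moreover have "?C \<noteq> {}" using u(1) by auto
      moreover have "(\<Sum>c\<in>?C. mscale (u (?m c)) (?m c)) \<noteq> 0" if "?C \<noteq> {}"
        by (rule ind[OF _ that]) auto
      ultimately show False by simp
    qed
    have "keys (?m c) \<subseteq> box V (d * (r * D))" if c: "c \<in> ?E" for c
    proof -
      have "keys (?m c) \<subseteq> box V (card {0..<r} * (d * D))"
      proof (rule box_prod)
        fix i assume i: "i \<in> {0..<r}"
        then have "c i < d" using c by auto
        then have "box V (c i * D) \<subseteq> box V (d * D)" by (intro box_mono) simp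
        moreover have "keys (a i ^ c i) \<subseteq> box V (c i * D)" using D i by (intro box_power) auto
        ultimately show "keys (a i ^ c i) \<subseteq> box V (d * D)" by blast
      qed
      then show ?thesis by (simp add: ac_simps)
    qed
    then have "card (?m ` ?E) \<le> card (box V (d * (r * D)))"
      using indep bounded_monomials(1)[OF V] by (intro mpoly_independent_card) (auto simp: box_def)
    also have "\<dots> \<le> Suc (d * (r * D)) ^ card V" unfolding box_def by (rule bounded_monomials(2)[OF V])
    also have "card (?m ` ?E) = d ^ r" by (simp add: card_image[OF inj] card_PiE)
    finally show ?thesis by simp
  qed
  then show ?thesis by (rule exponent_bound)
qed

text \<open>The primes are contracted to the polynomial ring, giving the sets \<open>Q i\<close>. A
  fraction and its numerator differ by a unit, so every gap of the chain contains a polynomial;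
  nonzero constants are units and avoid all \<open>Q i\<close>.\<close>

lemma krull_dim_upper:
  fixes P :: "nat \<Rightarrow> (('v, 'k::field) mpoly \<times> ('v, 'k) mpoly) set set"
  assumes V: "finite V" and P: "\<And>i. i \<le> r \<Longrightarrow> primeideal (P i) (loc V)" and chain: "\<And>i. i < r \<Longrightarrow> P i \<subset> P (Suc i)"
  shows "r \<le> card V"
proof -
  let ?R = "loc V :: (('v, 'k) mpoly \<times> ('v, 'k) mpoly) set ring"
  interpret cring ?R by (rule cring_loc)
  have id: "ideal (P i) ?R" if "i \<le> r" for i using P[OF that] by (rule primeideal.axioms)
  define Q where "Q i = {p \<in> polys V. node_frac V p 1 \<in> P i}" for i
  have "\<exists>a. i < r \<longrightarrow> a \<in> polys V \<and> a \<in> Q (Suc i) \<and> a \<notin> Q i" for i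
  proof (cases "i < r")
    case True
    then have I: "ideal (P i) ?R" "ideal (P (Suc i)) ?R" using id[of i] id[of "Suc i"] by auto
    obtain x where x: "x \<in> P (Suc i)" "x \<notin> P i" using chain[OF True] by blast
    obtain p s where p: "x = node_frac V p s" "p \<in> polys V" "s \<in> denoms V"
      using x(1) ideal.Icarr[OF I(2)] loc_cases by metis
    have "node_frac V p 1 = node_frac V s 1 \<otimes>\<^bsub>?R\<^esub> x"
      using p by (auto simp: loc_mult frac_eq_iff)
    then have "node_frac V p 1 \<in> P (Suc i)" using ideal.I_l_closed[OF I(2) x(1)] p(3) by auto
    moreover have "node_frac V p 1 \<notin> P i"
      using x(2) ideal.I_l_closed[OF I(1), of "node_frac V p 1" "node_frac V 1 s"] p(3)
      unfolding p(1) frac_mult_one[OF p(2,3)] by auto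
    ultimately show ?thesis using p(2) by (auto simp: Q_def)
  qed simp
  then obtain a where a: "\<And>i. i < r \<Longrightarrow> a i \<in> polys V \<and> a i \<in> Q (Suc i) \<and> a i \<notin> Q i" by metis
  show ?thesis
  proof (rule prime_chain_bound[OF V, of Q r a])
    show "0 \<in> Q 0" using ideal_zero[OF id[of 0]] by (simp add: Q_def loc_zero)
    fix i p q assume i: "i \<le> r"
    show "p + q \<in> Q i" if "p \<in> Q i" "q \<in> Q i"
      using that ideal_add[OF id[OF i], of "node_frac V p 1" "node_frac V q 1"] by (auto simp: Q_def loc_add)
    show "q * p \<in> Q i" if "p \<in> Q i" "q \<in> polys V"
      using that ideal.I_l_closed[OF id[OF i], of "node_frac V p 1" "node_frac V q 1"] by (auto simp: Q_def loc_mult)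
    show "p \<in> Q i \<or> q \<in> Q i" if "p \<in> polys V" "q \<in> polys V" "p * q \<in> Q i"
      using that primeideal.I_prime[OF P[OF i], of "node_frac V p 1" "node_frac V q 1"] by (auto simp: Q_def loc_mult)
    fix c :: 'k assume c: "c \<noteq> 0"
    have pc: "single 0 c \<in> polys V" "single 0 (inverse c) \<in> polys V" by (auto simp: polys_iff)
    show "single 0 c \<notin> Q i"
    proof
      assume "single 0 c \<in> Q i"
      then have "node_frac V (single 0 (inverse c)) 1 \<otimes>\<^bsub>?R\<^esub> node_frac V (single 0 c) 1 \<in> P i"
        using pc by (intro ideal.I_l_closed[OF id[OF i]]) (auto simp: Q_def)
      then have "\<one>\<^bsub>?R\<^esub> \<in> P i" using pc c by (simp add: loc_mult mult_single loc_one)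
      then show False using ideal.one_imp_carrier[OF id[OF i]] primeideal.I_notcarr[OF P[OF i]] by simp
    qed
  next
    fix i assume "i < r"
    then show "Q i \<subseteq> Q (Suc i)" using chain by (auto simp: Q_def)
  qed (rule a)
qed

section \<open>A chain of monomial primes\<close>

definition meeting_monomials :: "'v set \<Rightarrow> 'v set \<Rightarrow> ('v \<Rightarrow>\<^sub>0 nat) set" where
  "meeting_monomials V W = {u \<in> monomials V. \<exists>v\<in>W. lookup u v \<noteq> 0}"

lemma upset_meeting_monomials: "upset V (meeting_monomials V W)"
  by (auto simp: upset_def meeting_monomials_def lookup_add)

text \<open>Remove from \<open>p\<close> and \<open>q\<close> the terms that involve
  \<open>W\<close>. The product of the remainders has no term involving \<open>W\<close>, yet it
  differs from \<open>p * q\<close> only by terms that do. So it is 0, and one remainder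
  vanishes.\<close>

lemma meeting_monomials_prime:
  fixes p q :: "('v, 'k::field) mpoly"
  assumes "p \<in> polys V" "q \<in> polys V" "keys (p * q) \<subseteq> meeting_monomials V W"
  shows "keys p \<subseteq> meeting_monomials V W \<or> keys q \<subseteq> meeting_monomials V W"
proof -
  let ?U = "meeting_monomials V W"
  note up = upset_meeting_monomials[of V W]
  obtain p1 p2 where p: "p = p1 + p2" "keys p1 \<subseteq> keys p - ?U" "keys p2 \<subseteq> ?U \<inter> keys p"
    by (rule split_keys)
  obtain q1 q2 where q: "q = q1 + q2" "keys q1 \<subseteq> keys q - ?U" "keys q2 \<subseteq> ?U \<inter> keys q"
    by (rule split_keys)
  have pl: "p1 \<in> polys V" "q1 \<in> polys V" "p2 \<in> polys V" "q2 \<in> polys V"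
    using p(2,3) q(2,3) assms(1,2) unfolding polys_iff by blast+
  have eq: "p1 * q1 = p * q + (- (q * p2) + - (p1 * q2))" unfolding p(1) q(1) by (simp add: algebra_simps)
  have "keys (- (q * p2)) \<subseteq> ?U" unfolding keys_uminus
    by (rule keys_mult_upset[OF up _ assms(2)]) (use p(3) in blast)
  moreover have "keys (- (p1 * q2)) \<subseteq> ?U" unfolding keys_uminus
    by (rule keys_mult_upset[OF up _ pl(1)]) (use q(3) in blast)
  ultimately have sub: "keys (p1 * q1) \<subseteq> ?U"
    unfolding eq by (intro keys_add_subset assms(3))
  have "keys (p1 * q1) \<inter> ?U = {}"
  proof -
    have "u + w \<notin> ?U" if "u \<in> keys p1" "w \<in> keys q1" for u w
    proof -
      have "u \<in> monomials V - ?U" "w \<in> monomials V - ?U" using that p(2) q(2) assms(1,2) by (auto simp: polys_iff)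
      then show ?thesis by (auto simp: meeting_monomials_def lookup_add)
    qed
    then show ?thesis using keys_mult[of p1 q1] by blast
  qed
  then have "p1 * q1 = 0" using sub by (metis inf.absorb1 keys_eq_empty)
  then have "p1 = 0 \<or> q1 = 0" by (rule mpoly_no_zero_divisors)
  then show ?thesis using p q by auto
qed

lemma primeideal_meeting:
  fixes V :: "'v set"
  assumes V: "finite V"
  shows "primeideal (monomial_ideal V (meeting_monomials V W)) (loc V :: (('v, 'k::field) mpoly \<times> ('v, 'k) mpoly) set ring)"
proof (rule primeidealI)
  let ?R = "loc V :: (('v, 'k) mpoly \<times> ('v, 'k) mpoly) set ring"
  let ?I = "monomial_ideal V (meeting_monomials V W) :: (('v, 'k) mpoly \<times> ('v, 'k) mpoly) set set"
  note up = upset_meeting_monomials[of V W]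
  show "ideal ?I ?R" by (rule ideal_monomial_ideal[OF up])
  show "cring ?R" by (rule cring_loc)
  have "node_frac V 1 1 \<notin> ?I" using monomial_ideal_iff[OF V up, of 1 1] by (simp add: meeting_monomials_def)
  then show "carrier ?R \<noteq> ?I" by (metis frac_in polys_1 denoms_1)
  fix x y assume xy: "x \<in> carrier ?R" "y \<in> carrier ?R" "x \<otimes>\<^bsub>?R\<^esub> y \<in> ?I"
  obtain p s where p: "x = node_frac V p s" "p \<in> polys V" "s \<in> denoms V" using loc_cases[OF xy(1)] .
  obtain q t where q: "y = node_frac V q t" "q \<in> polys V" "t \<in> denoms V" using loc_cases[OF xy(2)] .
  have "keys (p * q) \<subseteq> meeting_monomials V W"
    using xy(3) p q by (simp add: loc_mult monomial_ideal_iff[OF V up])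
  then show "x \<in> ?I \<or> y \<in> ?I"
    using meeting_monomials_prime[OF p(2) q(2)] monomial_idealI p(1,3) q(1,3) by metis
qed

theorem krull_dim_node_local_ring:
  fixes V :: "'v set"
  assumes V: "finite V"
  shows "krull_dim (node_local_ring TYPE('k::field) V) = enat (card V)"
proof -
  let ?R = "loc V :: (('v, 'k) mpoly \<times> ('v, 'k) mpoly) set ring"
  let ?P = "\<lambda>n. \<exists>P. (\<forall>i\<le>n. primeideal (P i) ?R) \<and> (\<forall>i<n. P i \<subset> P (Suc i))"
  obtain f where f: "bij_betw f {0..<card V} V" using ex_bij_betw_nat_finite[OF V] by blast
  \<comment> \<open>The nodes are adjoined one at a time, so \<open>P i\<close> is generated by the
    first \<open>i\<close> of them and \<open>P 0\<close> is the zero ideal.\<close>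
  define P where "P i = (monomial_ideal V (meeting_monomials V (f ` {0..<i})) :: (('v, 'k) mpoly \<times> ('v, 'k) mpoly) set set)" for i
  have "P i \<subset> P (Suc i)" if i: "i < card V" for i
    unfolding P_def
  proof (rule monomial_ideal_strict[OF V upset_meeting_monomials upset_meeting_monomials])
    have "f i \<notin> f ` {0..<i}" using f i unfolding bij_betw_def inj_on_def by fastforce
    moreover have "f i \<in> V" using f i by (auto simp: bij_betw_def)
    ultimately have "single (f i) 1 \<in> meeting_monomials V (f ` {0..<Suc i})"
      "single (f i) 1 \<notin> meeting_monomials V (f ` {0..<i})"
      by (auto simp: meeting_monomials_def lookup_single when_def)
    moreover have "meeting_monomials V (f ` {0..<i}) \<subseteq> meeting_monomials V (f ` {0..<Suc i})"
      by (auto simp: meeting_monomials_def)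
    ultimately show "meeting_monomials V (f ` {0..<i}) \<subset> meeting_monomials V (f ` {0..<Suc i})" by blast
  qed
  then have "?P (card V)" using primeideal_meeting[OF V] by (intro exI[of _ P]) (auto simp: P_def)
  moreover have "n \<le> card V" if "?P n" for n using that krull_dim_upper[OF V] by blast
  ultimately show ?thesis unfolding krull_dim_def node_local_ring_def
    by (intro antisym SUP_least SUP_upper) auto
qed

theorem proposition6p2:
  fixes V :: "'v set" and E :: "'v set set" and m :: nat
  assumes "hypergraph V E"
    and "m \<ge> 1"
    and "uniform m E"
    and "\<forall>v\<in>V. \<not> isolated_node E v"
    and "\<forall>W\<in>connected_components V E. properly_connected m (induced_edges E W)"
  shows "j_multiplicity (node_local_ring TYPE('k::field) V) (edge_ideal TYPE('k) V E) \<noteq> 0 \<longleftrightarrow>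
    (\<forall>W\<in>connected_components V E. \<forall>x\<in>W. \<forall>y\<in>W. pivot_equivalent V E x y)"
proof -
  have V: "finite V" and E: "E \<subseteq> Pow V" using assms(1) by (auto simp: hypergraph_def)
  obtain L where L: "(\<lambda>t. ereal (real (card (torsion_monomials V E t))) / ereal (real t ^ (card V - 1))) \<longlonglongrightarrow> L"
    and iff: "L \<noteq> 0 \<longleftrightarrow> (\<forall>W\<in>connected_components V E. \<forall>x\<in>W. \<forall>y\<in>W. pivot_equivalent V E x y)"
    using torsion_limit_pivot[OF assms] by blast
  \<comment> \<open>The Krull dimension identifies the exponent of the definition with
    \<open>card V - 1\<close>. The factorial is a positive real, so the product vanishes exactly
    when \<open>L\<close> does, even if \<open>L\<close> is infinite.\<close>
  have "j_multiplicity (node_local_ring TYPE('k) V) (edge_ideal TYPE('k) V E) = ereal (fact (card V - 1)) * L"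
    unfolding j_multiplicity_def krull_dim_node_local_ring[OF V] length_local_cohomology[OF V E] Let_def
    using limI[OF L] by simp
  then show ?thesis unfolding iff[symmetric] by simp
qed

end
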